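(* Let $l\ge 1$ be an integer and let $(R,\mathfrak{m})$ be an existentially closed model of $\mathcal{A}rt_l$ (or an existentially closed model of $\mathcal{A}rt'_l$). Then the following hold. (i) The residue field $\kappa=R/\mathfrak{m}$ is algebraically closed. (ii) $R$ is Gorenstein. (iii) The length of $R$ is exactly $l$.
   Context: Rings are commutative with identity. The language is the language of rings $\langle +,\cdot,-;0,1\rangle$. $\mathcal{A}rt_l$ (respectively $\mathcal{A}rt'_l$) is the first-order theory whose models are exactly the Artinian local rings of length at most $l$ (respectively, of length exactly $l$), where length means length as a module over itself. A model $R$ of a theory $T$ is existentially closed if every existential ($\exists_1$) sentence with parameters from $R$ which holds in some model $S$ of $T$ containing $R$ as a subring already holds in $R$. An Artinian local ring is Gorenstein if its socle (the annihilator of the maximal ideal) is a principal ideal. *)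

theory Defs
  imports "HOL-Algebra.Algebraic_Closure" "HOL-Library.Extended_Nat"
begin

definition artinian_ring :: "('a, 'm) ring_scheme \<Rightarrow> bool" where
  "artinian_ring R \<longleftrightarrow> cring R \<and>
     (\<forall>I :: nat \<Rightarrow> 'a set. (\<forall>n. ideal (I n) R) \<and> (\<forall>n. I (Suc n) \<subseteq> I n)
        \<longrightarrow> (\<exists>N. \<forall>n\<ge>N. I n = I N))"

definition local_ring :: "('a, 'm) ring_scheme \<Rightarrow> bool" where
  "local_ring R \<longleftrightarrow> cring R \<and> (\<exists>!\<mm>. maximalideal \<mm> R)"

definition artinian_local_ring :: "('a, 'm) ring_scheme \<Rightarrow> bool" where
  "artinian_local_ring R \<longleftrightarrow> artinian_ring R \<and> local_ring R"

text \<open>The submodules of \<open>R\<close>, viewed as a module over itself, are its ideals. The length is the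
  supremum of the numbers \<open>n\<close> of strict inclusions in chains of ideals
  \<open>I 0 \<subset> I 1 \<subset> \<dots> \<subset> I n\<close>.\<close>

definition ring_length :: "('a, 'm) ring_scheme \<Rightarrow> enat" where
  "ring_length R = (SUP n \<in> {n. \<exists>I :: nat \<Rightarrow> 'a set.
     (\<forall>i\<le>n. ideal (I i) R) \<and> (\<forall>i<n. I i \<subset> I (Suc i))}. enat n)"

text \<open>Only meaningful when \<open>R\<close> is local.\<close>

definition max_ideal :: "('a, 'm) ring_scheme \<Rightarrow> 'a set" where
  "max_ideal R = (THE \<mm>. maximalideal \<mm> R)"

definition annihilator :: "('a, 'm) ring_scheme \<Rightarrow> 'a set \<Rightarrow> 'a set" where
  "annihilator R A = {x \<in> carrier R. \<forall>a\<in>A. x \<otimes>\<^bsub>R\<^esub> a = \<zero>\<^bsub>R\<^esub>}"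

definition socle :: "('a, 'm) ring_scheme \<Rightarrow> 'a set" where
  "socle R = annihilator R (max_ideal R)"

definition gorenstein :: "('a, 'm) ring_scheme \<Rightarrow> bool" where
  "gorenstein R \<longleftrightarrow> artinian_local_ring R \<and> principalideal (socle R) R"

datatype (tparams: 'p) ring_term =
    Var nat
  | Param 'p
  | Zero
  | One
  | Add "'p ring_term" "'p ring_term"
  | Mul "'p ring_term" "'p ring_term"
  | Neg "'p ring_term"

datatype (qparams: 'p) qf_formula =
    FEq "'p ring_term" "'p ring_term"
  | FNot "'p qf_formula"
  | FAnd "'p qf_formula" "'p qf_formula"
  | FOr "'p qf_formula" "'p qf_formula"

text \<open>\<open>h\<close> interprets the parameters and \<open>v\<close> the variables.\<close>

primrec term_val ::
  "('s, 'm) ring_scheme \<Rightarrow> ('p \<Rightarrow> 's) \<Rightarrow> (nat \<Rightarrow> 's) \<Rightarrow> 'p ring_term \<Rightarrow> 's" where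
  "term_val S h v (Var i) = v i"
| "term_val S h v (Param p) = h p"
| "term_val S h v Zero = \<zero>\<^bsub>S\<^esub>"
| "term_val S h v One = \<one>\<^bsub>S\<^esub>"
| "term_val S h v (Add s t) = term_val S h v s \<oplus>\<^bsub>S\<^esub> term_val S h v t"
| "term_val S h v (Mul s t) = term_val S h v s \<otimes>\<^bsub>S\<^esub> term_val S h v t"
| "term_val S h v (Neg t) = \<ominus>\<^bsub>S\<^esub> term_val S h v t"

primrec qf_holds ::
  "('s, 'm) ring_scheme \<Rightarrow> ('p \<Rightarrow> 's) \<Rightarrow> (nat \<Rightarrow> 's) \<Rightarrow> 'p qf_formula \<Rightarrow> bool" where
  "qf_holds S h v (FEq s t) \<longleftrightarrow> term_val S h v s = term_val S h v t"
| "qf_holds S h v (FNot \<phi>) \<longleftrightarrow> \<not> qf_holds S h v \<phi>"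
| "qf_holds S h v (FAnd \<phi> \<psi>) \<longleftrightarrow> qf_holds S h v \<phi> \<and> qf_holds S h v \<psi>"
| "qf_holds S h v (FOr \<phi> \<psi>) \<longleftrightarrow> qf_holds S h v \<phi> \<or> qf_holds S h v \<psi>"

text \<open>Truth in \<open>S\<close> of the existential closure of \<open>\<phi>\<close>. Only the finitely many variables occurring
  in \<open>\<phi>\<close> matter, so quantifying over a whole assignment amounts to a finite block of existential
  quantifiers.\<close>

definition ex_holds ::
  "('s, 'm) ring_scheme \<Rightarrow> ('p \<Rightarrow> 's) \<Rightarrow> 'p qf_formula \<Rightarrow> bool" where
  "ex_holds S h \<phi> \<longleftrightarrow> (\<exists>v. (\<forall>i. v i \<in> carrier S) \<and> qf_holds S h v \<phi>)"

text \<open>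
  A theory enters through its class of models. HOL cannot quantify over types inside a formula, so
  that class is passed twice: as \<open>T\<close> for rings over \<open>'a\<close>, where \<open>R\<close> lives, and as \<open>T'\<close> for rings
  over \<open>'a list\<close>, where the extensions \<open>S\<close> live. A type of size \<open>|'a list| = max |'a| \<aleph>\<^sub>0\<close> is large
  enough for elementary classes: the language is countable, so by downward
  Loewenheim--Skolem any model \<open>S\<close> of the theory that contains \<open>R\<close> has an elementary substructure
  of size at most \<open>max |R| \<aleph>\<^sub>0\<close> that contains \<open>R\<close>, in which the same sentences with parameters from
  \<open>R\<close> hold. Containment of \<open>R\<close> as a subring is expressed by an injective ring
  homomorphism \<open>h\<close>, along which parameters are read in \<open>S\<close>.
\<close>

definition existentially_closed ::
  "('a ring \<Rightarrow> bool) \<Rightarrow> ('a list ring \<Rightarrow> bool) \<Rightarrow> 'a ring \<Rightarrow> bool" where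
  "existentially_closed T T' R \<longleftrightarrow> T R \<and>
     (\<forall>S h \<phi>. T' S \<and> h \<in> ring_hom R S \<and> inj_on h (carrier R) \<and>
        qparams \<phi> \<subseteq> carrier R \<and> ex_holds S h \<phi> \<longrightarrow> ex_holds R (\<lambda>r. r) \<phi>)"

definition Art_le :: "nat \<Rightarrow> 'a ring \<Rightarrow> bool" where
  "Art_le l R \<longleftrightarrow> artinian_local_ring R \<and> ring_length R \<le> enat l"

definition Art_eq :: "nat \<Rightarrow> 'a ring \<Rightarrow> bool" where
  "Art_eq l R \<longleftrightarrow> artinian_local_ring R \<and> ring_length R = enat l"

end

(*
  In each of the three parts a failure of the conclusion yields an extension S of R in which an
  existential sentence becomes true that fails in R.

  Length: if the length of R is less than l, adjoin a square root X of some s in the socle and in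
  the maximal ideal m, subject to m X = 0. This raises the length by exactly one. When s can be
  chosen nonzero, no element of R annihilated by m has square s; otherwise R is a field, and X is a
  new nilpotent element. Iterating the construction with s = 0 embeds every ring of length at most l
  into one of length exactly l, so both theories can be treated at once.

  Residue field: let f0 be a polynomial of positive degree whose leading coefficient is a unit, Q a
  maximal ideal of R[X] containing m and f0, and f in Q of minimal degree modulo m. Then
  Q = m R[X] + (f), and (R[X] / (f))_Q contains R and a root of f. A root
  of f in R is a root of f0 modulo m, because f0 lies in Q.

  Gorenstein: if s and t are independent in the socle, then in R(X) / (X s - t), where R(X) is the
  localization of R[X] at m R[X], the element t becomes a multiple of s.

  In the last two constructions the maximal ideal of S is generated by that of R. A composition
  series of R then generates one of S (possibly with repetitions), so the length does not increase;
  neither flatness nor the Jordan-Hoelder theorem is needed.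
*)
theory Submission
  imports Defs "HOL-Algebra.UnivPoly"
begin

text \<open>Three obstacles shape the proof. First, \<open>R\<close> has to embed in its extension.
  Every nonzero element of \<open>R\<close> has a nonzero multiple \<open>b\<close> in the socle,
  and in \<open>R[X]\<close> such a \<open>b\<close> sees other coefficients only modulo
  \<open>m\<close>. So it suffices to exclude that a denominator \<open>u\<close> sends some such
  \<open>b\<close> into the ideal that is divided out, and this is done by comparing coefficients in
  an equation between \<open>u b\<close> (or \<open>b\<close>) and a multiple \<open>q f\<close> of
  the generator \<open>f\<close>. Second, existential closedness is tested on rings over
  \<open>'a list\<close> only, whereas residue classes have type \<open>'a set\<close> and
  polynomials type \<open>nat \<Rightarrow> 'a\<close>. Hence classes and fractions are replaced by
  chosen representatives, polynomials by their coefficient lists, and every carrier is coded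
  injectively into lists. Third, a sentence is finite, so \<open>m X = 0\<close> has to be expressed
  by finitely many generators of \<open>m\<close>; a composition series supplies them.\<close>

section \<open>Ideals\<close>

lemma (in cring) idealI_cring:
  assumes "I \<subseteq> carrier R" "\<zero> \<in> I" "\<And>a b. a \<in> I \<Longrightarrow> b \<in> I \<Longrightarrow> a \<oplus> b \<in> I"
    and mult: "\<And>a x. a \<in> I \<Longrightarrow> x \<in> carrier R \<Longrightarrow> x \<otimes> a \<in> I"
  shows "ideal I R"
proof (rule idealI)
  show "ring R" by (rule ring_axioms)
  have neg: "\<ominus> a \<in> I" if "a \<in> I" for a
  proof -
    have "(\<ominus> \<one>) \<otimes> a \<in> I" using mult that by simp
    then show ?thesis using that assms(1) by (auto simp: l_minus subset_iff)
  qed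
  show "subgroup I (add_monoid R)"
    using assms neg by (intro subgroup.intro) (auto simp: a_inv_def)
  show "a \<in> I \<Longrightarrow> x \<in> carrier R \<Longrightarrow> x \<otimes> a \<in> I" for a x by (rule mult)
  show "a \<in> I \<Longrightarrow> x \<in> carrier R \<Longrightarrow> a \<otimes> x \<in> I" for a x
    using mult[of a x] assms(1) m_comm by (auto simp: subset_iff)
qed

lemma (in ideal) minus_mem: "a \<in> I \<Longrightarrow> b \<in> I \<Longrightarrow> a \<ominus> b \<in> I"
  by (simp add: minus_eq)

lemma (in ideal) mem_of_minus_mem: "a \<ominus> b \<in> I \<Longrightarrow> b \<in> I \<Longrightarrow> a \<in> carrier R \<Longrightarrow> a \<in> I"
proof -
  assume "a \<ominus> b \<in> I" "b \<in> I" "a \<in> carrier R"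
  moreover have "a = (a \<ominus> b) \<oplus> b" using \<open>b \<in> I\<close> \<open>a \<in> carrier R\<close> Icarr by algebra
  moreover have "(a \<ominus> b) \<oplus> b \<in> I"
    using additive_subgroup.a_closed[OF additive_subgroup_axioms] calculation by blast
  ultimately show ?thesis by metis
qed

text \<open>Serves to pass from generators to the whole ideal: if each generator multiplies
  \<open>a\<close> into \<open>I\<close>, then so does every element of the ideal that they
  generate.\<close>

lemma (in cring) colon_ideal:
  assumes "ideal I R" "a \<in> carrier R"
  shows "ideal {x \<in> carrier R. x \<otimes> a \<in> I} R"
proof -
  interpret ideal I R by fact
  show ?thesis
    by (rule idealI_cring) (use assms(2) in \<open>auto simp: l_distr m_assoc I_l_closed\<close>)
qed

lemma (in cring) add_principal_ideal:
  assumes "ideal I R" "a \<in> carrier R"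
  shows "ideal {i \<oplus> r \<otimes> a |i r. i \<in> I \<and> r \<in> carrier R} R"
proof -
  interpret ideal I R by fact
  show ?thesis
  proof (rule idealI_cring)
    show "{i \<oplus> r \<otimes> a |i r. i \<in> I \<and> r \<in> carrier R} \<subseteq> carrier R" using assms(2) by auto
    show "\<zero> \<in> {i \<oplus> r \<otimes> a |i r. i \<in> I \<and> r \<in> carrier R}"
      using assms(2) by (auto intro!: exI[of _ \<zero>])
  next
    fix x y assume "x \<in> {i \<oplus> r \<otimes> a |i r. i \<in> I \<and> r \<in> carrier R}" "y \<in> {i \<oplus> r \<otimes> a |i r. i \<in> I \<and> r \<in> carrier R}"
    then obtain i r j s where *: "x = i \<oplus> r \<otimes> a" "y = j \<oplus> s \<otimes> a" "i \<in> I" "j \<in> I" "r \<in> carrier R" "s \<in> carrier R"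
      by blast
    moreover have "x \<oplus> y = (i \<oplus> j) \<oplus> (r \<oplus> s) \<otimes> a" unfolding * using * assms(2) Icarr by algebra
    ultimately show "x \<oplus> y \<in> {i \<oplus> r \<otimes> a |i r. i \<in> I \<and> r \<in> carrier R}" by blast
  next
    fix x y assume "x \<in> {i \<oplus> r \<otimes> a |i r. i \<in> I \<and> r \<in> carrier R}" and y: "y \<in> carrier R"
    then obtain i r where *: "x = i \<oplus> r \<otimes> a" "i \<in> I" "r \<in> carrier R"
      by blast
    moreover have "y \<otimes> x = y \<otimes> i \<oplus> (y \<otimes> r) \<otimes> a" unfolding * using * y assms(2) Icarr by algebra
    ultimately show "y \<otimes> x \<in> {i \<oplus> r \<otimes> a |i r. i \<in> I \<and> r \<in> carrier R}"
      using y I_l_closed by blast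
  qed
qed

text \<open>Zorn's lemma for the ideals above \<open>I\<close> that avoid \<open>\<one>\<close>, a
  property that survives unions of chains. The empty chain is bounded by \<open>I\<close>
  itself.\<close>

lemma (in ring) exists_maximalideal:
  assumes "ideal I R" "\<one> \<notin> I"
  obtains M where "maximalideal M R" "I \<subseteq> M"
proof -
  let ?S = "{K. ideal K R \<and> I \<subseteq> K \<and> \<one> \<notin> K}"
  have "\<exists>M \<in> ?S. \<forall>K \<in> ?S. M \<subseteq> K \<longrightarrow> K = M"
  proof (rule subset_Zorn)
    fix C assume C: "subset.chain ?S C"
    show "\<exists>U \<in> ?S. \<forall>K \<in> C. K \<subseteq> U"
    proof (cases "C = {}")
      case True
      then show ?thesis using assms by auto
    next
      case False
      have "subset.chain {K. ideal K R} C" using C unfolding pred_on.chain_def by auto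
      then have "ideal (\<Union>C) R" using chain_Union_is_ideal[of C] False by simp
      then have "\<Union>C \<in> ?S" using C False unfolding pred_on.chain_def by auto
      then show ?thesis by blast
    qed
  qed
  then obtain M where "M \<in> ?S" and "\<forall>K \<in> ?S. M \<subseteq> K \<longrightarrow> K = M" ..
  then have M: "ideal M R" "I \<subseteq> M" "\<one> \<notin> M" "\<And>K. K \<in> ?S \<Longrightarrow> M \<subseteq> K \<Longrightarrow> K = M" by auto
  have "maximalideal M R"
  proof (rule maximalidealI[OF M(1)])
    show "carrier R \<noteq> M" using M(3) by auto
    fix K assume K: "ideal K R" "M \<subseteq> K" "K \<subseteq> carrier R"
    show "K = M \<or> K = carrier R"
      using M(4)[of K] K M(2) ideal.one_imp_carrier[OF K(1)] by blast
  qed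
  then show ?thesis using that M(2) by blast
qed

section \<open>Local rings\<close>

text \<open>An ideal without \<open>\<one>\<close> contains no unit and so lies inside
  \<open>M\<close>. Hence \<open>M\<close> is maximal and the only maximal ideal.\<close>

lemma local_ringI:
  assumes "cring S" "ideal M S" "\<one>\<^bsub>S\<^esub> \<notin> M" "\<And>x. x \<in> carrier S \<Longrightarrow> x \<notin> M \<Longrightarrow> x \<in> Units S"
  shows "local_ring S" "max_ideal S = M"
proof -
  interpret S: cring S by fact
  have sub: "K \<subseteq> M" if K: "ideal K S" "\<one>\<^bsub>S\<^esub> \<notin> K" for K
  proof
    fix x assume x: "x \<in> K"
    interpret K: ideal K S by fact
    show "x \<in> M"
    proof (rule ccontr)
      assume "x \<notin> M"
      then have "x \<in> Units S" using x K.Icarr assms(4) by blast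
      then have "inv\<^bsub>S\<^esub> x \<otimes>\<^bsub>S\<^esub> x = \<one>\<^bsub>S\<^esub>" "inv\<^bsub>S\<^esub> x \<in> carrier S" by auto
      then show False using K.I_l_closed[OF x] K(2) by metis
    qed
  qed
  have max: "maximalideal M S"
  proof (rule maximalidealI[OF assms(2)])
    show "carrier S \<noteq> M" using assms(3) by auto
    show "K = M \<or> K = carrier S" if "ideal K S" "M \<subseteq> K" "K \<subseteq> carrier S" for K
      using sub[OF that(1)] ideal.one_imp_carrier[OF that(1)] that by blast
  qed
  have uniq: "K = M" if "maximalideal K S" for K
  proof -
    interpret K: maximalideal K S by fact
    have "K \<subseteq> M" using sub[OF K.is_ideal] K.I_notcarr K.one_imp_carrier by blast
    then show ?thesis
      using K.I_maximal[OF assms(2)] assms(3) additive_subgroup.a_subset[OF ideal.axioms(1)[OF assms(2)]]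
      by (metis S.one_closed)
  qed
  show "local_ring S" unfolding local_ring_def using assms(1) max uniq by blast
  show "max_ideal S = M" unfolding max_ideal_def using max uniq by (rule the_equality)
qed

text \<open>For the last claim, a non-unit generates a proper ideal, which lies in some maximal
  ideal, and there is only one.\<close>

lemma local_ringD:
  fixes R (structure)
  assumes "local_ring R"
  shows "cring R" "maximalideal (max_ideal R) R" "ideal (max_ideal R) R" "\<one>\<^bsub>R\<^esub> \<notin> max_ideal R"
    and "\<And>x. x \<in> carrier R \<Longrightarrow> x \<notin> max_ideal R \<Longrightarrow> x \<in> Units R"
proof -
  show "cring R" using assms by (simp add: local_ring_def)
  then interpret cring R .
  have ex1: "\<exists>!M. maximalideal M R" using assms by (simp add: local_ring_def)
  show m: "maximalideal (max_ideal R) R"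
    unfolding max_ideal_def by (rule theI'[OF ex1])
  then interpret m: maximalideal "max_ideal R" R .
  show "ideal (max_ideal R) R" by (rule m.is_ideal)
  show "\<one>\<^bsub>R\<^esub> \<notin> max_ideal R" using m.one_imp_carrier m.I_notcarr by blast
  fix x assume x: "x \<in> carrier R" "x \<notin> max_ideal R"
  show "x \<in> Units R"
  proof (rule ccontr)
    assume nu: "x \<notin> Units R"
    have "\<one>\<^bsub>R\<^esub> \<notin> PIdl x"
    proof
      assume "\<one>\<^bsub>R\<^esub> \<in> PIdl x"
      then obtain y where "y \<in> carrier R" "y \<otimes> x = \<one>" by (auto simp: cgenideal_def)
      then show False using nu x(1) m_comm by (auto simp: Units_def)
    qed
    then obtain K where "maximalideal K R" "PIdl x \<subseteq> K"
      using exists_maximalideal[OF cgenideal_ideal[OF x(1)]] by blast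
    then show False using ex1 m x cgenideal_self[OF x(1)] by blast
  qed
qed

section \<open>Length\<close>

text \<open>For ideals \<open>I \<subseteq> J\<close> this says that the module \<open>J / I\<close>
  is zero or simple: modulo \<open>I\<close>, each element of \<open>J\<close> outside
  \<open>I\<close> generates all of \<open>J\<close>.\<close>

definition simple_step :: "('a, 'm) ring_scheme \<Rightarrow> 'a set \<Rightarrow> 'a set \<Rightarrow> bool" where
  "simple_step R I J \<longleftrightarrow> (\<forall>x\<in>J. \<forall>y\<in>J - I. \<exists>r\<in>carrier R. x \<ominus>\<^bsub>R\<^esub> r \<otimes>\<^bsub>R\<^esub> y \<in> I)"

text \<open>Repetitions are allowed, so that a series can be pushed forward along a homomorphism.\<close>

definition comp_series :: "('a, 'm) ring_scheme \<Rightarrow> nat \<Rightarrow> (nat \<Rightarrow> 'a set) \<Rightarrow> bool" where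
  "comp_series R n J \<longleftrightarrow> J 0 = {\<zero>\<^bsub>R\<^esub>} \<and> J n = carrier R \<and> (\<forall>i\<le>n. ideal (J i) R) \<and>
     (\<forall>i<n. J i \<subseteq> J (Suc i) \<and> simple_step R (J i) (J (Suc i)))"

definition ideal_chain :: "('a, 'm) ring_scheme \<Rightarrow> nat \<Rightarrow> (nat \<Rightarrow> 'a set) \<Rightarrow> bool" where
  "ideal_chain R n I \<longleftrightarrow> (\<forall>i\<le>n. ideal (I i) R) \<and> (\<forall>i<n. I i \<subset> I (Suc i))"

lemma ring_length_eq_Sup: "ring_length R = (SUP n \<in> {n. \<exists>I. ideal_chain R n I}. enat n)"
  unfolding ring_length_def ideal_chain_def by simp

lemma ideal_chain_le_ring_length: "ideal_chain R n I \<Longrightarrow> enat n \<le> ring_length R"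
  unfolding ring_length_eq_Sup by (rule SUP_upper) blast

lemma ring_length_le: "(\<And>n I. ideal_chain R n I \<Longrightarrow> n \<le> k) \<Longrightarrow> ring_length R \<le> enat k"
  unfolding ring_length_eq_Sup by (rule SUP_least) auto

text \<open>Counts the nonzero quotients of the filtration that \<open>J\<close> induces on
  \<open>I\<close>. For a composition series these quotients are simple, so the count is the length
  of \<open>I\<close> as a module.\<close>

definition series_rank :: "nat \<Rightarrow> (nat \<Rightarrow> 'a set) \<Rightarrow> 'a set \<Rightarrow> nat" where
  "series_rank n J I = card {i. i < n \<and> \<not> I \<inter> J (Suc i) \<subseteq> J i}"

lemma series_rank_le: "series_rank n J I \<le> n"
proof -
  have "series_rank n J I \<le> card {..<n}" unfolding series_rank_def by (rule card_mono) auto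
  then show ?thesis by simp
qed

text \<open>If \<open>K\<close> meets no further step than \<open>I\<close>, then
  \<open>K \<subseteq> I\<close>: climbing up the series, an element of \<open>K\<close> is
  corrected by a multiple of an element of \<open>I\<close> that generates the same step, and the
  difference lies lower in the series.\<close>

lemma series_rank_strict_mono:
  fixes R (structure)
  assumes R: "cring R" and J: "comp_series R n J" and I: "ideal I R" and K: "ideal K R" and less: "I \<subset> K"
  shows "series_rank n J I < series_rank n J K"
proof -
  interpret cring R by fact
  interpret I: ideal I R by fact
  interpret K: ideal K R by fact
  let ?D = "\<lambda>I. {i. i < n \<and> \<not> I \<inter> J (Suc i) \<subseteq> J i}"
  have "?D I \<subseteq> ?D K" using less by blast
  moreover have "?D I \<noteq> ?D K"
  proof
    assume eq: "?D I = ?D K"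
    have "i \<le> n \<Longrightarrow> K \<inter> J i \<subseteq> I" for i
    proof (induction i)
      case 0
      then show ?case using J I.zero_closed by (auto simp: comp_series_def)
    next
      case (Suc i)
      have Ji: "ideal (J i) R" "ideal (J (Suc i)) R" "simple_step R (J i) (J (Suc i))" "J i \<subseteq> J (Suc i)"
        using J Suc.prems by (auto simp: comp_series_def)
      interpret Ji: ideal "J i" R by fact
      interpret Jsi: ideal "J (Suc i)" R by fact
      show ?case
      proof
        fix x assume x: "x \<in> K \<inter> J (Suc i)"
        show "x \<in> I"
        proof (cases "x \<in> J i")
          case True
          then show ?thesis using Suc x by auto
        next
          case False
          then have "i \<in> ?D K" using x Suc.prems by auto
          then have "i \<in> ?D I" using eq by simp
          then obtain y where y: "y \<in> I" "y \<in> J (Suc i)" "y \<notin> J i" by blast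
          then obtain r where r: "r \<in> carrier R" "x \<ominus> r \<otimes> y \<in> J i"
            using Ji(3) x unfolding simple_step_def by blast
          have "r \<otimes> y \<in> I" using y(1) r(1) I.I_l_closed by blast
          moreover have "x \<ominus> r \<otimes> y \<in> K" using x calculation less K.minus_mem by blast
          then have "x \<ominus> r \<otimes> y \<in> I" using r(2) Suc by auto
          ultimately show ?thesis using I.mem_of_minus_mem x K.Icarr by blast
        qed
      qed
    qed
    from this[of n] have "K \<subseteq> I" using J K.Icarr by (auto simp: comp_series_def)
    then show False using less by auto
  qed
  ultimately show ?thesis unfolding series_rank_def by (intro psubset_card_mono) auto
qed

text \<open>Along a strict chain of ideals the rank increases by at least one at each inclusion and
  never exceeds \<open>n\<close>.\<close>

lemma comp_series_ring_length_le:
  assumes R: "cring R" and J: "comp_series R n J"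
  shows "ring_length R \<le> enat n"
proof (rule ring_length_le)
  fix k I assume I: "ideal_chain R k I"
  have "i \<le> k \<Longrightarrow> i \<le> series_rank n J (I i)" for i
  proof (induction i)
    case (Suc i)
    then have "series_rank n J (I i) < series_rank n J (I (Suc i))"
      using I by (intro series_rank_strict_mono[OF R J]) (auto simp: ideal_chain_def)
    then show ?case using Suc by simp
  qed simp
  from this[of k] show "k \<le> n" using series_rank_le[of n J "I k"] by simp
qed

lemma comp_series_artinian:
  assumes R: "cring R" and J: "comp_series R n J"
  shows "artinian_ring R"
  unfolding artinian_ring_def
proof (intro conjI allI impI R)
  fix I :: "nat \<Rightarrow> 'a set" assume I: "(\<forall>n. ideal (I n) R) \<and> (\<forall>n. I (Suc n) \<subseteq> I n)"
  \<comment> \<open>A member of least rank: any strict inclusion after it would lower the rank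
    further.\<close>
  define N where "N = (ARG_MIN (\<lambda>k. series_rank n J (I k)) k. True)"
  have N: "series_rank n J (I N) \<le> series_rank n J (I k)" for k
    unfolding N_def by (rule arg_min_nat_le) simp
  have "I k = I N" if "k \<ge> N" for k
  proof -
    have "I k \<subseteq> I N" using lift_Suc_antimono_le[of I N k] I that by blast
    then show ?thesis
      using series_rank_strict_mono[OF R J, of "I k" "I N"] N[of k] I by fastforce
  qed
  then show "\<exists>N. \<forall>k\<ge>N. I k = I N" by blast
qed

lemma strict_comp_series_ring_length:
  assumes R: "cring R" and J: "comp_series R n J" and strict: "\<And>i. i < n \<Longrightarrow> J i \<noteq> J (Suc i)"
  shows "ring_length R = enat n"
proof (rule antisym)
  show "ring_length R \<le> enat n" by (rule comp_series_ring_length_le[OF R J])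
  show "enat n \<le> ring_length R"
    using J strict by (intro ideal_chain_le_ring_length[of _ _ J]) (auto simp: ideal_chain_def comp_series_def)
qed

text \<open>Chains of greatest length are analysed by showing that nothing can be inserted.
  \<open>K\<close> becomes the member number \<open>k\<close>; the values \<open>0\<close> and
  \<open>Suc n\<close> of \<open>k\<close> put it below or above the whole chain, and then only one
  of the two inclusions is demanded.\<close>

lemma ideal_chain_insert:
  assumes I: "ideal_chain R n I" and k: "k \<le> Suc n" and K: "ideal K R"
    and "k > 0 \<Longrightarrow> I (k - 1) \<subset> K" "k \<le> n \<Longrightarrow> K \<subset> I k"
  shows "ideal_chain R (Suc n) (\<lambda>j. if j < k then I j else if j = k then K else I (j - 1))"
  unfolding ideal_chain_def
proof (intro conjI allI impI)
  fix i assume "i \<le> Suc n"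
  then show "ideal (if i < k then I i else if i = k then K else I (i - 1)) R"
    using I K k by (auto simp: ideal_chain_def)
next
  fix i assume i: "i < Suc n"
  consider "Suc i < k" | "Suc i = k" | "i = k" | "k < i" by linarith
  then show "(if i < k then I i else if i = k then K else I (i - 1))
       \<subset> (if Suc i < k then I (Suc i) else if Suc i = k then K else I (Suc i - 1))"
  proof cases
    case 1
    then show ?thesis using I k by (simp add: ideal_chain_def)
  next
    case 2
    then show ?thesis using assms(4) by auto
  next
    case 3
    then show ?thesis using assms(5) i by auto
  next
    case 4
    then obtain j where j: "i = Suc j" by (cases i) auto
    then have "I j \<subset> I (Suc j)" using I i unfolding ideal_chain_def by blast
    then show ?thesis using 4 j by simp
  qed
qed

lemma exists_comp_series:
  fixes R (structure)
  assumes R: "cring R" and len: "ring_length R = enat n"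
  obtains J where "comp_series R n J" "\<And>i. i < n \<Longrightarrow> J i \<noteq> J (Suc i)"
proof -
  interpret cring R by fact
  have bound: "k \<le> n" if "ideal_chain R k I" for k I
    using ideal_chain_le_ring_length[OF that] len by simp
  have "\<exists>k. (\<exists>I. ideal_chain R k I) \<and> n \<le> k"
  proof (rule ccontr)
    assume *: "\<not> ?thesis"
    \<comment> \<open>This chain without inclusions guarantees \<open>0 < n\<close>, so that
      \<open>n - 1\<close> below is a genuine predecessor.\<close>
    have "ideal_chain R 0 (\<lambda>_. {\<zero>})" using zeroideal by (simp add: ideal_chain_def)
    then have n: "0 < n" using * by (metis gr0I le_refl)
    have "ring_length R \<le> enat (n - 1)"
      by (rule ring_length_le) (use * n in fastforce)
    then show False using len n by simp
  qed
  then obtain J where J: "ideal_chain R n J" using bound by (metis le_antisym)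
  \<comment> \<open>A longer chain is impossible. The bottom, the top and the simplicity of the
    steps of \<open>J\<close> all follow from this, by inserting \<open>{\<zero>}\<close>,
    \<open>carrier R\<close> and \<open>J i + R y\<close>.\<close>
  have noins: False
    if "k \<le> Suc n" "ideal K R" "k > 0 \<Longrightarrow> J (k - 1) \<subset> K" "k \<le> n \<Longrightarrow> K \<subset> J k" for k K
    using bound[OF ideal_chain_insert[OF J that]] by simp
  have "comp_series R n J" unfolding comp_series_def
  proof (intro conjI allI impI)
    interpret J0: ideal "J 0" R using J by (simp add: ideal_chain_def)
    show "J 0 = {\<zero>}"
    proof (rule ccontr)
      assume "J 0 \<noteq> {\<zero>}"
      then have "{\<zero>} \<subset> J 0" by auto
      then show False using noins[OF _ zeroideal, of 0] by simp
    qed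
    interpret Jn: ideal "J n" R using J by (simp add: ideal_chain_def)
    show "J n = carrier R"
    proof (rule ccontr)
      assume "J n \<noteq> carrier R"
      then have "J n \<subset> carrier R" using Jn.Icarr by auto
      then show False using noins[OF _ oneideal, of "Suc n"] by simp
    qed
    show "ideal (J i) R" if "i \<le> n" for i using J that by (simp add: ideal_chain_def)
    show "J i \<subseteq> J (Suc i)" if "i < n" for i using J that by (auto simp: ideal_chain_def)
    show "simple_step R (J i) (J (Suc i))" if i: "i < n" for i
      unfolding simple_step_def
    proof (intro ballI)
      interpret Ji: ideal "J i" R using J i by (simp add: ideal_chain_def)
      interpret Jsi: ideal "J (Suc i)" R using J i by (simp add: ideal_chain_def)
      fix x y assume x: "x \<in> J (Suc i)" and y: "y \<in> J (Suc i) - J i"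
      \<comment> \<open>This ideal lies strictly above \<open>J i\<close> and inside
        \<open>J (Suc i)\<close>, so it must be \<open>J (Suc i)\<close>; in particular it contains
        \<open>x\<close>.\<close>
      let ?K = "{j \<oplus> r \<otimes> y |j r. j \<in> J i \<and> r \<in> carrier R}"
      have yc: "y \<in> carrier R" using y Jsi.Icarr by blast
      have K: "ideal ?K R" using add_principal_ideal[OF Ji.is_ideal yc] .
      have le: "J i \<subseteq> J (Suc i)" using J i by (auto simp: ideal_chain_def)
      have "?K \<subseteq> J (Suc i)" using y le Jsi.I_l_closed by blast
      moreover have sub: "J i \<subseteq> ?K"
      proof
        fix j assume j: "j \<in> J i"
        then have "j = j \<oplus> \<zero> \<otimes> y" using yc Ji.Icarr by simp
        then show "j \<in> ?K" using j by blast
      qed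
      moreover have "y \<in> ?K"
      proof -
        have "y = \<zero> \<oplus> \<one> \<otimes> y" using yc by simp
        then show ?thesis using Ji.zero_closed by blast
      qed
      then have "J i \<noteq> ?K" using y by blast
      with sub have "J i \<subset> ?K" by (rule psubsetI)
      ultimately have "?K = J (Suc i)"
        using noins[OF _ K, of "Suc i"] i by (simp add: psubset_eq) blast
      then obtain j r where jr: "x = j \<oplus> r \<otimes> y" "j \<in> J i" "r \<in> carrier R" using x by blast
      have "x \<ominus> r \<otimes> y = j" unfolding jr(1) using jr(2,3) yc Ji.Icarr by algebra
      then show "\<exists>r\<in>carrier R. x \<ominus> r \<otimes> y \<in> J i" using jr(2,3) by metis
    qed
  qed
  moreover have "\<And>i. i < n \<Longrightarrow> J i \<noteq> J (Suc i)" using J by (auto simp: ideal_chain_def)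
  ultimately show ?thesis using that by blast
qed

lemma artinian_localI:
  assumes "cring S" "ideal M S" "\<one>\<^bsub>S\<^esub> \<notin> M" "\<And>x. x \<in> carrier S \<Longrightarrow> x \<notin> M \<Longrightarrow> x \<in> Units S"
    and "comp_series S n J"
  shows "artinian_local_ring S" "ring_length S \<le> enat n"
  using local_ringI(1)[OF assms(1-4)] comp_series_artinian[OF assms(1,5)] comp_series_ring_length_le[OF assms(1,5)]
  unfolding artinian_local_ring_def by auto

text \<open>A form of Nakayama's lemma. If \<open>a \<otimes> x\<close> were outside
  \<open>J i\<close>, it would generate the step, so \<open>x\<close> would be
  \<open>r \<otimes> (a \<otimes> x)\<close> modulo \<open>J i\<close>; but
  \<open>\<one> \<ominus> r \<otimes> a\<close> is a unit, which puts \<open>x\<close> into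
  \<open>J i\<close>.\<close>

lemma comp_series_max_ideal_mult:
  fixes R (structure)
  assumes R: "local_ring R" and J: "comp_series R n J" and i: "i < n"
    and a: "a \<in> max_ideal R" and x: "x \<in> J (Suc i)"
  shows "a \<otimes> x \<in> J i"
proof (rule ccontr)
  interpret cring R using R by (rule local_ringD(1))
  interpret m: ideal "max_ideal R" R using R by (rule local_ringD(3))
  interpret Ji: ideal "J i" R using J i by (simp add: comp_series_def)
  interpret Jsi: ideal "J (Suc i)" R using J i by (simp add: comp_series_def)
  have xc: "x \<in> carrier R" and ac: "a \<in> carrier R" using x a Jsi.Icarr m.Icarr by auto
  assume "a \<otimes> x \<notin> J i"
  moreover have "a \<otimes> x \<in> J (Suc i)" using x ac Jsi.I_l_closed by blast
  ultimately obtain r where r: "r \<in> carrier R" "x \<ominus> r \<otimes> (a \<otimes> x) \<in> J i"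
    using J i x unfolding comp_series_def simple_step_def by blast
  let ?u = "\<one> \<ominus> r \<otimes> a"
  have "?u \<notin> max_ideal R"
  proof
    assume "?u \<in> max_ideal R"
    moreover have "r \<otimes> a \<in> max_ideal R" using a r(1) m.I_l_closed by blast
    ultimately have "\<one> \<in> max_ideal R" using m.mem_of_minus_mem by blast
    then show False using local_ringD(4)[OF R] by simp
  qed
  then have u: "?u \<in> Units R" using r(1) ac by (intro local_ringD(5)[OF R]) auto
  have "?u \<otimes> x \<in> J i" using r xc ac by (simp add: minus_eq l_distr l_minus m_assoc)
  then have "inv ?u \<otimes> (?u \<otimes> x) \<in> J i" using u Ji.I_l_closed by blast
  moreover have "inv ?u \<otimes> (?u \<otimes> x) = x" using u xc by (metis Units_closed Units_inv_closed Units_l_inv l_one m_assoc)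
  ultimately have "x \<in> J i" by metis
  then show False using \<open>a \<otimes> x \<notin> J i\<close> ac Ji.I_l_closed by blast
qed

text \<open>A step of the extended series is spanned over the lower member by the image of a single
  element, and \<open>M\<close>, being generated by the image of the maximal ideal of
  \<open>R\<close>, annihilates it. So it is a quotient of \<open>S / M\<close>, hence zero or
  simple.\<close>

lemma comp_series_genideal:
  fixes S (structure)
  assumes R: "local_ring R" and J: "comp_series R n J" and S: "cring S" and h: "h \<in> ring_hom R S"
    and M: "ideal M S" "\<And>x. x \<in> carrier S \<Longrightarrow> x \<notin> M \<Longrightarrow> x \<in> Units S"
      "M \<subseteq> genideal S (h ` max_ideal R)"
  shows "comp_series S n (\<lambda>i. genideal S (h ` J i))"
proof -
  interpret R: cring R using R by (rule local_ringD(1))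
  interpret S: cring S by fact
  interpret h: ring_hom_cring R S h using h by unfold_locales
  have Jc: "J i \<subseteq> carrier R" if "i \<le> n" for i
    using J that ideal.Icarr by (fastforce simp: comp_series_def)
  have hJc: "h ` J i \<subseteq> carrier S" if "i \<le> n" for i
    using Jc[OF that] by auto
  have K: "ideal (Idl (h ` J i)) S" if "i \<le> n" for i
    by (rule S.genideal_ideal[OF hJc[OF that]])
  show ?thesis unfolding comp_series_def
  proof (intro conjI allI impI)
    show "Idl (h ` J 0) = {\<zero>}" using J by (simp add: comp_series_def S.genideal_zero)
    have "\<one> \<in> Idl (h ` J n)"
      using S.genideal_self[OF hJc[of n]] J by (force simp: comp_series_def intro: rev_image_eqI[of "\<one>\<^bsub>R\<^esub>"])
    then show "Idl (h ` J n) = carrier S" using ideal.one_imp_carrier[OF K[of n]] by simp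
    show "ideal (Idl (h ` J i)) S" if "i \<le> n" for i by (rule K[OF that])
    show "Idl (h ` J i) \<subseteq> Idl (h ` J (Suc i))" if i: "i < n" for i
    proof (rule S.genideal_minimal[OF K])
      have "J i \<subseteq> J (Suc i)" using J i by (simp add: comp_series_def)
      then show "h ` J i \<subseteq> Idl (h ` J (Suc i))" using S.genideal_self[OF hJc[of "Suc i"]] i by auto
    qed (use i in simp)
    show "simple_step S (Idl (h ` J i)) (Idl (h ` J (Suc i)))" if i: "i < n" for i
      unfolding simple_step_def
    proof (intro ballI)
      interpret Ki: ideal "Idl (h ` J i)" S using K i by simp
      interpret Ji: ideal "J i" R using J i by (simp add: comp_series_def)
      fix x y assume x: "x \<in> Idl (h ` J (Suc i))" and y: "y \<in> Idl (h ` J (Suc i)) - Idl (h ` J i)"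
      have "J i \<noteq> J (Suc i)" using y by auto
      moreover have "J i \<subseteq> J (Suc i)" using J i by (simp add: comp_series_def)
      ultimately obtain a where a: "a \<in> J (Suc i)" "a \<notin> J i" by blast
      have ac: "a \<in> carrier R" using a(1) Jc[of "Suc i"] i by auto
      \<comment> \<open>One element \<open>a\<close> outside \<open>J i\<close> generates the step
        in \<open>R\<close>; accordingly \<open>h a\<close> together with the lower member gives all
        of the upper one in \<open>S\<close>.\<close>
      let ?L = "{k \<oplus> s \<otimes> h a |k s. k \<in> Idl (h ` J i) \<and> s \<in> carrier S}"
      have L: "ideal ?L S" using ac by (intro S.add_principal_ideal K) (use i in auto)
      have "h ` J (Suc i) \<subseteq> ?L"
      proof
        fix z assume "z \<in> h ` J (Suc i)"
        then obtain b where b: "b \<in> J (Suc i)" "z = h b" by auto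
        then obtain r where r: "r \<in> carrier R" "b \<ominus>\<^bsub>R\<^esub> r \<otimes>\<^bsub>R\<^esub> a \<in> J i"
          using J i a unfolding comp_series_def simple_step_def by blast
        have bc: "b \<in> carrier R" using b(1) Jc[of "Suc i"] i by auto
        have "b = (b \<ominus>\<^bsub>R\<^esub> r \<otimes>\<^bsub>R\<^esub> a) \<oplus>\<^bsub>R\<^esub> r \<otimes>\<^bsub>R\<^esub> a" using bc r(1) ac by algebra
        then have "h b = h (b \<ominus>\<^bsub>R\<^esub> r \<otimes>\<^bsub>R\<^esub> a) \<oplus> h r \<otimes> h a"
          using bc r(1) ac by (metis R.m_closed R.minus_closed h.hom_add h.hom_mult)
        moreover have "h (b \<ominus>\<^bsub>R\<^esub> r \<otimes>\<^bsub>R\<^esub> a) \<in> Idl (h ` J i)"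
          using S.genideal_self[OF hJc[of i]] i r(2) by auto
        ultimately show "z \<in> ?L" using b(2) r(1) by (auto intro: h.hom_closed)
      qed
      then have sub: "Idl (h ` J (Suc i)) \<subseteq> ?L" by (rule S.genideal_minimal[OF L])
      obtain k s where ks: "x = k \<oplus> s \<otimes> h a" "k \<in> Idl (h ` J i)" "s \<in> carrier S" using x sub by blast
      obtain k' s' where ks': "y = k' \<oplus> s' \<otimes> h a" "k' \<in> Idl (h ` J i)" "s' \<in> carrier S" using y sub by blast
      have "s' \<notin> M"
      proof
        assume "s' \<in> M"
        \<comment> \<open>The maximal ideal of \<open>R\<close> multiplies \<open>a\<close> into
          \<open>J i\<close>, so \<open>M\<close> multiplies \<open>h a\<close> into the lower
          member. A coefficient \<open>s'\<close> in \<open>M\<close> would therefore put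
          \<open>y\<close> itself there.\<close>
        let ?C = "{z \<in> carrier S. z \<otimes> h a \<in> Idl (h ` J i)}"
        have C: "ideal ?C S" using ac by (intro S.colon_ideal K) (use i in auto)
        have "h ` max_ideal R \<subseteq> ?C"
        proof
          fix z assume "z \<in> h ` max_ideal R"
          then obtain b where b: "b \<in> max_ideal R" "z = h b" by auto
          have bc: "b \<in> carrier R" using b(1) ideal.Icarr[OF local_ringD(3)[OF R]] by blast
          have "b \<otimes>\<^bsub>R\<^esub> a \<in> J i" by (rule comp_series_max_ideal_mult[OF R J i b(1) a(1)])
          then have "h (b \<otimes>\<^bsub>R\<^esub> a) \<in> Idl (h ` J i)" using S.genideal_self[OF hJc[of i]] i by auto
          then show "z \<in> ?C" using b(2) bc ac by auto
        qed
        then have "M \<subseteq> ?C" using M(3) S.genideal_minimal[OF C] by blast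
        then have "y \<in> Idl (h ` J i)" unfolding ks' using \<open>s' \<in> M\<close> ks'(2) by auto
        then show False using y by blast
      qed
      then have u: "s' \<in> Units S" using ks'(3) M(2) by blast
      \<comment> \<open>Chosen so that the multiples of \<open>h a\<close> in \<open>x\<close> and
        in \<open>?r \<otimes> y\<close> cancel.\<close>
      let ?r = "s \<otimes> inv s'"
      have rc: "?r \<in> carrier S" using u ks(3) by simp
      have "?r \<otimes> s' = s" using u ks(3) ks'(3) by (simp add: S.m_assoc)
      then have "?r \<otimes> (s' \<otimes> h a) = s \<otimes> h a" using rc ks'(3) ac by (simp add: S.m_assoc[symmetric])
      then have "?r \<otimes> y = ?r \<otimes> k' \<oplus> s \<otimes> h a"
        unfolding ks'(1) using rc ks' ac Ki.Icarr by (simp add: S.r_distr)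
      then have "x \<ominus> ?r \<otimes> y = k \<ominus> ?r \<otimes> k'"
      proof -
        assume eq: "?r \<otimes> y = ?r \<otimes> k' \<oplus> s \<otimes> h a"
        have c: "k \<in> carrier S" "?r \<otimes> k' \<in> carrier S" "s \<otimes> h a \<in> carrier S"
          using ks ks' rc ac Ki.Icarr by auto
        show ?thesis unfolding eq ks(1) using c by algebra
      qed
      moreover have "k \<ominus> ?r \<otimes> k' \<in> Idl (h ` J i)"
        using Ki.minus_mem[OF ks(2) Ki.I_l_closed[OF ks'(2) rc]] .
      ultimately show "\<exists>r\<in>carrier S. x \<ominus> r \<otimes> y \<in> Idl (h ` J i)" using rc by metis
    qed
  qed
qed

text \<open>Among the nonzero multiples of \<open>r\<close>, take one that lies in the lowest
  possible member of the series. Multiplying it by the maximal ideal moves it one member down, where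
  only zero is left. This reduces injectivity of a homomorphism to the socle.\<close>

lemma exists_multiple_in_socle:
  fixes R (structure)
  assumes R: "local_ring R" and J: "comp_series R n J" and r: "r \<in> carrier R" "r \<noteq> \<zero>"
  obtains c where "c \<in> carrier R" "c \<otimes> r \<in> socle R" "c \<otimes> r \<noteq> \<zero>"
proof -
  interpret cring R using R by (rule local_ringD(1))
  interpret m: ideal "max_ideal R" R using R by (rule local_ringD(3))
  let ?P = "\<lambda>i. i \<le> n \<and> (\<exists>c\<in>carrier R. c \<otimes> r \<in> J i \<and> c \<otimes> r \<noteq> \<zero>)"
  define k where "k = (LEAST i. ?P i)"
  have "?P n" using J r by (auto simp: comp_series_def intro!: bexI[of _ \<one>])
  then have k: "?P k" unfolding k_def by (rule LeastI)
  then obtain c where c: "c \<in> carrier R" "c \<otimes> r \<in> J k" "c \<otimes> r \<noteq> \<zero>" by blast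
  have "k \<noteq> 0" using c J by (auto simp: comp_series_def)
  then obtain i where i: "k = Suc i" by (cases k) auto
  have "(c \<otimes> r) \<otimes> a = \<zero>" if a: "a \<in> max_ideal R" for a
  proof (rule ccontr)
    assume nz: "(c \<otimes> r) \<otimes> a \<noteq> \<zero>"
    have ac: "a \<in> carrier R" using a m.Icarr by blast
    have eq: "(c \<otimes> r) \<otimes> a = a \<otimes> (c \<otimes> r)" "(c \<otimes> r) \<otimes> a = (a \<otimes> c) \<otimes> r"
      using ac c(1) r(1) by (simp_all add: m_ac)
    have "a \<otimes> (c \<otimes> r) \<in> J i"
      using comp_series_max_ideal_mult[OF R J _ a] c(2) k i by simp
    then have "?P i" using nz eq k i c(1) ac by (metis Suc_leD m_closed)
    then show False using not_less_Least[of i ?P] i unfolding k_def[symmetric] by simp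
  qed
  then have "c \<otimes> r \<in> socle R" using c r by (auto simp: socle_def annihilator_def)
  then show ?thesis using that c by blast
qed

lemma socle_ideal:
  fixes R (structure)
  assumes "local_ring R"
  shows "ideal (socle R) R"
proof -
  interpret cring R using assms by (rule local_ringD(1))
  interpret m: ideal "max_ideal R" R using assms by (rule local_ringD(3))
  show ?thesis
    by (rule idealI_cring) (auto simp: socle_def annihilator_def l_distr m_assoc m.Icarr)
qed

section \<open>Transport along isomorphisms\<close>

lemma surjective_hom_ring_length_le:
  assumes "ring_hom_ring R S h" "h ` carrier R = carrier S"
  shows "ring_length S \<le> ring_length R"
  unfolding ring_length_eq_Sup[of S]
proof (rule SUP_least, clarify)
  fix n I assume I: "ideal_chain S n I"
  interpret ring_hom_ring R S h by fact
  have sub: "I i \<subseteq> carrier S" if "i \<le> n" for i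
    using I that ideal.Icarr by (fastforce simp: ideal_chain_def)
  have "ideal_chain R n (\<lambda>i. {r \<in> carrier R. h r \<in> I i})"
    unfolding ideal_chain_def
  proof (intro conjI allI impI ideal_vimage)
    show "ideal (I i) S" if "i \<le> n" for i using I that by (simp add: ideal_chain_def)
    fix i assume i: "i < n"
    then have "I i \<subset> I (Suc i)" using I by (simp add: ideal_chain_def)
    moreover obtain x where x: "x \<in> I (Suc i)" "x \<notin> I i" using calculation by blast
    moreover obtain r where "r \<in> carrier R" "x = h r" using x sub[of "Suc i"] i assms(2) by auto
    ultimately show "{r \<in> carrier R. h r \<in> I i} \<subset> {r \<in> carrier R. h r \<in> I (Suc i)}" by blast
  qed
  then show "enat n \<le> ring_length R" by (rule ideal_chain_le_ring_length)
qed

lemma surjective_hom_artinian: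
  assumes "ring_hom_ring R S h" "h ` carrier R = carrier S" "artinian_ring R" "cring S"
  shows "artinian_ring S"
  unfolding artinian_ring_def
proof (intro conjI allI impI assms(4))
  fix I :: "nat \<Rightarrow> _ set" assume I: "(\<forall>n. ideal (I n) S) \<and> (\<forall>n. I (Suc n) \<subseteq> I n)"
  interpret ring_hom_ring R S h by fact
  let ?V = "\<lambda>n. {r \<in> carrier R. h r \<in> I n}"
  have img: "h ` ?V n = I n" for n
    using I assms(2) ideal.Icarr[of "I n" S] by (auto 0 4)
  have "(\<forall>n. ideal (?V n) R) \<and> (\<forall>n. ?V (Suc n) \<subseteq> ?V n)"
    using I ideal_vimage by blast
  then obtain N where "\<forall>n\<ge>N. ?V n = ?V N"
    using assms(3) unfolding artinian_ring_def by meson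
  then have "\<forall>n\<ge>N. I n = I N" using img by metis
  then show "\<exists>N. \<forall>n\<ge>N. I n = I N" by blast
qed

text \<open>Existential closedness speaks of rings over \<open>'a list\<close> only. The extensions
  are built over other types and are moved there along a map that is injective on the
  carrier.\<close>

lemma image_ring_artinian_local:
  fixes S (structure)
  assumes S: "artinian_local_ring S" and g: "inj_on g (carrier S)"
  shows "artinian_local_ring (image_ring g S)" "ring_length (image_ring g S) = ring_length S"
proof -
  let ?T = "image_ring g S"
  have loc: "local_ring S" and art: "artinian_ring S" using S by (auto simp: artinian_local_ring_def)
  interpret S: cring S using loc by (rule local_ringD(1))
  have iso: "g \<in> ring_iso S ?T" by (rule inj_imp_image_ring_iso[OF g])
  have T: "cring ?T"
    using S.ring_iso_imp_img_cring[OF iso] by (simp add: image_ring_def image_group_def monoid.defs)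
  interpret T: cring ?T by fact
  define k where "k = inv_into (carrier S) g"
  have isok: "k \<in> ring_iso ?T S" unfolding k_def by (rule ring_iso_set_sym[OF S.ring_axioms iso])
  have g_hom: "ring_hom_ring S ?T g"
    using iso by (intro ring_hom_ringI2 S.ring_axioms T.ring_axioms) (auto simp: ring_iso_def)
  have k_hom: "ring_hom_ring ?T S k"
    using isok by (intro ring_hom_ringI2 S.ring_axioms T.ring_axioms) (auto simp: ring_iso_def)
  have gs: "g ` carrier S = carrier ?T" using iso by (auto simp: ring_iso_def bij_betw_def)
  have ks: "k ` carrier ?T = carrier S" using isok by (auto simp: ring_iso_def bij_betw_def)
  interpret k: ring_hom_ring ?T S k by fact
  interpret g: ring_hom_ring S ?T g by fact
  show "ring_length ?T = ring_length S"
    using surjective_hom_ring_length_le[OF g_hom gs] surjective_hom_ring_length_le[OF k_hom ks] by simp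
  let ?M = "{r \<in> carrier ?T. k r \<in> max_ideal S}"
  have "local_ring ?T"
  proof (rule local_ringI(1)[OF T])
    show "ideal ?M ?T" by (rule k.ideal_vimage[OF local_ringD(3)[OF loc]])
    show "\<one>\<^bsub>?T\<^esub> \<notin> ?M" using local_ringD(4)[OF loc] by simp
    fix x assume x: "x \<in> carrier ?T" "x \<notin> ?M"
    then have u: "k x \<in> Units S" using local_ringD(5)[OF loc] by simp
    have gk: "g (k x) = x" using x(1) gs unfolding k_def by (auto intro: f_inv_into_f)
    have "g (inv (k x)) \<otimes>\<^bsub>?T\<^esub> g (k x) = \<one>\<^bsub>?T\<^esub>"
      using u by (metis S.Units_closed S.Units_inv_closed S.Units_l_inv g.hom_mult g.hom_one)
    moreover have "g (inv (k x)) \<in> carrier ?T" using u by simp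
    ultimately show "x \<in> Units ?T" using x(1) unfolding Units_def gk
      by (auto intro!: bexI[of _ "g (inv (k x))"] simp: T.m_comm)
  qed
  then show "artinian_local_ring ?T"
    using surjective_hom_artinian[OF g_hom gs art T] by (simp add: artinian_local_ring_def)
qed

text \<open>The type of lists is infinite even for finite \<open>'a\<close>, and an infinite set has
  as many elements as its square.\<close>

lemma exists_inj_list_pair: "\<exists>g :: 'a list \<times> 'a list \<Rightarrow> 'a list. inj g"
proof -
  have "(card_of ((UNIV :: 'a list set) \<times> (UNIV :: 'a list set)), card_of (UNIV :: 'a list set)) \<in> ordIso"
    by (rule card_of_Times_same_infinite[OF infinite_UNIV_listI])
  then have "(card_of (UNIV :: ('a list \<times> 'a list) set), card_of (UNIV :: 'a list set)) \<in> ordLeq"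
    using ordIso_imp_ordLeq by simp
  then show ?thesis unfolding card_of_ordLeq[symmetric] by auto
qed

section \<open>Existential formulas\<close>

lemma term_val_hom:
  assumes "ring_hom_ring S T f" "\<forall>p\<in>tparams t. h p \<in> carrier S" "\<forall>i. v i \<in> carrier S"
  shows "term_val S h v t \<in> carrier S \<and> term_val T (\<lambda>p. f (h p)) (\<lambda>i. f (v i)) t = f (term_val S h v t)"
proof -
  interpret ring_hom_ring S T f by fact
  show ?thesis using assms(2,3) by (induction t) auto
qed

text \<open>Injectivity makes equations reflected as well as preserved, and the equivalence is what
  carries the induction through \<open>FNot\<close>.\<close>

lemma qf_holds_hom:
  assumes f: "ring_hom_ring S T f" and inj: "inj_on f (carrier S)"
    and "\<forall>p\<in>qparams \<phi>. h p \<in> carrier S" "\<forall>i. v i \<in> carrier S"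
  shows "qf_holds T (\<lambda>p. f (h p)) (\<lambda>i. f (v i)) \<phi> \<longleftrightarrow> qf_holds S h v \<phi>"
  using assms(3)
proof (induction \<phi>)
  case (FEq s t)
  then show ?case
    using term_val_hom[OF f, of s h v] term_val_hom[OF f, of t h v] assms(4) inj
    by (auto simp: inj_on_eq_iff)
qed auto

lemma ex_holds_hom:
  assumes f: "ring_hom_ring S T f" "inj_on f (carrier S)" "\<forall>p\<in>qparams \<phi>. h p \<in> carrier S"
    and "ex_holds S h \<phi>"
  shows "ex_holds T (\<lambda>p. f (h p)) \<phi>"
proof -
  interpret ring_hom_ring S T f by fact
  obtain v where v: "\<forall>i. v i \<in> carrier S" "qf_holds S h v \<phi>" using assms(4) unfolding ex_holds_def by blast
  then have "qf_holds T (\<lambda>p. f (h p)) (\<lambda>i. f (v i)) \<phi>" using qf_holds_hom[OF f] by blast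
  then show ?thesis unfolding ex_holds_def using v(1) by (intro exI[of _ "\<lambda>i. f (v i)"]) auto
qed

section \<open>Enlarging the socle\<close>

text \<open>Has two uses: it lets an element of the ring multiply a residue class, and it codes a
  class by an element of \<open>'a\<close>, since \<open>'a set\<close> may be too large to be
  embedded in \<open>'a list\<close>.\<close>

definition coset_rep :: "'a set \<Rightarrow> 'a" where
  "coset_rep C = (SOME x. x \<in> C)"

lemma (in ideal) coset_rep_cong:
  assumes "a \<in> carrier R"
  shows "coset_rep (I +> a) \<in> carrier R" "I +> coset_rep (I +> a) = I +> a"
proof -
  have "a \<in> I +> a" using assms by (rule a_rcos_self)
  then have mem: "coset_rep (I +> a) \<in> I +> a" unfolding coset_rep_def by (rule someI)
  then show "I +> coset_rep (I +> a) = I +> a"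
    using a_repr_independence[OF mem assms] a_subgroup by simp
  show "coset_rep (I +> a) \<in> carrier R" using mem assms a_elemrcos_carrier by blast
qed

lemma (in ideal) inj_on_coset_rep: "inj_on coset_rep (carrier (R Quot I))"
proof (rule inj_onI)
  fix C D assume C: "C \<in> carrier (R Quot I)" and D: "D \<in> carrier (R Quot I)" and eq: "coset_rep C = coset_rep D"
  have *: "I +> coset_rep B = B" if "B \<in> carrier (R Quot I)" for B
    using that coset_rep_cong(2) by (fastforce simp: FactRing_def A_RCOSETS_def')
  show "C = D" using *[OF C] *[OF D] unfolding eq by metis
qed

text \<open>The ring \<open>R[X] / (X\<^sup>2 - s, \<mm> X)\<close>, whose elements are written as \<open>a + c X\<close> with \<open>c\<close> in the
  residue field. It is well defined when \<open>s\<close> lies in the maximal ideal and in the socle.\<close>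

definition root_ext :: "('a, 'm) ring_scheme \<Rightarrow> 'a \<Rightarrow> ('a \<times> 'a set) ring" where
  "root_ext R s = (let K = R Quot max_ideal R; pr = (\<lambda>a. max_ideal R +>\<^bsub>R\<^esub> a) in
    \<lparr>carrier = carrier R \<times> carrier K,
     monoid.mult = (\<lambda>(a, c) (b, d). (a \<otimes>\<^bsub>R\<^esub> b \<oplus>\<^bsub>R\<^esub> s \<otimes>\<^bsub>R\<^esub> coset_rep (c \<otimes>\<^bsub>K\<^esub> d), pr a \<otimes>\<^bsub>K\<^esub> d \<oplus>\<^bsub>K\<^esub> pr b \<otimes>\<^bsub>K\<^esub> c)),
     one = (\<one>\<^bsub>R\<^esub>, \<zero>\<^bsub>K\<^esub>),
     zero = (\<zero>\<^bsub>R\<^esub>, \<zero>\<^bsub>K\<^esub>),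
     add = (\<lambda>(a, c) (b, d). (a \<oplus>\<^bsub>R\<^esub> b, c \<oplus>\<^bsub>K\<^esub> d))\<rparr>)"

text \<open>That \<open>s\<close> annihilates the maximal ideal makes \<open>s\<close> times a
  residue class meaningful; that \<open>s\<close> is itself in the maximal ideal keeps
  \<open>X\<close> out of the units. Over a field the socle is the whole ring, so the first
  condition does not imply the second.\<close>

locale root_extension =
  fixes R (structure) and s
  assumes local: "local_ring R" and s_socle: "s \<in> socle R" and s_max: "s \<in> max_ideal R"
begin

definition pr :: "'a \<Rightarrow> 'a set" where
  "pr a = max_ideal R +> a"

sublocale cring R
  using local by (rule local_ringD(1))

sublocale m: ideal "max_ideal R" R
  using local by (rule local_ringD(3))

sublocale K: cring "R Quot max_ideal R"
  by (rule m.quotient_is_cring) (rule cring_axioms)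

sublocale pr: ring_hom_cring R "R Quot max_ideal R" pr
  unfolding pr_def using m.rcos_ring_hom_cring[OF cring_axioms] by simp

lemma s_closed [simp]: "s \<in> carrier R"
  using s_max m.Icarr by blast

lemma pr_eq_iff: "a \<in> carrier R \<Longrightarrow> b \<in> carrier R \<Longrightarrow> pr a = pr b \<longleftrightarrow> a \<ominus> b \<in> max_ideal R"
  unfolding pr_def using quotient_eq_iff_same_a_r_cos[OF m.is_ideal] by blast

lemma pr_eq_zero_iff: "a \<in> carrier R \<Longrightarrow> pr a = \<zero>\<^bsub>R Quot max_ideal R\<^esub> \<longleftrightarrow> a \<in> max_ideal R"
  using pr_eq_iff[of a \<zero>] by (simp add: minus_eq)

lemma carrier_residue: "carrier (R Quot max_ideal R) = pr ` carrier R"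
  by (auto simp: FactRing_def A_RCOSETS_def' pr_def)

text \<open>Two representatives of a class differ by an element of the maximal ideal, which
  \<open>s\<close> annihilates.\<close>

lemma twist_pr:
  assumes "a \<in> carrier R"
  shows "s \<otimes> coset_rep (pr a) = s \<otimes> a"
proof -
  let ?b = "coset_rep (pr a)"
  have b: "?b \<in> carrier R" "pr ?b = pr a"
    using m.coset_rep_cong[OF assms] by (auto simp: pr_def)
  then have "?b \<ominus> a \<in> max_ideal R" using pr_eq_iff assms by blast
  then have "s \<otimes> (?b \<ominus> a) = \<zero>" using s_socle by (auto simp: socle_def annihilator_def)
  moreover have "s \<otimes> ?b = s \<otimes> (?b \<ominus> a) \<oplus> s \<otimes> a" using b(1) assms s_closed by algebra
  ultimately show ?thesis using assms by simp
qed

abbreviation S where "S \<equiv> root_ext R s"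

lemma carrier_S: "carrier S = {(a, pr b) |a b. a \<in> carrier R \<and> b \<in> carrier R}"
  by (auto simp: root_ext_def Let_def carrier_residue)

lemma S_closed [simp]: "a \<in> carrier R \<Longrightarrow> b \<in> carrier R \<Longrightarrow> (a, pr b) \<in> carrier S"
  by (auto simp: carrier_S)

lemma S_cases:
  assumes "x \<in> carrier S"
  obtains a b where "a \<in> carrier R" "b \<in> carrier R" "x = (a, pr b)"
  using assms by (auto simp: carrier_S)

lemma S_zero: "\<zero>\<^bsub>S\<^esub> = (\<zero>, pr \<zero>)"
  by (simp add: root_ext_def Let_def)

lemma S_one: "\<one>\<^bsub>S\<^esub> = (\<one>, pr \<zero>)"
  by (simp add: root_ext_def Let_def)

lemma S_add:
  assumes "b \<in> carrier R" "d \<in> carrier R"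
  shows "(a, pr b) \<oplus>\<^bsub>S\<^esub> (c, pr d) = (a \<oplus> c, pr (b \<oplus> d))"
  using assms by (simp add: root_ext_def Let_def)

lemma S_mult:
  assumes "a \<in> carrier R" "b \<in> carrier R" "c \<in> carrier R" "d \<in> carrier R"
  shows "(a, pr b) \<otimes>\<^bsub>S\<^esub> (c, pr d) = (a \<otimes> c \<oplus> s \<otimes> (b \<otimes> d), pr (a \<otimes> d \<oplus> c \<otimes> b))"
proof -
  have "coset_rep (pr b \<otimes>\<^bsub>R Quot max_ideal R\<^esub> pr d) = coset_rep (pr (b \<otimes> d))"
    using assms by simp
  then show ?thesis using assms twist_pr[of "b \<otimes> d"] pr.hom_mult
    by (simp add: root_ext_def Let_def pr_def[symmetric])
qed

lemma S_cring: "cring S"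
proof (rule cringI)
  show "abelian_group S"
  proof (rule abelian_groupI)
    fix x assume "x \<in> carrier S"
    then obtain a b where x: "a \<in> carrier R" "b \<in> carrier R" "x = (a, pr b)" by (rule S_cases)
    show "\<exists>y\<in>carrier S. y \<oplus>\<^bsub>S\<^esub> x = \<zero>\<^bsub>S\<^esub>"
      using x by (intro bexI[of _ "(\<ominus> a, pr (\<ominus> b))"]) (simp_all add: S_add S_zero l_neg del: pr.hom_add pr.hom_a_inv)
  qed (auto elim!: S_cases simp: S_add S_zero a_ac simp del: pr.hom_add pr.hom_zero)
  show "comm_monoid S"
  proof (rule comm_monoidI)
    fix x y z assume "x \<in> carrier S" "y \<in> carrier S" "z \<in> carrier S"
    then obtain a b c d e f where x: "a \<in> carrier R" "b \<in> carrier R" "x = (a, pr b)"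
      and y: "c \<in> carrier R" "d \<in> carrier R" "y = (c, pr d)"
      and z: "e \<in> carrier R" "f \<in> carrier R" "z = (e, pr f)" by (metis S_cases)
    have "(a \<otimes> c \<oplus> s \<otimes> (b \<otimes> d)) \<otimes> e \<oplus> s \<otimes> ((a \<otimes> d \<oplus> c \<otimes> b) \<otimes> f) =
        a \<otimes> (c \<otimes> e \<oplus> s \<otimes> (d \<otimes> f)) \<oplus> s \<otimes> (b \<otimes> (c \<otimes> f \<oplus> e \<otimes> d))"
      "(a \<otimes> c \<oplus> s \<otimes> (b \<otimes> d)) \<otimes> f \<oplus> e \<otimes> (a \<otimes> d \<oplus> c \<otimes> b) =
        a \<otimes> (c \<otimes> f \<oplus> e \<otimes> d) \<oplus> (c \<otimes> e \<oplus> s \<otimes> (d \<otimes> f)) \<otimes> b"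
      using x(1,2) y(1,2) z(1,2) s_closed by algebra+
    then show "x \<otimes>\<^bsub>S\<^esub> y \<otimes>\<^bsub>S\<^esub> z = x \<otimes>\<^bsub>S\<^esub> (y \<otimes>\<^bsub>S\<^esub> z)"
      using x y z by (simp add: S_mult del: pr.hom_add pr.hom_mult)
  next
    fix x y assume "x \<in> carrier S" "y \<in> carrier S"
    then show "x \<otimes>\<^bsub>S\<^esub> y = y \<otimes>\<^bsub>S\<^esub> x" "x \<otimes>\<^bsub>S\<^esub> y \<in> carrier S"
      by (auto elim!: S_cases simp: S_mult a_ac m_ac simp del: pr.hom_add pr.hom_mult)
  next
    show "\<one>\<^bsub>S\<^esub> \<in> carrier S" by (simp add: S_one del: pr.hom_zero)
    show "x \<in> carrier S \<Longrightarrow> \<one>\<^bsub>S\<^esub> \<otimes>\<^bsub>S\<^esub> x = x" for x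
      by (auto elim!: S_cases simp: S_mult S_one simp del: pr.hom_add pr.hom_mult pr.hom_zero)
  qed
  fix x y z assume "x \<in> carrier S" "y \<in> carrier S" "z \<in> carrier S"
  then obtain a b c d e f where x: "a \<in> carrier R" "b \<in> carrier R" "x = (a, pr b)"
    and y: "c \<in> carrier R" "d \<in> carrier R" "y = (c, pr d)"
    and z: "e \<in> carrier R" "f \<in> carrier R" "z = (e, pr f)" by (metis S_cases)
  have "(a \<oplus> c) \<otimes> e \<oplus> s \<otimes> ((b \<oplus> d) \<otimes> f) = (a \<otimes> e \<oplus> s \<otimes> (b \<otimes> f)) \<oplus> (c \<otimes> e \<oplus> s \<otimes> (d \<otimes> f))"
    "(a \<oplus> c) \<otimes> f \<oplus> e \<otimes> (b \<oplus> d) = (a \<otimes> f \<oplus> e \<otimes> b) \<oplus> (c \<otimes> f \<oplus> e \<otimes> d)"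
    using x(1,2) y(1,2) z(1,2) s_closed by algebra+
  then show "(x \<oplus>\<^bsub>S\<^esub> y) \<otimes>\<^bsub>S\<^esub> z = x \<otimes>\<^bsub>S\<^esub> z \<oplus>\<^bsub>S\<^esub> y \<otimes>\<^bsub>S\<^esub> z"
    using x y z by (simp add: S_mult S_add del: pr.hom_add pr.hom_mult)
qed

sublocale S: cring S
  by (rule S_cring)

lemma S_minus:
  assumes "a \<in> carrier R" "b \<in> carrier R" "c \<in> carrier R" "d \<in> carrier R"
  shows "(a, pr b) \<ominus>\<^bsub>S\<^esub> (c, pr d) = (a \<ominus> c, pr (b \<ominus> d))"
proof -
  have eq: "(a, pr b) = (a \<ominus> c, pr (b \<ominus> d)) \<oplus>\<^bsub>S\<^esub> (c, pr d)"
  proof -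
    have "a = a \<ominus> c \<oplus> c" "b = b \<ominus> d \<oplus> d" using assms by algebra+
    then show ?thesis using assms S_add[of "b \<ominus> d" d "a \<ominus> c" c] by simp
  qed
  have *: "(z \<oplus>\<^bsub>S\<^esub> y) \<ominus>\<^bsub>S\<^esub> y = z" if "z \<in> carrier S" "y \<in> carrier S" for y z
    using that by (simp add: S.minus_eq S.a_assoc S.r_neg)
  have "((a \<ominus> c, pr (b \<ominus> d)) \<oplus>\<^bsub>S\<^esub> (c, pr d)) \<ominus>\<^bsub>S\<^esub> (c, pr d) = (a \<ominus> c, pr (b \<ominus> d))"
    using assms by (intro * S_closed) simp_all
  then show ?thesis unfolding eq[symmetric] .
qed

text \<open>The product of \<open>a\<close> in \<open>I\<close> with \<open>c + d X\<close> is
  \<open>c a + (a d) X\<close>. Its second part vanishes because \<open>a d\<close> lies in the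
  maximal ideal.\<close>

lemma S_ideal_zero:
  assumes "ideal I R" "I \<subseteq> max_ideal R"
  shows "ideal (I \<times> {pr \<zero>}) S"
proof (rule S.idealI_cring)
  interpret I: ideal I R by fact
  have pz: "pr a = pr \<zero>" if "a \<in> I" for a
    using pr_eq_zero_iff[of a] that assms(2) I.Icarr by auto
  show "I \<times> {pr \<zero>} \<subseteq> carrier S"
    using I.Icarr by (auto simp del: pr.hom_zero)
  show "\<zero>\<^bsub>S\<^esub> \<in> I \<times> {pr \<zero>}" by (simp add: S_zero)
  fix x assume x: "x \<in> I \<times> {pr \<zero>}"
  then obtain a where x: "x = (a, pr \<zero>)" "a \<in> I" by blast
  show "x \<oplus>\<^bsub>S\<^esub> y \<in> I \<times> {pr \<zero>}" if "y \<in> I \<times> {pr \<zero>}" for y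
    using that x by (auto simp: S_add simp del: pr.hom_add pr.hom_zero)
  show "y \<otimes>\<^bsub>S\<^esub> x \<in> I \<times> {pr \<zero>}" if y: "y \<in> carrier S" for y
  proof -
    obtain c d where cd: "c \<in> carrier R" "d \<in> carrier R" "y = (c, pr d)" using y by (rule S_cases)
    have "a \<otimes> d \<in> I" "c \<otimes> a \<in> I" using x(2) cd I.I_l_closed I.I_r_closed by auto
    then show ?thesis using x cd pz[of "a \<otimes> d"] I.Icarr
      by (simp add: S_mult del: pr.hom_add pr.hom_mult pr.hom_zero)
  qed
qed

definition M where "M = max_ideal R \<times> pr ` carrier R"

lemma mem_M: "b \<in> carrier R \<Longrightarrow> (a, pr b) \<in> M \<longleftrightarrow> a \<in> max_ideal R"
  by (auto simp: M_def)

lemma M_ideal: "ideal M S"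
proof (rule S.idealI_cring)
  show "M \<subseteq> carrier S"
    using m.Icarr by (auto simp: M_def)
  show "\<zero>\<^bsub>S\<^esub> \<in> M" by (simp add: S_zero mem_M del: pr.hom_zero)
  fix x assume x: "x \<in> M"
  then obtain a b where x: "x = (a, pr b)" "a \<in> max_ideal R" "b \<in> carrier R" by (auto simp: M_def)
  show "x \<oplus>\<^bsub>S\<^esub> y \<in> M" if y: "y \<in> M" for y
  proof -
    obtain c d where "y = (c, pr d)" "c \<in> max_ideal R" "d \<in> carrier R" using y by (auto simp: M_def)
    then show ?thesis using x by (simp add: S_add mem_M del: pr.hom_add)
  qed
  show "y \<otimes>\<^bsub>S\<^esub> x \<in> M" if y: "y \<in> carrier S" for y
  proof -
    obtain c d where cd: "c \<in> carrier R" "d \<in> carrier R" "y = (c, pr d)" using y by (rule S_cases)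
    then show ?thesis using x s_max m.Icarr
      by (simp add: S_mult mem_M m.I_l_closed m.I_r_closed del: pr.hom_add pr.hom_mult)
  qed
qed

lemma one_notin_M: "\<one>\<^bsub>S\<^esub> \<notin> M"
  using local_ringD(4)[OF local] by (simp add: S_one mem_M del: pr.hom_zero)

lemma S_units:
  assumes "x \<in> carrier S" "x \<notin> M"
  shows "x \<in> Units S"
proof -
  obtain a b where ab: "a \<in> carrier R" "b \<in> carrier R" "x = (a, pr b)" using assms(1) by (rule S_cases)
  have u: "a \<in> Units R" using assms(2) ab local_ringD(5)[OF local] by (simp add: mem_M)
  \<comment> \<open>The norm of \<open>a + b X\<close>, that is its product with the conjugate
    \<open>a - b X\<close>. The inverse of \<open>a + b X\<close> is the conjugate divided by
    \<open>w\<close>.\<close>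
  define w where "w = a \<otimes> a \<ominus> s \<otimes> (b \<otimes> b)"
  have wc: "w \<in> carrier R" using ab by (simp add: w_def)
  have "w \<notin> max_ideal R"
  proof
    assume "w \<in> max_ideal R"
    moreover have "s \<otimes> (b \<otimes> b) \<in> max_ideal R" using s_max ab m.I_r_closed by simp
    ultimately have "a \<otimes> a \<in> max_ideal R" unfolding w_def using m.mem_of_minus_mem ab by blast
    then have "inv a \<otimes> (inv a \<otimes> (a \<otimes> a)) \<in> max_ideal R" using m.I_l_closed Units_inv_closed[OF u] by metis
    moreover have "inv a \<otimes> (inv a \<otimes> (a \<otimes> a)) = \<one>"
      using u by (metis Units_closed Units_inv_closed Units_l_inv l_one m_assoc)
    ultimately show False using local_ringD(4)[OF local] by metis
  qed
  then have w: "w \<in> Units R" using wc local_ringD(5)[OF local] by blast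
  define v where "v = inv w"
  have v: "v \<in> carrier R" "w \<otimes> v = \<one>" using w by (auto simp: v_def)
  have "(v \<otimes> a, pr (\<ominus> (v \<otimes> b))) \<otimes>\<^bsub>S\<^esub> x = \<one>\<^bsub>S\<^esub>"
  proof -
    have "v \<otimes> a \<otimes> a \<oplus> s \<otimes> (\<ominus> (v \<otimes> b) \<otimes> b) = w \<otimes> v"
      unfolding w_def using v(1) ab s_closed by algebra
    moreover have "v \<otimes> a \<otimes> b \<oplus> a \<otimes> (\<ominus> (v \<otimes> b)) = \<zero>" using v(1) ab by algebra
    ultimately show ?thesis using ab v by (simp add: S_mult S_one del: pr.hom_add pr.hom_mult pr.hom_zero pr.hom_a_inv)
  qed
  moreover have "(v \<otimes> a, pr (\<ominus> (v \<otimes> b))) \<in> carrier S" using v(1) ab by (simp del: pr.hom_a_inv)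
  ultimately show ?thesis using assms(1) S.m_comm unfolding Units_def by fastforce
qed

lemma embed_hom: "(\<lambda>a. (a, pr \<zero>)) \<in> ring_hom R S"
  by (rule ring_hom_memI) (simp_all add: S_mult S_add S_one del: pr.hom_add pr.hom_mult pr.hom_zero)

text \<open>The series of \<open>R\<close> is kept up to its last proper member, the maximal ideal.
  Above it come \<open>M\<close>, with the residue field times \<open>X\<close> as the only new
  quotient, and the whole ring. This accounts for exactly one additional step.\<close>

lemma S_comp_series:
  assumes J: "comp_series R n J" and strict: "\<And>i. i < n \<Longrightarrow> J i \<noteq> J (Suc i)"
  defines "J' \<equiv> \<lambda>i. if i < n then J i \<times> {pr \<zero>} else if i = n then M else carrier S"
  shows "comp_series S (Suc n) J'" "\<And>i. i < Suc n \<Longrightarrow> J' i \<noteq> J' (Suc i)"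
proof -
  have Jid: "ideal (J i) R" if "i \<le> n" for i using J that by (simp add: comp_series_def)
  have "\<one> \<noteq> \<zero>" using local_ringD(4)[OF local] m.zero_closed by metis
  then have "n \<noteq> 0" using J by (auto simp: comp_series_def)
  then obtain k where k: "n = Suc k" by (cases n) auto
  have Jmono: "J i \<subseteq> J j" if "i \<le> j" "j \<le> n" for i j
    using that
  proof (induction j)
    case (Suc j)
    then have "J j \<subseteq> J (Suc j)" using J by (simp add: comp_series_def)
    then show ?case using Suc by (cases "i = Suc j") auto
  qed simp
  \<comment> \<open>The last proper member contains no unit, since otherwise the last inclusion
    would not be strict; conversely the maximal ideal times \<open>\<one>\<close> falls into
    it.\<close>
  have Jk: "J k = max_ideal R"
  proof
    interpret Jk: ideal "J k" R using Jid[of k] k by simp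
    show "J k \<subseteq> max_ideal R"
    proof
      fix a assume a: "a \<in> J k"
      show "a \<in> max_ideal R"
      proof (rule ccontr)
        assume "a \<notin> max_ideal R"
        then have "a \<in> Units R" using a Jk.Icarr local_ringD(5)[OF local] by blast
        then have "\<one> \<in> J k" using a Jk.I_l_closed[of a "inv a"] by simp
        then have "J k = carrier R" by (rule Jk.one_imp_carrier)
        then show False using strict[of k] k J by (simp add: comp_series_def)
      qed
    qed
    show "max_ideal R \<subseteq> J k"
    proof
      fix a assume a: "a \<in> max_ideal R"
      have "\<one> \<in> J (Suc k)" using J k by (simp add: comp_series_def)
      then have "a \<otimes> \<one> \<in> J k" using comp_series_max_ideal_mult[OF local J _ a] k by simp
      then show "a \<in> J k" using a m.Icarr by simp
    qed
  qed
  have Jsub: "J i \<subseteq> max_ideal R" if "i < n" for i using Jmono[of i k] that k Jk by simp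
  have pz: "pr a = pr \<zero>" if "a \<in> max_ideal R" for a
    using pr_eq_zero_iff[of a] that m.Icarr by auto
  have M0: "max_ideal R \<times> {pr \<zero>} \<noteq> M"
  proof
    assume "max_ideal R \<times> {pr \<zero>} = M"
    moreover have "(\<zero>, pr \<one>) \<in> M" by (simp add: mem_M del: pr.hom_one)
    ultimately have "(\<zero>, pr \<one>) \<in> max_ideal R \<times> {pr \<zero>}" by simp
    then show False using pr_eq_zero_iff[of \<one>] local_ringD(4)[OF local] by auto
  qed
  have J'_ideal: "ideal (J' i) S" if "i \<le> Suc n" for i
    using S_ideal_zero[OF Jid Jsub] M_ideal S.oneideal that by (auto simp: J'_def simp del: pr.hom_zero)
  show "comp_series S (Suc n) J'"
    unfolding comp_series_def
  proof (intro conjI allI impI)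
    show "J' 0 = {\<zero>\<^bsub>S\<^esub>}" using J k by (simp add: J'_def comp_series_def S_zero)
    show "J' (Suc n) = carrier S" by (simp add: J'_def)
    show "ideal (J' i) S" if "i \<le> Suc n" for i by (rule J'_ideal[OF that])
    fix i assume i: "i < Suc n"
    then have cases: "Suc i < n \<or> i = k \<or> i = n" using k by linarith
    then consider "Suc i < n" | "i = k" | "i = n" by blast
    then show "J' i \<subseteq> J' (Suc i)"
    proof cases
      case 1
      then show ?thesis using Jmono[of i "Suc i"] by (auto simp: J'_def)
    next
      case 2
      then show ?thesis using k Jk by (auto simp: J'_def M_def simp del: pr.hom_zero)
    next
      case 3
      then show ?thesis using ideal.Icarr[OF M_ideal] by (auto simp: J'_def)
    qed
    show "simple_step S (J' i) (J' (Suc i))"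
      unfolding simple_step_def
    proof (intro ballI)
      fix x y assume x: "x \<in> J' (Suc i)" and y: "y \<in> J' (Suc i) - J' i"
      have c: "x \<in> carrier S" "y \<in> carrier S"
        using x y ideal.Icarr[OF J'_ideal[of "Suc i"]] i by auto
      obtain a b where ab: "a \<in> carrier R" "b \<in> carrier R" "x = (a, pr b)" using c(1) by (rule S_cases)
      obtain e d where ed: "e \<in> carrier R" "d \<in> carrier R" "y = (e, pr d)" using c(2) by (rule S_cases)
      \<comment> \<open>In all three cases the multiplier can be taken from \<open>R\<close>: for an
        old step it is the old multiplier, for the step of \<open>X\<close> it is \<open>b\<close>
        divided by \<open>d\<close>, and for the top step \<open>a\<close> divided by
        \<open>e\<close>.\<close>
      have *: "x \<ominus>\<^bsub>S\<^esub> (r, pr \<zero>) \<otimes>\<^bsub>S\<^esub> y = (a \<ominus> r \<otimes> e, pr (b \<ominus> r \<otimes> d))"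
        if "r \<in> carrier R" for r
      proof -
        have "(r, pr \<zero>) \<otimes>\<^bsub>S\<^esub> y = (r \<otimes> e, pr (r \<otimes> d))"
          using that ed by (simp add: S_mult del: pr.hom_add pr.hom_mult pr.hom_zero)
        then show ?thesis using S_minus[of a b "r \<otimes> e" "r \<otimes> d"] ab ed that by simp
      qed
      from cases consider "Suc i < n" | "i = k" | "i = n" by blast
      then show "\<exists>r\<in>carrier S. x \<ominus>\<^bsub>S\<^esub> r \<otimes>\<^bsub>S\<^esub> y \<in> J' i"
      proof cases
        case 1
        then have m: "a \<in> J (Suc i)" "e \<in> J (Suc i) - J i" "pr b = pr \<zero>" "pr d = pr \<zero>"
          using x y ab ed by (auto simp: J'_def)
        then obtain r where r: "r \<in> carrier R" "a \<ominus> r \<otimes> e \<in> J i"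
          using J 1 unfolding comp_series_def simple_step_def by (meson Suc_lessD)
        have "pr (b \<ominus> r \<otimes> d) = pr \<zero>"
          using m(3,4) ab ed r(1) by (simp add: minus_eq)
        then show ?thesis using *[OF r(1)] r 1
          by (intro bexI[of _ "(r, pr \<zero>)"]) (simp_all add: J'_def del: pr.hom_zero)
      next
        case 2
        then have m: "a \<in> max_ideal R" "e \<in> max_ideal R" "pr d \<noteq> pr \<zero>"
          using x y ab ed k Jk mem_M by (auto simp: J'_def simp del: pr.hom_zero)
        then have "d \<in> Units R" using pr_eq_zero_iff[OF ed(2)] ed(2) local_ringD(5)[OF local] by auto
        then have r: "b \<otimes> inv d \<in> carrier R" "b \<otimes> inv d \<otimes> d = b" using ab ed by (auto simp: m_assoc)
        have "b \<ominus> b \<otimes> inv d \<otimes> d = \<zero>" using r(2) ab by (simp add: minus_eq r_neg)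
        moreover have "a \<ominus> b \<otimes> inv d \<otimes> e \<in> max_ideal R"
          using m r(1) m.minus_mem m.I_l_closed by blast
        ultimately show ?thesis using *[OF r(1)] r 2 k Jk
          by (intro bexI[of _ "(b \<otimes> inv d, pr \<zero>)"]) (simp_all add: J'_def del: pr.hom_zero)
      next
        case 3
        then have "e \<notin> max_ideal R" using y ed mem_M by (auto simp: J'_def)
        then have "e \<in> Units R" using ed local_ringD(5)[OF local] by auto
        then have r: "a \<otimes> inv e \<in> carrier R" "a \<otimes> inv e \<otimes> e = a" using ab ed by (auto simp: m_assoc)
        have "a \<ominus> a \<otimes> inv e \<otimes> e = \<zero>" using r(2) ab by (simp add: minus_eq r_neg)
        then have "x \<ominus>\<^bsub>S\<^esub> (a \<otimes> inv e, pr \<zero>) \<otimes>\<^bsub>S\<^esub> y = (\<zero>, pr (b \<ominus> a \<otimes> inv e \<otimes> d))"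
          using *[OF r(1)] by simp
        moreover have "(\<zero>, pr (b \<ominus> a \<otimes> inv e \<otimes> d)) \<in> M"
          by (subst mem_M) (use r ab ed in auto)
        ultimately have "x \<ominus>\<^bsub>S\<^esub> (a \<otimes> inv e, pr \<zero>) \<otimes>\<^bsub>S\<^esub> y \<in> J' i" using 3 by (simp add: J'_def)
        then show ?thesis using S_closed[OF r(1) zero_closed] by blast
      qed
    qed
  qed
  show "J' i \<noteq> J' (Suc i)" if "i < Suc n" for i
  proof -
    from that consider "Suc i < n" | "i = k" | "i = n" using k by linarith
    then show ?thesis
    proof cases
      case 1
      then show ?thesis using strict[of i] by (auto simp: J'_def)
    next
      case 2
      then show ?thesis using k Jk M0 by (simp add: J'_def del: pr.hom_zero)
    next
      case 3
      then show ?thesis using one_notin_M S.one_closed by (auto simp: J'_def)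
    qed
  qed
qed

lemma S_artinian_local:
  assumes "artinian_local_ring R" "ring_length R = enat n"
  shows "artinian_local_ring S" "ring_length S = enat (Suc n)"
proof -
  obtain J where J: "comp_series R n J" "\<And>i. i < n \<Longrightarrow> J i \<noteq> J (Suc i)"
    using exists_comp_series[OF cring_axioms assms(2)] by blast
  note J' = S_comp_series[OF J]
  show "artinian_local_ring S"
    by (rule artinian_localI(1)[OF S_cring M_ideal one_notin_M S_units J'(1)])
  show "ring_length S = enat (Suc n)"
    by (rule strict_comp_series_ring_length[OF S_cring J'])
qed

definition root :: "'a \<times> 'a set" where
  "root = (\<zero>, pr \<one>)"

lemma root_closed: "root \<in> carrier S"
  by (simp add: root_def del: pr.hom_one)

lemma root_square: "root \<otimes>\<^bsub>S\<^esub> root = (s, pr \<zero>)"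
  by (simp add: root_def S_mult del: pr.hom_zero pr.hom_one pr.hom_add pr.hom_mult)

lemma root_ne_zero: "root \<noteq> \<zero>\<^bsub>S\<^esub>"
  using pr_eq_zero_iff[of \<one>] local_ringD(4)[OF local] by (simp add: root_def S_zero)

lemma max_ideal_mult_root:
  assumes "a \<in> max_ideal R"
  shows "root \<otimes>\<^bsub>S\<^esub> (a, pr \<zero>) = \<zero>\<^bsub>S\<^esub>"
proof -
  have "pr a = pr \<zero>" using pr_eq_zero_iff[of a] assms m.Icarr by auto
  then show ?thesis using m.Icarr[OF assms]
    by (simp add: root_def S_mult S_zero del: pr.hom_zero pr.hom_one pr.hom_add pr.hom_mult)
qed

lemma inj_on_pair_coset_rep: "inj_on (\<lambda>(a, c). (a, coset_rep c)) (carrier S)"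
  using m.inj_on_coset_rep by (auto simp: inj_on_def root_ext_def Let_def)

end

section \<open>Realizing existential sentences\<close>

lemma inj_on_hom_comp:
  assumes "h \<in> ring_hom A B" "inj_on h (carrier A)" "inj_on g (carrier B)"
  shows "inj_on (g \<circ> h) (carrier A)"
  using assms by (intro comp_inj_on) (auto simp: ring_hom_def intro: inj_on_subset)

text \<open>Here \<open>s = \<zero>\<close>, so \<open>X\<close> has square zero. Coding pairs of
  lists as lists keeps the result over \<open>'a list\<close>, and the construction can be iterated
  within one type.\<close>

lemma Art_le_root_ext:
  fixes R :: "'a list ring"
  assumes R: "artinian_local_ring R" "ring_length R = enat n"
  obtains T :: "'a list ring" and f
  where "artinian_local_ring T" "ring_length T = enat (Suc n)" "f \<in> ring_hom R T" "inj_on f (carrier R)"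
proof -
  have loc: "local_ring R" using R by (simp add: artinian_local_ring_def)
  interpret r: root_extension R "\<zero>\<^bsub>R\<^esub>"
  proof
    show "local_ring R" by (rule loc)
    show "\<zero>\<^bsub>R\<^esub> \<in> socle R" "\<zero>\<^bsub>R\<^esub> \<in> max_ideal R"
      using socle_ideal[OF loc] local_ringD(3)[OF loc]
      by (auto intro: additive_subgroup.zero_closed ideal.axioms)
  qed
  obtain g :: "'a list \<times> 'a list \<Rightarrow> 'a list" where g: "inj g" using exists_inj_list_pair by blast
  define k where "k = g \<circ> (\<lambda>(a, c). (a, coset_rep c))"
  have k: "inj_on k (carrier r.S)"
    unfolding k_def using r.inj_on_pair_coset_rep g by (meson comp_inj_on inj_on_subset subset_UNIV)
  note S = r.S_artinian_local[OF R]
  have iso: "k \<in> ring_hom r.S (image_ring k r.S)"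
    using inj_imp_image_ring_iso[OF k] by (simp add: ring_iso_def)
  let ?f = "k \<circ> (\<lambda>a. (a, r.pr \<zero>\<^bsub>R\<^esub>))"
  have "?f \<in> ring_hom R (image_ring k r.S)"
    by (rule ring_hom_trans[OF r.embed_hom iso])
  moreover have "inj_on ?f (carrier R)"
    by (rule inj_on_hom_comp[OF r.embed_hom _ k]) (simp add: inj_on_def)
  ultimately show ?thesis using that image_ring_artinian_local[OF S(1) k] S(2) by metis
qed

lemma Art_le_embeds_Art_eq:
  fixes R :: "'a list ring"
  assumes "artinian_local_ring R" "ring_length R = enat n" "n \<le> l"
  obtains T :: "'a list ring" and f where "Art_eq l T" "f \<in> ring_hom R T" "inj_on f (carrier R)"
  using assms
proof (induction "l - n" arbitrary: n R thesis)
  case 0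
  then have "Art_eq l R" by (simp add: Art_eq_def)
  then show ?case using 0(2)[of R id] by (simp add: ring_hom_def)
next
  case (Suc d)
  obtain T :: "'a list ring" and f
    where T: "artinian_local_ring T" "ring_length T = enat (Suc n)" "f \<in> ring_hom R T" "inj_on f (carrier R)"
    using Art_le_root_ext[OF Suc(4,5)] by blast
  have "d = l - Suc n" "Suc n \<le> l" using Suc(2) by auto
  then obtain U :: "'a list ring" and f' where U: "Art_eq l U" "f' \<in> ring_hom T U" "inj_on f' (carrier T)"
    using Suc(1)[of "Suc n" T] T(1,2) by blast
  have "f' \<circ> f \<in> ring_hom R U" by (rule ring_hom_trans[OF T(3) U(2)])
  moreover have "inj_on (f' \<circ> f) (carrier R)"
    by (rule inj_on_hom_comp[OF T(3,4) U(3)])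
  ultimately show ?case using Suc(3) U(1) by blast
qed

text \<open>The common access to both theories. When the length has to be exact, the extension is
  enlarged until it has length \<open>l\<close>; existential sentences with parameters remain true
  under such embeddings.\<close>

lemma existentially_closed_realize:
  fixes R :: "'a ring" and S :: "'c ring" and g :: "'c \<Rightarrow> 'a list"
  assumes ec: "existentially_closed (Art_le l) (Art_le l) R \<or> existentially_closed (Art_eq l) (Art_eq l) R"
    and S: "artinian_local_ring S" "ring_length S \<le> enat l"
    and h: "h \<in> ring_hom R S" "inj_on h (carrier R)" and g: "inj_on g (carrier S)"
    and \<phi>: "qparams \<phi> \<subseteq> carrier R" "ex_holds S h \<phi>"
  shows "ex_holds R (\<lambda>r. r) \<phi>"
proof -
  define T where "T = image_ring g S"
  have T: "artinian_local_ring T" "ring_length T \<le> enat l"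
    using image_ring_artinian_local[OF S(1) g] S(2) by (simp_all add: T_def)
  have g_hom: "g \<in> ring_hom S T"
    using inj_imp_image_ring_iso[OF g] by (simp add: ring_iso_def T_def)
  have gh: "g \<circ> h \<in> ring_hom R T" "inj_on (g \<circ> h) (carrier R)"
    using ring_hom_trans[OF h(1) g_hom] inj_on_hom_comp[OF h g] by blast+
  have ringS: "ring S" using S(1) by (simp add: artinian_local_ring_def local_ring_def cring.axioms(1))
  have ringT: "ring T" using T(1) by (simp add: artinian_local_ring_def local_ring_def cring.axioms(1))
  have exT: "ex_holds T (g \<circ> h) \<phi>"
    using ex_holds_hom[OF ring_hom_ringI2[OF ringS ringT g_hom] g _ \<phi>(2)] \<phi>(1) h(1)
    by (auto simp: o_def ring_hom_def)
  from ec show ?thesis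
  proof
    assume "existentially_closed (Art_le l) (Art_le l) R"
    moreover have "Art_le l T" using T by (simp add: Art_le_def)
    ultimately show ?thesis using gh exT \<phi>(1) unfolding existentially_closed_def by blast
  next
    assume ec: "existentially_closed (Art_eq l) (Art_eq l) R"
    obtain n where n: "ring_length T = enat n" "n \<le> l" using T(2) by (cases "ring_length T") auto
    obtain U :: "'a list ring" and f where U: "Art_eq l U" "f \<in> ring_hom T U" "inj_on f (carrier T)"
      using Art_le_embeds_Art_eq[OF T(1) n] by blast
    have ringU: "ring U"
      using U(1) by (simp add: Art_eq_def artinian_local_ring_def local_ring_def cring.axioms(1))
    have "f \<circ> (g \<circ> h) \<in> ring_hom R U" by (rule ring_hom_trans[OF gh(1) U(2)])
    moreover have "inj_on (f \<circ> (g \<circ> h)) (carrier R)"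
      by (rule inj_on_hom_comp[OF gh U(3)])
    moreover have "ex_holds U (f \<circ> (g \<circ> h)) \<phi>"
      using ex_holds_hom[OF ring_hom_ringI2[OF ringT ringU U(2)] U(3) _ exT] \<phi>(1) gh(1)
      by (auto simp: o_def ring_hom_def)
    ultimately show ?thesis using ec U(1) \<phi>(1) unfolding existentially_closed_def by blast
  qed
qed

section \<open>Localization of a quotient at a prime ideal\<close>

text \<open>The ring \<open>(A / J)\<^sub>P\<close>. Every fraction is represented by a chosen pair rather than by an
  equivalence class, so that the carrier stays in the type \<open>'a \<times> 'a\<close>.\<close>

locale localized_quotient = cring A + P: primeideal P A + J: ideal J A
  for A (structure) and P and J +
  assumes J_sub_P: "J \<subseteq> P"
begin

text \<open>The kernel of the canonical map from \<open>A\<close> to the localization at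
  \<open>P\<close> of \<open>A / J\<close>.\<close>

definition sat :: "'a set" where
  "sat = {a \<in> carrier A. \<exists>u\<in>carrier A - P. u \<otimes> a \<in> J}"

definition dens :: "'a set" where
  "dens = carrier A - P"

text \<open>The extra denominator usual in the equality of fractions is hidden in
  \<open>sat\<close>.\<close>

definition fraction_rel :: "'a \<times> 'a \<Rightarrow> 'a \<times> 'a \<Rightarrow> bool" where
  "fraction_rel x y \<longleftrightarrow> fst x \<otimes> snd y \<ominus> fst y \<otimes> snd x \<in> sat"

definition fraction :: "'a \<Rightarrow> 'a \<Rightarrow> 'a \<times> 'a" where
  "fraction p q = (SOME y. y \<in> carrier A \<times> dens \<and> fraction_rel (p, q) y)"

definition Loc :: "('a \<times> 'a) ring" where
  "Loc = \<lparr>carrier = {fraction p q |p q. p \<in> carrier A \<and> q \<in> dens},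
     monoid.mult = (\<lambda>(p, q) (p', q'). fraction (p \<otimes> p') (q \<otimes> q')),
     one = fraction \<one> \<one>, zero = fraction \<zero> \<one>,
     add = (\<lambda>(p, q) (p', q'). fraction (p \<otimes> q' \<oplus> p' \<otimes> q) (q \<otimes> q'))\<rparr>"

lemma dens_closed [simp]: "q \<in> dens \<Longrightarrow> q \<in> carrier A"
  by (simp add: dens_def)

lemma one_dens [simp]: "\<one> \<in> dens"
  using P.one_imp_carrier P.I_notcarr by (auto simp: dens_def)

lemma mult_dens [simp]: "q \<in> dens \<Longrightarrow> t \<in> dens \<Longrightarrow> q \<otimes> t \<in> dens"
  using P.I_prime by (auto simp: dens_def)

lemma satI: "a \<in> carrier A \<Longrightarrow> u \<in> dens \<Longrightarrow> u \<otimes> a \<in> J \<Longrightarrow> a \<in> sat"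
  unfolding sat_def dens_def by blast

lemma satE:
  assumes "a \<in> sat"
  obtains u where "a \<in> carrier A" "u \<in> dens" "u \<otimes> a \<in> J"
  using assms unfolding sat_def dens_def by blast

lemma sat_ideal: "ideal sat A"
proof (rule idealI_cring)
  show "sat \<subseteq> carrier A" by (auto simp: sat_def)
  show "\<zero> \<in> sat" using one_dens by (auto simp: sat_def dens_def intro!: bexI[of _ \<one>])
  fix a assume "a \<in> sat"
  then obtain u where a: "a \<in> carrier A" "u \<in> dens" "u \<otimes> a \<in> J" by (auto simp: sat_def dens_def)
  show "a \<oplus> b \<in> sat" if "b \<in> sat" for b
  proof -
    obtain v where b: "b \<in> carrier A" "v \<in> dens" "v \<otimes> b \<in> J" using \<open>b \<in> sat\<close> by (auto simp: sat_def dens_def)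
    have "(u \<otimes> v) \<otimes> (a \<oplus> b) = v \<otimes> (u \<otimes> a) \<oplus> u \<otimes> (v \<otimes> b)"
      using dens_closed[OF a(2)] dens_closed[OF b(2)] a(1) b(1) by algebra
    also have "\<dots> \<in> J" using a b J.I_l_closed by simp
    finally show ?thesis using mult_dens[OF a(2) b(2)] a(1) b(1) unfolding sat_def dens_def by blast
  qed
  show "x \<otimes> a \<in> sat" if "x \<in> carrier A" for x
  proof -
    have "u \<otimes> (x \<otimes> a) = x \<otimes> (u \<otimes> a)" using dens_closed[OF a(2)] a(1) that by (simp add: m_ac)
    then have "u \<otimes> (x \<otimes> a) \<in> J" using J.I_l_closed[OF a(3) that] by simp
    then show ?thesis using a that by (auto simp: sat_def dens_def)
  qed
qed

sublocale sat: ideal sat A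
  by (rule sat_ideal)

lemma J_sub_sat: "J \<subseteq> sat"
proof
  fix a assume "a \<in> J"
  then have "a \<in> carrier A" "\<one> \<otimes> a \<in> J" by simp_all
  then show "a \<in> sat" using one_dens unfolding sat_def dens_def by blast
qed

lemma sat_sub_P: "sat \<subseteq> P"
proof
  fix a assume "a \<in> sat"
  then obtain u where u: "a \<in> carrier A" "u \<in> carrier A" "u \<notin> P" "u \<otimes> a \<in> J"
    unfolding sat_def by blast
  then have "u \<otimes> a \<in> P" using J_sub_P by (rule_tac subsetD)
  then show "a \<in> P" using P.I_prime[OF u(2,1)] u(3) by blast
qed

lemma sat_cancel:
  assumes "u \<in> dens" "a \<in> carrier A" "u \<otimes> a \<in> sat"
  shows "a \<in> sat"
  using assms(3)
proof (rule satE)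
  fix v assume v: "v \<in> dens" "v \<otimes> (u \<otimes> a) \<in> J"
  then have "(v \<otimes> u) \<otimes> a \<in> J" using assms(1,2) by (simp add: m_assoc)
  then show ?thesis using satI[OF assms(2) mult_dens[OF v(1) assms(1)]] by blast
qed

lemma fraction_rel_refl: "p \<in> carrier A \<Longrightarrow> q \<in> dens \<Longrightarrow> fraction_rel (p, q) (p, q)"
  by (simp add: fraction_rel_def minus_eq r_neg)

lemma fraction_rel_sym:
  assumes "p \<in> carrier A" "q \<in> dens" "r \<in> carrier A" "t \<in> dens" "fraction_rel (p, q) (r, t)"
  shows "fraction_rel (r, t) (p, q)"
proof -
  have "r \<otimes> q \<ominus> p \<otimes> t = \<ominus> (p \<otimes> t \<ominus> r \<otimes> q)"
    using assms(1,3) dens_closed[OF assms(2)] dens_closed[OF assms(4)] by algebra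
  then show ?thesis using assms(5) by (simp add: fraction_rel_def)
qed

lemma fraction_rel_trans:
  assumes "p \<in> carrier A" "q \<in> dens" "r \<in> carrier A" "t \<in> dens" "v \<in> carrier A" "w \<in> dens"
    and 1: "fraction_rel (p, q) (r, t)" and 2: "fraction_rel (r, t) (v, w)"
  shows "fraction_rel (p, q) (v, w)"
proof -
  note c = assms(1,3,5) dens_closed[OF assms(2)] dens_closed[OF assms(4)] dens_closed[OF assms(6)]
  \<comment> \<open>The two given relations combine only after multiplication by the middle
    denominator \<open>t\<close>, which \<open>sat_cancel\<close> then removes.\<close>
  have "t \<otimes> (p \<otimes> w \<ominus> v \<otimes> q) = w \<otimes> (p \<otimes> t \<ominus> r \<otimes> q) \<oplus> q \<otimes> (r \<otimes> w \<ominus> v \<otimes> t)"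
    using c by algebra
  also have "\<dots> \<in> sat"
    using 1 2 c unfolding fraction_rel_def fst_conv snd_conv
    by (intro additive_subgroup.a_closed[OF sat.additive_subgroup_axioms] sat.I_l_closed) simp_all
  finally have *: "t \<otimes> (p \<otimes> w \<ominus> v \<otimes> q) \<in> sat" .
  show ?thesis unfolding fraction_rel_def fst_conv snd_conv
    by (rule sat_cancel[OF assms(4) _ *]) (use c in simp)
qed

lemma fraction_rep:
  assumes "p \<in> carrier A" "q \<in> dens"
  obtains r t where "r \<in> carrier A" "t \<in> dens" "fraction p q = (r, t)" "fraction_rel (p, q) (r, t)"
proof -
  have "\<exists>y. y \<in> carrier A \<times> dens \<and> fraction_rel (p, q) y"
    using fraction_rel_refl[OF assms] assms by (intro exI[of _ "(p, q)"]) simp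
  then have "fraction p q \<in> carrier A \<times> dens \<and> fraction_rel (p, q) (fraction p q)"
    unfolding fraction_def by (rule someI_ex)
  then show ?thesis using that by (cases "fraction p q") auto
qed

text \<open>Equivalent pairs satisfy the same defining predicate, so the choice operator picks the
  same pair for both. Conversely, each pair is equivalent to the one picked for it.\<close>

lemma fraction_eq_iff:
  assumes "p \<in> carrier A" "q \<in> dens" "r \<in> carrier A" "t \<in> dens"
  shows "fraction p q = fraction r t \<longleftrightarrow> p \<otimes> t \<ominus> r \<otimes> q \<in> sat"
proof
  assume eq: "fraction p q = fraction r t"
  obtain a b where 1: "a \<in> carrier A" "b \<in> dens" "fraction p q = (a, b)" "fraction_rel (p, q) (a, b)"
    using fraction_rep[OF assms(1,2)] by blast
  obtain c d where 2: "c \<in> carrier A" "d \<in> dens" "fraction r t = (c, d)" "fraction_rel (r, t) (c, d)"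
    using fraction_rep[OF assms(3,4)] by blast
  have "fraction_rel (a, b) (r, t)" using fraction_rel_sym[OF assms(3,4) 2(1,2,4)] 1 2 eq by simp
  then have "fraction_rel (p, q) (r, t)" using fraction_rel_trans[OF assms(1,2) 1(1,2) assms(3,4) 1(4)] by simp
  then show "p \<otimes> t \<ominus> r \<otimes> q \<in> sat" by (simp add: fraction_rel_def)
next
  assume "p \<otimes> t \<ominus> r \<otimes> q \<in> sat"
  then have r: "fraction_rel (p, q) (r, t)" by (simp add: fraction_rel_def)
  have "(y \<in> carrier A \<times> dens \<and> fraction_rel (p, q) y) = (y \<in> carrier A \<times> dens \<and> fraction_rel (r, t) y)" for y
  proof (cases y)
    case (Pair a b)
    then show ?thesis
      using fraction_rel_trans[OF assms(1-4), of a b, OF _ _ r]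
        fraction_rel_trans[OF assms(3,4,1,2), of a b, OF _ _ fraction_rel_sym[OF assms r]] by auto
  qed
  then show "fraction p q = fraction r t" unfolding fraction_def by presburger
qed

lemma fraction_eqI:
  assumes "p \<in> carrier A" "q \<in> dens" "r \<in> carrier A" "t \<in> dens" "p \<otimes> t = r \<otimes> q"
  shows "fraction p q = fraction r t"
  using assms by (simp add: fraction_eq_iff minus_eq r_neg)

lemma Loc_cases:
  assumes "x \<in> carrier Loc"
  obtains p q where "p \<in> carrier A" "q \<in> dens" "x = fraction p q"
  using assms by (auto simp: Loc_def)

lemma Loc_closed [simp]: "p \<in> carrier A \<Longrightarrow> q \<in> dens \<Longrightarrow> fraction p q \<in> carrier Loc"
  by (auto simp: Loc_def)

text \<open>The definition multiplies the chosen pairs. Any other pairs give the same class, because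
  the difference of the cross products is a combination of the two that relate the given pairs to
  the chosen ones.\<close>

lemma Loc_mult:
  assumes "p \<in> carrier A" "q \<in> dens" "r \<in> carrier A" "t \<in> dens"
  shows "fraction p q \<otimes>\<^bsub>Loc\<^esub> fraction r t = fraction (p \<otimes> r) (q \<otimes> t)"
proof -
  obtain a b where 1: "a \<in> carrier A" "b \<in> dens" "fraction p q = (a, b)" "fraction_rel (p, q) (a, b)"
    using fraction_rep[OF assms(1,2)] by blast
  obtain c d where 2: "c \<in> carrier A" "d \<in> dens" "fraction r t = (c, d)" "fraction_rel (r, t) (c, d)"
    using fraction_rep[OF assms(3,4)] by blast
  note cl = assms(1,3) 1(1) 2(1) assms(2,4)[THEN dens_closed] 1(2)[THEN dens_closed] 2(2)[THEN dens_closed]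
  have "(p \<otimes> r) \<otimes> (b \<otimes> d) \<ominus> (a \<otimes> c) \<otimes> (q \<otimes> t) =
      (r \<otimes> d) \<otimes> (p \<otimes> b \<ominus> a \<otimes> q) \<oplus> (a \<otimes> q) \<otimes> (r \<otimes> d \<ominus> c \<otimes> t)"
    using cl by algebra
  also have "\<dots> \<in> sat"
    using 1(4) 2(4) cl unfolding fraction_rel_def fst_conv snd_conv
    by (intro additive_subgroup.a_closed[OF sat.additive_subgroup_axioms] sat.I_l_closed) simp_all
  finally have "fraction (p \<otimes> r) (q \<otimes> t) = fraction (a \<otimes> c) (b \<otimes> d)"
    using assms 1 2 by (subst fraction_eq_iff) auto
  then show ?thesis using 1(3) 2(3) by (simp add: Loc_def)
qed

lemma Loc_add:
  assumes "p \<in> carrier A" "q \<in> dens" "r \<in> carrier A" "t \<in> dens"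
  shows "fraction p q \<oplus>\<^bsub>Loc\<^esub> fraction r t = fraction (p \<otimes> t \<oplus> r \<otimes> q) (q \<otimes> t)"
proof -
  obtain a b where 1: "a \<in> carrier A" "b \<in> dens" "fraction p q = (a, b)" "fraction_rel (p, q) (a, b)"
    using fraction_rep[OF assms(1,2)] by blast
  obtain c d where 2: "c \<in> carrier A" "d \<in> dens" "fraction r t = (c, d)" "fraction_rel (r, t) (c, d)"
    using fraction_rep[OF assms(3,4)] by blast
  note cl = assms(1,3) 1(1) 2(1) assms(2,4)[THEN dens_closed] 1(2)[THEN dens_closed] 2(2)[THEN dens_closed]
  have "(p \<otimes> t \<oplus> r \<otimes> q) \<otimes> (b \<otimes> d) \<ominus> (a \<otimes> d \<oplus> c \<otimes> b) \<otimes> (q \<otimes> t) =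
      (t \<otimes> d) \<otimes> (p \<otimes> b \<ominus> a \<otimes> q) \<oplus> (q \<otimes> b) \<otimes> (r \<otimes> d \<ominus> c \<otimes> t)"
    using cl by algebra
  also have "\<dots> \<in> sat"
    using 1(4) 2(4) cl unfolding fraction_rel_def fst_conv snd_conv
    by (intro additive_subgroup.a_closed[OF sat.additive_subgroup_axioms] sat.I_l_closed) simp_all
  finally have "fraction (p \<otimes> t \<oplus> r \<otimes> q) (q \<otimes> t) = fraction (a \<otimes> d \<oplus> c \<otimes> b) (b \<otimes> d)"
    using assms 1 2 by (subst fraction_eq_iff) auto
  then show ?thesis using 1(3) 2(3) by (simp add: Loc_def)
qed

lemma Loc_zero: "\<zero>\<^bsub>Loc\<^esub> = fraction \<zero> \<one>"
  by (simp add: Loc_def)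

lemma Loc_one: "\<one>\<^bsub>Loc\<^esub> = fraction \<one> \<one>"
  by (simp add: Loc_def)

lemma Loc_cring: "cring Loc"
proof (rule cringI)
  show "abelian_group Loc"
  proof (rule abelian_groupI)
    fix x y assume "x \<in> carrier Loc" "y \<in> carrier Loc"
    then obtain p q r t where x: "p \<in> carrier A" "q \<in> dens" "x = fraction p q"
      and y: "r \<in> carrier A" "t \<in> dens" "y = fraction r t" by (metis Loc_cases)
    show "x \<oplus>\<^bsub>Loc\<^esub> y \<in> carrier Loc" using x y by (simp add: Loc_add)
    show "x \<oplus>\<^bsub>Loc\<^esub> y = y \<oplus>\<^bsub>Loc\<^esub> x" using x y by (simp add: Loc_add a_comm m_comm)
    fix z assume "z \<in> carrier Loc"
    then obtain v w where z: "v \<in> carrier A" "w \<in> dens" "z = fraction v w" by (rule Loc_cases)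
    have "(p \<otimes> t \<oplus> r \<otimes> q) \<otimes> w \<oplus> v \<otimes> (q \<otimes> t) = p \<otimes> (t \<otimes> w) \<oplus> (r \<otimes> w \<oplus> v \<otimes> t) \<otimes> q"
      using x(1) y(1) z(1) x(2)[THEN dens_closed] y(2)[THEN dens_closed] z(2)[THEN dens_closed] by algebra
    then show "x \<oplus>\<^bsub>Loc\<^esub> y \<oplus>\<^bsub>Loc\<^esub> z = x \<oplus>\<^bsub>Loc\<^esub> (y \<oplus>\<^bsub>Loc\<^esub> z)"
      using x y z by (simp add: Loc_add m_assoc)
  next
    show "\<zero>\<^bsub>Loc\<^esub> \<in> carrier Loc" by (simp add: Loc_zero)
    fix x assume "x \<in> carrier Loc"
    then obtain p q where x: "p \<in> carrier A" "q \<in> dens" "x = fraction p q" by (rule Loc_cases)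
    show "\<zero>\<^bsub>Loc\<^esub> \<oplus>\<^bsub>Loc\<^esub> x = x" using x by (simp add: Loc_add Loc_zero)
    have "fraction (\<ominus> p) q \<oplus>\<^bsub>Loc\<^esub> x = \<zero>\<^bsub>Loc\<^esub>"
      using x by (auto simp: Loc_add Loc_zero l_minus l_neg intro!: fraction_eqI)
    then show "\<exists>y\<in>carrier Loc. y \<oplus>\<^bsub>Loc\<^esub> x = \<zero>\<^bsub>Loc\<^esub>" using x by (meson Loc_closed a_inv_closed)
  qed
  show "comm_monoid Loc"
    by (rule comm_monoidI) (auto elim!: Loc_cases simp: Loc_mult Loc_one m_ac)
  fix x y z assume "x \<in> carrier Loc" "y \<in> carrier Loc" "z \<in> carrier Loc"
  then obtain p q r t v w where x: "p \<in> carrier A" "q \<in> dens" "x = fraction p q"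
    and y: "r \<in> carrier A" "t \<in> dens" "y = fraction r t"
    and z: "v \<in> carrier A" "w \<in> dens" "z = fraction v w" by (metis Loc_cases)
  note c = x(1) y(1) z(1) x(2)[THEN dens_closed] y(2)[THEN dens_closed] z(2)[THEN dens_closed]
  have "fraction ((p \<otimes> t \<oplus> r \<otimes> q) \<otimes> v) (q \<otimes> t \<otimes> w) =
      fraction (p \<otimes> v \<otimes> (t \<otimes> w) \<oplus> r \<otimes> v \<otimes> (q \<otimes> w)) (q \<otimes> w \<otimes> (t \<otimes> w))"
  proof (rule fraction_eqI)
    show "(p \<otimes> t \<oplus> r \<otimes> q) \<otimes> v \<otimes> (q \<otimes> w \<otimes> (t \<otimes> w)) =
        (p \<otimes> v \<otimes> (t \<otimes> w) \<oplus> r \<otimes> v \<otimes> (q \<otimes> w)) \<otimes> (q \<otimes> t \<otimes> w)"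
      using c by algebra
  qed (use x y z in simp_all)
  then show "(x \<oplus>\<^bsub>Loc\<^esub> y) \<otimes>\<^bsub>Loc\<^esub> z = x \<otimes>\<^bsub>Loc\<^esub> z \<oplus>\<^bsub>Loc\<^esub> y \<otimes>\<^bsub>Loc\<^esub> z"
    using x y z by (simp add: Loc_add Loc_mult)
qed

sublocale Loc: cring Loc
  by (rule Loc_cring)

definition loc :: "'a \<Rightarrow> 'a \<times> 'a" where
  "loc a = fraction a \<one>"

lemma loc_hom: "loc \<in> ring_hom A Loc"
  by (rule ring_hom_memI) (simp_all add: loc_def Loc_add Loc_mult Loc_one)

sublocale loc: ring_hom_cring A Loc loc
  by unfold_locales (rule loc_hom)

lemma loc_eq_zero_iff: "a \<in> carrier A \<Longrightarrow> loc a = \<zero>\<^bsub>Loc\<^esub> \<longleftrightarrow> a \<in> sat"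
  by (simp add: loc_def Loc_zero fraction_eq_iff minus_eq)

definition LM :: "('a \<times> 'a) set" where
  "LM = {fraction p q |p q. p \<in> P \<and> q \<in> dens}"

text \<open>The cross products of equal fractions differ by an element of \<open>sat\<close>, hence
  of \<open>P\<close>, and denominators lie outside the prime \<open>P\<close>. So membership of the
  numerator does not depend on the representation.\<close>

lemma fraction_mem_LM:
  assumes "p \<in> carrier A" "q \<in> dens"
  shows "fraction p q \<in> LM \<longleftrightarrow> p \<in> P"
proof
  assume "fraction p q \<in> LM"
  then obtain r t where r: "r \<in> P" "t \<in> dens" "fraction p q = fraction r t" by (auto simp: LM_def)
  then have "p \<otimes> t \<ominus> r \<otimes> q \<in> P" using fraction_eq_iff[OF assms] P.Icarr sat_sub_P by blast
  moreover have "r \<otimes> q \<in> P" using r(1) assms(2) P.I_r_closed by simp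
  ultimately have "p \<otimes> t \<in> P" using P.mem_of_minus_mem assms(1) r(2) by simp
  then show "p \<in> P" using P.I_prime assms(1) r(2) by (auto simp: dens_def)
qed (use assms in \<open>unfold LM_def, blast\<close>)

lemma LM_ideal: "ideal LM Loc"
proof (rule Loc.idealI_cring)
  show "LM \<subseteq> carrier Loc" using P.Icarr by (auto simp: LM_def)
  show "\<zero>\<^bsub>Loc\<^esub> \<in> LM" by (simp add: Loc_zero fraction_mem_LM)
  fix x assume "x \<in> LM"
  then obtain p q where x: "p \<in> P" "q \<in> dens" "x = fraction p q" by (auto simp: LM_def)
  have pc: "p \<in> carrier A" using x P.Icarr by blast
  show "x \<oplus>\<^bsub>Loc\<^esub> y \<in> LM" if "y \<in> LM" for y
  proof -
    obtain r t where y: "r \<in> P" "t \<in> dens" "y = fraction r t" using \<open>y \<in> LM\<close> by (auto simp: LM_def)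
    have "r \<in> carrier A" using y P.Icarr by blast
    moreover have "p \<otimes> t \<oplus> r \<otimes> q \<in> P"
      using x y P.I_r_closed additive_subgroup.a_closed[OF P.additive_subgroup_axioms] by simp
    ultimately show ?thesis using x y pc by (simp add: Loc_add fraction_mem_LM)
  qed
  show "y \<otimes>\<^bsub>Loc\<^esub> x \<in> LM" if "y \<in> carrier Loc" for y
  proof -
    obtain r t where "r \<in> carrier A" "t \<in> dens" "y = fraction r t" using \<open>y \<in> carrier Loc\<close> by (rule Loc_cases)
    then show ?thesis using x pc P.I_l_closed by (simp add: Loc_mult fraction_mem_LM)
  qed
qed

lemma one_notin_LM: "\<one>\<^bsub>Loc\<^esub> \<notin> LM"
  using one_dens by (simp add: Loc_one fraction_mem_LM dens_def)

lemma Loc_units: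
  assumes "x \<in> carrier Loc" "x \<notin> LM"
  shows "x \<in> Units Loc"
proof -
  obtain p q where x: "p \<in> carrier A" "q \<in> dens" "x = fraction p q" using assms(1) by (rule Loc_cases)
  then have p: "p \<in> dens" using assms(2) by (simp add: fraction_mem_LM dens_def)
  have "fraction q p \<otimes>\<^bsub>Loc\<^esub> x = \<one>\<^bsub>Loc\<^esub>"
    using x p by (auto simp: Loc_mult Loc_one m_comm intro!: fraction_eqI)
  moreover have "fraction q p \<in> carrier Loc" using x p by simp
  ultimately show ?thesis using assms(1) Loc.m_comm unfolding Units_def by fastforce
qed

text \<open>As \<open>J\<close> dies in the localization, the assumption on \<open>P\<close> says
  that the maximal ideal \<open>LM\<close> is generated by the image of that of \<open>R\<close>,
  and \<open>comp_series_genideal\<close> applies.\<close>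

lemma Loc_artinian_local:
  assumes R: "local_ring R" "comp_series R n I" and \<iota>: "\<iota> \<in> ring_hom R A"
    and P: "P \<subseteq> genideal A (\<iota> ` max_ideal R \<union> J)"
  shows "artinian_local_ring Loc" "ring_length Loc \<le> enat n"
proof -
  let ?h = "loc \<circ> \<iota>"
  let ?I = "genideal Loc (?h ` max_ideal R)"
  have \<iota>c: "\<iota> a \<in> carrier A" if "a \<in> max_ideal R" for a
    using that \<iota> ideal.Icarr[OF local_ringD(3)[OF R(1)]] by (auto simp: ring_hom_def)
  have sub: "?h ` max_ideal R \<subseteq> carrier Loc"
    using \<iota>c by (intro image_subsetI) simp
  have I: "ideal ?I Loc" by (rule Loc.genideal_ideal[OF sub])
  interpret I: ideal ?I Loc by (rule I)
  have "P \<subseteq> {a \<in> carrier A. loc a \<in> ?I}"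
  proof -
    have "genideal A (\<iota> ` max_ideal R \<union> J) \<subseteq> {a \<in> carrier A. loc a \<in> ?I}"
    proof (rule genideal_minimal)
      show "ideal {a \<in> carrier A. loc a \<in> ?I} A" by (rule ring_hom_ring.ideal_vimage[OF ring_hom_ringI2[OF ring_axioms Loc.ring_axioms loc_hom] I])
      have "loc a = \<zero>\<^bsub>Loc\<^esub>" if "a \<in> J" for a
        using that J_sub_sat loc_eq_zero_iff J.Icarr by blast
      then show "\<iota> ` max_ideal R \<union> J \<subseteq> {a \<in> carrier A. loc a \<in> ?I}"
        using Loc.genideal_self[OF sub] \<iota>c J.Icarr I.zero_closed by (auto simp: image_subset_iff)
    qed
    then show ?thesis using P by blast
  qed
  then have "LM \<subseteq> ?I"
  proof (intro subsetI)
    fix x assume PI: "P \<subseteq> {a \<in> carrier A. loc a \<in> ?I}" and "x \<in> LM"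
    then obtain p q where x: "p \<in> P" "q \<in> dens" "x = fraction p q" by (auto simp: LM_def)
    then have "loc p \<in> ?I" "p \<in> carrier A" using PI by auto
    moreover have "x = fraction \<one> q \<otimes>\<^bsub>Loc\<^esub> loc p" using x calculation(2) by (simp add: loc_def Loc_mult)
    ultimately show "x \<in> ?I" using I.I_l_closed x(2) by simp
  qed
  then have "comp_series Loc n (\<lambda>i. genideal Loc (?h ` I i))"
    using comp_series_genideal[OF R Loc_cring ring_hom_trans[OF \<iota> loc_hom] LM_ideal Loc_units] by simp
  then show "artinian_local_ring Loc" "ring_length Loc \<le> enat n"
    using artinian_localI[OF Loc_cring LM_ideal one_notin_LM Loc_units] by blast+
qed

text \<open>The last assumption is triviality of the kernel, written out in \<open>A\<close> so that
  applications compute there and not with fractions.\<close>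

lemma inj_on_loc_comp:
  assumes "ring R" "\<iota> \<in> ring_hom R A"
    and "\<And>u r. u \<in> carrier A \<Longrightarrow> u \<notin> P \<Longrightarrow> r \<in> carrier R \<Longrightarrow> u \<otimes>\<^bsub>A\<^esub> \<iota> r \<in> J \<Longrightarrow> r = \<zero>\<^bsub>R\<^esub>"
  shows "inj_on (loc \<circ> \<iota>) (carrier R)"
proof -
  interpret h: ring_hom_ring R Loc "loc \<circ> \<iota>"
    by (intro ring_hom_ringI2 assms(1) Loc.ring_axioms ring_hom_trans[OF assms(2) loc_hom])
  have "r = \<zero>\<^bsub>R\<^esub>" if r: "r \<in> carrier R" "loc (\<iota> r) = \<zero>\<^bsub>Loc\<^esub>" for r
  proof -
    have "\<iota> r \<in> carrier A" using r assms(2) by (auto simp: ring_hom_def)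
    then have "\<iota> r \<in> sat" using r loc_eq_zero_iff by blast
    then show ?thesis using assms(3) r(1) unfolding sat_def by blast
  qed
  then have "a_kernel R Loc (loc \<circ> \<iota>) \<subseteq> {\<zero>\<^bsub>R\<^esub>}"
    unfolding a_kernel_def' comp_def by blast
  moreover have "\<zero>\<^bsub>R\<^esub> \<in> a_kernel R Loc (loc \<circ> \<iota>)"
    unfolding a_kernel_def' mem_Collect_eq using h.hom_zero h.R.zero_closed by (intro conjI)
  ultimately have "a_kernel R Loc (loc \<circ> \<iota>) = {\<zero>\<^bsub>R\<^esub>}" by blast
  then show ?thesis by (rule h.trivial_ker_imp_inj)
qed

end

section \<open>Polynomials over a local ring\<close>

lemma (in ideal) finsum_mem: "(\<And>i. i \<in> B \<Longrightarrow> f i \<in> I) \<Longrightarrow> finsum R f B \<in> I"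
proof (induction B rule: infinite_finite_induct)
  case (insert b B)
  then have "finsum R f (insert b B) = f b \<oplus> finsum R f B"
    using Icarr by (intro finsum_insert) auto
  moreover have "f b \<in> I" "finsum R f B \<in> I" using insert by auto
  ultimately show ?case using additive_subgroup.a_closed[OF additive_subgroup_axioms] by simp
qed (simp_all add: additive_subgroup.zero_closed[OF additive_subgroup_axioms])

context UP_cring
begin

abbreviation cf :: "(nat \<Rightarrow> 'a) \<Rightarrow> nat \<Rightarrow> 'a" where
  "cf p n \<equiv> up_ring.coeff P p n"

abbreviation mon :: "'a \<Rightarrow> nat \<Rightarrow> nat \<Rightarrow> 'a" where
  "mon a n \<equiv> up_ring.monom P a n"

abbreviation const :: "'a \<Rightarrow> nat \<Rightarrow> 'a" where
  "const a \<equiv> mon a 0"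

lemma cf_eventually_zero:
  assumes "p \<in> carrier P"
  obtains k where "\<And>i. i \<ge> k \<Longrightarrow> cf p i = \<zero>"
  using deg_aboveD[OF _ assms] that[of "Suc (deg R p)"] by auto

text \<open>The number \<open>k\<close> is the degree of \<open>p\<close> modulo
  \<open>I\<close>.\<close>

lemma exists_top_cf:
  assumes I: "ideal I R" and p: "p \<in> carrier P" and j: "cf p j \<notin> I"
  obtains k where "cf p k \<notin> I" "\<And>i. i > k \<Longrightarrow> cf p i \<in> I"
proof -
  obtain d where d: "\<And>i. i \<ge> d \<Longrightarrow> cf p i = \<zero>" using cf_eventually_zero[OF p] by blast
  have z: "\<zero> \<in> I" using I by (simp add: additive_subgroup.zero_closed ideal.axioms)
  have bound: "i \<le> d" if "cf p i \<notin> I" for i using d[of i] z that by (metis nat_le_linear)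
  define k where "k = (GREATEST i. cf p i \<notin> I)"
  have "cf p k \<notin> I" unfolding k_def by (rule GreatestI_nat[of "\<lambda>i. cf p i \<notin> I", OF j bound])
  moreover have "cf p i \<in> I" if "i > k" for i
    using Greatest_le_nat[of "\<lambda>i. cf p i \<notin> I", OF _ bound] that unfolding k_def by fastforce
  ultimately show ?thesis using that by blast
qed

text \<open>Leading coefficients multiply modulo \<open>I\<close>: in the convolution sum, every
  index other than \<open>j\<close> puts one of the two factors beyond its degree modulo
  \<open>I\<close>.\<close>

lemma cf_mult_top:
  assumes I: "ideal I R" and p: "p \<in> carrier P" and q: "q \<in> carrier P"
    and pj: "\<And>i. i > j \<Longrightarrow> cf p i \<in> I" and qk: "\<And>i. i > k \<Longrightarrow> cf q i \<in> I"
  shows "cf (p \<otimes>\<^bsub>P\<^esub> q) (j + k) \<ominus> cf p j \<otimes> cf q k \<in> I"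
proof -
  interpret I: ideal I R by fact
  let ?f = "\<lambda>i. cf p i \<otimes> cf q (j + k - i)"
  have f: "?f \<in> {..j + k} \<rightarrow> carrier R" using p q by simp
  have "cf (p \<otimes>\<^bsub>P\<^esub> q) (j + k) = finsum R ?f (insert j ({..j + k} - {j}))"
    using p q by (simp add: insert_absorb)
  also have "\<dots> = ?f j \<oplus> finsum R ?f ({..j + k} - {j})"
    using p q by (intro R.finsum_insert) auto
  finally have eq: "cf (p \<otimes>\<^bsub>P\<^esub> q) (j + k) = cf p j \<otimes> cf q k \<oplus> finsum R ?f ({..j + k} - {j})" by simp
  have mem: "finsum R ?f ({..j + k} - {j}) \<in> I"
  proof (rule I.finsum_mem)
    fix i assume i: "i \<in> {..j + k} - {j}"
    then consider "i > j" | "j + k - i > k" by fastforce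
    then show "?f i \<in> I"
    proof cases
      case 1
      then show ?thesis using pj I.I_r_closed q by simp
    next
      case 2
      then show ?thesis using qk I.I_l_closed p by simp
    qed
  qed
  have "(b \<oplus> a) \<ominus> b = a" if "a \<in> carrier R" "b \<in> carrier R" for a b
    using that by algebra
  moreover have "cf p j \<otimes> cf q k \<in> carrier R" using p q by simp
  ultimately have "(cf p j \<otimes> cf q k \<oplus> finsum R ?f ({..j + k} - {j})) \<ominus> cf p j \<otimes> cf q k = finsum R ?f ({..j + k} - {j})"
    using I.Icarr[OF mem] by blast
  then show ?thesis using mem eq by simp
qed

text \<open>The extended ideal \<open>I R[X]\<close>, described by coefficients.\<close>

definition cf_ideal :: "'a set \<Rightarrow> (nat \<Rightarrow> 'a) set" where
  "cf_ideal I = {p \<in> carrier P. \<forall>i. cf p i \<in> I}"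

lemma cf_ideal_ideal:
  assumes "ideal I R"
  shows "ideal (cf_ideal I) P"
proof (rule P.idealI_cring)
  interpret I: ideal I R by fact
  show "cf_ideal I \<subseteq> carrier P" by (auto simp: cf_ideal_def)
  show "\<zero>\<^bsub>P\<^esub> \<in> cf_ideal I" by (simp add: cf_ideal_def)
  fix a assume a: "a \<in> cf_ideal I"
  show "a \<oplus>\<^bsub>P\<^esub> b \<in> cf_ideal I" if "b \<in> cf_ideal I" for b
    using a that by (simp add: cf_ideal_def)
  show "x \<otimes>\<^bsub>P\<^esub> a \<in> cf_ideal I" if "x \<in> carrier P" for x
    using a that by (auto simp: cf_ideal_def intro!: I.finsum_mem I.I_l_closed)
qed

lemma cf_ideal_le_genideal:
  assumes "I \<subseteq> carrier R"
  shows "cf_ideal I \<subseteq> genideal P (const ` I)"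
proof
  fix p assume p: "p \<in> cf_ideal I"
  have sub: "const ` I \<subseteq> carrier P" using assms by auto
  interpret G: ideal "genideal P (const ` I)" P by (rule P.genideal_ideal[OF sub])
  have pc: "p \<in> carrier P" using p by (simp add: cf_ideal_def)
  have "mon (cf p i) i \<in> genideal P (const ` I)" for i
  proof -
    have "cf p i \<in> I" using p by (simp add: cf_ideal_def)
    then have "const (cf p i) \<in> genideal P (const ` I)" using P.genideal_self[OF sub] by blast
    then have "mon \<one> i \<otimes>\<^bsub>P\<^esub> const (cf p i) \<in> genideal P (const ` I)" by (rule G.I_l_closed) simp
    then show ?thesis using monom_mult[of \<one> "cf p i" i 0] pc by simp
  qed
  then have "(\<Oplus>\<^bsub>P\<^esub>i \<in> {..deg R p}. mon (cf p i) i) \<in> genideal P (const ` I)"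
    by (intro G.finsum_mem)
  then show "p \<in> genideal P (const ` I)" using up_repr[OF pc] by simp
qed

text \<open>The recursion runs parallel to that of \<open>poly_term\<close>, so that a term and its
  polynomial are evaluated by one induction. It also cuts off a polynomial: the exponents stay below
  the second argument.\<close>

fun trunc :: "(nat \<Rightarrow> 'a) \<Rightarrow> nat \<Rightarrow> nat \<Rightarrow> 'a" where
  "trunc c 0 = \<zero>\<^bsub>P\<^esub>"
| "trunc c (Suc k) = trunc c k \<oplus>\<^bsub>P\<^esub> mon (c k) k"

lemma trunc_closed: "(\<And>i. c i \<in> carrier R) \<Longrightarrow> trunc c k \<in> carrier P"
  by (induction k) auto

lemma cf_trunc: "(\<And>i. c i \<in> carrier R) \<Longrightarrow> cf (trunc c k) i = (if i < k then c i else \<zero>)"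
  by (induction k) (auto simp: trunc_closed)

text \<open>If \<open>q\<close> had a degree modulo \<open>I\<close>, its leading coefficient times
  the unit \<open>cf f N\<close> would survive as a coefficient of the product in a position not
  below \<open>N\<close>.\<close>

lemma mult_unit_top_mem:
  assumes I: "ideal I R" and q: "q \<in> carrier P" and f: "f \<in> carrier P" "cf f N \<in> Units R"
    and top: "\<And>i. i > N \<Longrightarrow> cf f i \<in> I" and qf: "\<And>i. i \<ge> N \<Longrightarrow> cf (q \<otimes>\<^bsub>P\<^esub> f) i \<in> I"
  shows "cf q i \<in> I"
proof (rule ccontr)
  interpret I: ideal I R by fact
  assume "cf q i \<notin> I"
  then obtain k where k: "cf q k \<notin> I" "\<And>i. i > k \<Longrightarrow> cf q i \<in> I" using exists_top_cf[OF I q] by blast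
  let ?c = "cf q k \<otimes> cf f N"
  have c: "?c \<in> carrier R" using q f by simp
  have 1: "cf (q \<otimes>\<^bsub>P\<^esub> f) (k + N) \<ominus> ?c \<in> I" by (rule cf_mult_top[OF I q f(1) k(2) top])
  have 2: "cf (q \<otimes>\<^bsub>P\<^esub> f) (k + N) \<in> I" by (rule qf) simp
  have "?c = cf (q \<otimes>\<^bsub>P\<^esub> f) (k + N) \<ominus> (cf (q \<otimes>\<^bsub>P\<^esub> f) (k + N) \<ominus> ?c)"
  proof -
    have "a = b \<ominus> (b \<ominus> a)" if "a \<in> carrier R" "b \<in> carrier R" for a b using that by algebra
    then show ?thesis using c I.Icarr[OF 2] by blast
  qed
  then have "?c \<in> I" using I.minus_mem[OF 2 1] by metis
  then have "?c \<otimes> inv (cf f N) \<in> I" using I.I_r_closed f(2) by simp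
  moreover have "?c \<otimes> inv (cf f N) = cf q k" using f(2) q by (simp add: R.m_assoc R.Units_closed)
  ultimately show False using k(1) by simp
qed

text \<open>Polynomials are functions on \<open>nat\<close>, a type that may be too large for
  \<open>'a list\<close>; those in the carrier are determined by finitely many coefficients.\<close>

lemma inj_on_cf_list: "inj_on (\<lambda>p. map (up_ring.coeff P p) [0..<Suc (deg R p)]) (carrier P)"
proof (rule inj_onI)
  fix p q assume p: "p \<in> carrier P" and q: "q \<in> carrier P"
    and eq: "map (up_ring.coeff P p) [0..<Suc (deg R p)] = map (up_ring.coeff P q) [0..<Suc (deg R q)]"
  have d: "deg R p = deg R q" using arg_cong[OF eq, of length] by simp
  show "p = q"
  proof (rule up_eqI)
    fix n
    show "cf p n = cf q n"
    proof (cases "n \<le> deg R p")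
      case True
      then show ?thesis using eq d by (cases "n = deg R p") auto
    next
      case False
      then show ?thesis using deg_aboveD[OF _ p] deg_aboveD[OF _ q] d by simp
    qed
  qed (use p q in auto)
qed

lemma hom_trunc:
  assumes g: "g \<in> ring_hom P T" and T: "cring T" and c: "\<And>i. c i \<in> carrier R"
  shows "g (trunc c (Suc k)) = g (trunc c k) \<oplus>\<^bsub>T\<^esub> g (const (c k)) \<otimes>\<^bsub>T\<^esub> g (mon \<one> 1) [^]\<^bsub>T\<^esub> k"
proof -
  interpret g: ring_hom_cring P T g using g T P.cring_axioms by (simp add: ring_hom_cringI ring_hom_cring_def ring_hom_cring_axioms_def)
  have "mon (c k) k = const (c k) \<otimes>\<^bsub>P\<^esub> mon \<one> 1 [^]\<^bsub>P\<^esub> k"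
    using monom_mult[of "c k" \<one> 0 k] c by (simp add: monom_pow del: monom_mult)
  then show ?thesis using trunc_closed[OF c] c by simp
qed

end

section \<open>Polynomial terms, and realizing sentences in localized quotients of
  \<open>R[X]\<close>\<close>

fun power_term :: "nat \<Rightarrow> 'p ring_term" where
  "power_term 0 = One"
| "power_term (Suc k) = Mul (power_term k) (Var 0)"

fun poly_term :: "(nat \<Rightarrow> 'p) \<Rightarrow> nat \<Rightarrow> 'p ring_term" where
  "poly_term c 0 = Zero"
| "poly_term c (Suc k) = Add (poly_term c k) (Mul (Param (c k)) (power_term k))"

lemma tparams_power_term: "tparams (power_term k) = {}"
  by (induction k) auto

lemma tparams_poly_term: "tparams (poly_term c k) \<subseteq> range c"
  by (induction k) (auto simp: tparams_power_term)

lemma term_val_power_term: "term_val S h v (power_term k) = v 0 [^]\<^bsub>S\<^esub> k"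
  by (induction k) (simp_all add: nat_pow_def)

text \<open>Stated for any homomorphism out of \<open>R[X]\<close>: it is applied to the map into
  the extension, and then to the evaluation at the solution found in \<open>R\<close>.\<close>

lemma (in UP_cring) term_val_poly_term:
  assumes "g \<in> ring_hom P T" "cring T" "\<And>i. c i \<in> carrier R"
    and "\<And>a. a \<in> carrier R \<Longrightarrow> h a = g (const a)" and "v 0 = g (mon \<one> 1)"
  shows "term_val T h v (poly_term c k) = g (trunc c k)"
proof (induction k)
  case 0
  interpret T: cring T by fact
  have "ring_hom_ring P T g" by (intro ring_hom_ringI2 P.ring_axioms T.ring_axioms assms(1))
  then interpret g: ring_hom_ring P T g .
  show ?case by simp
next
  case (Suc k)
  then show ?case using hom_trunc[OF assms(1,2), of c k] assms(3-5) by (simp add: term_val_power_term)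
qed

text \<open>Common to the residue field and the socle: the extension is the localization at
  \<open>Q\<close> of \<open>R[X] / J\<close>. The assumption \<open>holds\<close> lets the sentence
  be verified from the vanishing of \<open>J\<close> alone.\<close>

lemma UP_localized_realize:
  fixes R :: "'a ring"
  assumes ec: "existentially_closed (Art_le l) (Art_le l) R \<or> existentially_closed (Art_eq l) (Art_eq l) R"
    and R: "local_ring R" "comp_series R n I" "n \<le> l"
    and Q: "primeideal Q (UP R)" and J: "ideal J (UP R)" "J \<subseteq> Q"
    and gen: "Q \<subseteq> genideal (UP R) ((\<lambda>a. up_ring.monom (UP R) a 0) ` max_ideal R \<union> J)"
    and inj: "\<And>u r. u \<in> carrier (UP R) \<Longrightarrow> u \<notin> Q \<Longrightarrow> r \<in> carrier R \<Longrightarrow>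
      u \<otimes>\<^bsub>UP R\<^esub> up_ring.monom (UP R) r 0 \<in> J \<Longrightarrow> r = \<zero>\<^bsub>R\<^esub>"
    and \<phi>: "qparams \<phi> \<subseteq> carrier R"
    and holds: "\<And>(S :: ((nat \<Rightarrow> 'a) \<times> (nat \<Rightarrow> 'a)) ring) g. cring S \<Longrightarrow> g \<in> ring_hom (UP R) S \<Longrightarrow>
      (\<And>a. a \<in> J \<Longrightarrow> g a = \<zero>\<^bsub>S\<^esub>) \<Longrightarrow> ex_holds S (\<lambda>a. g (up_ring.monom (UP R) a 0)) \<phi>"
  shows "ex_holds R (\<lambda>r. r) \<phi>"
proof -
  interpret R: cring R using R(1) by (rule local_ringD(1))
  interpret UP_cring R "UP R" by unfold_locales simp
  interpret L: localized_quotient "UP R" Q J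
    using P.cring_axioms Q J by (simp add: localized_quotient_def localized_quotient_axioms_def)
  have const: "const \<in> ring_hom R (UP R)" by (rule const_ring_hom)
  have art: "artinian_local_ring L.Loc" "ring_length L.Loc \<le> enat l"
    using L.Loc_artinian_local[OF R(1,2) const gen] order.trans[of "ring_length L.Loc" "enat n" "enat l"] R(3)
    by simp_all
  \<comment> \<open>A fraction is a chosen pair of polynomials, coded by two coefficient lists,
    which \<open>e\<close> merges into one list.\<close>
  let ?code = "\<lambda>p. map (up_ring.coeff (UP R) p) [0..<Suc (deg R p)]"
  obtain e :: "'a list \<times> 'a list \<Rightarrow> 'a list" where e: "inj e" using exists_inj_list_pair by blast
  have "inj_on (map_prod ?code ?code) (carrier (UP R) \<times> carrier (UP R))"
    using inj_on_cf_list by (intro map_prod_inj_on)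
  moreover have "carrier L.Loc \<subseteq> carrier (UP R) \<times> carrier (UP R)"
  proof
    fix x assume "x \<in> carrier L.Loc"
    then obtain p q where pq: "p \<in> carrier (UP R)" "q \<in> L.dens" "x = L.fraction p q" by (rule L.Loc_cases)
    obtain r t where "r \<in> carrier (UP R)" "t \<in> L.dens" "x = (r, t)"
      using L.fraction_rep[OF pq(1,2)] pq(3) by metis
    then show "x \<in> carrier (UP R) \<times> carrier (UP R)" by simp
  qed
  ultimately have "inj_on (map_prod ?code ?code) (carrier L.Loc)" by (rule inj_on_subset)
  then have code: "inj_on (e \<circ> map_prod ?code ?code) (carrier L.Loc)"
    using e by (meson comp_inj_on inj_on_subset subset_UNIV)
  have "L.loc a = \<zero>\<^bsub>L.Loc\<^esub>" if "a \<in> J" for a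
    using that L.J_sub_sat L.loc_eq_zero_iff L.J.Icarr by blast
  then have ex: "ex_holds L.Loc (L.loc \<circ> const) \<phi>"
    using holds[OF L.Loc_cring L.loc_hom] by (simp add: comp_def)
  show ?thesis
    by (rule existentially_closed_realize[OF ec art ring_hom_trans[OF const L.loc_hom]
          L.inj_on_loc_comp[OF R.ring_axioms const inj] code \<phi> ex])
qed

section \<open>Prime and maximal ideals of \<open>R[X]\<close> above the maximal ideal of
  \<open>R\<close>\<close>

context UP_cring
begin

text \<open>The leading coefficients modulo the maximal ideal multiply to an element outside it,
  which is, modulo that ideal, a coefficient of the product.\<close>

lemma cf_ideal_max_prime:
  assumes R: "local_ring R"
  shows "primeideal (cf_ideal (max_ideal R)) P"
proof (rule primeidealI)
  interpret m: maximalideal "max_ideal R" R using R by (rule local_ringD(2))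
  interpret mp: primeideal "max_ideal R" R using R.maximalideal_prime[OF m.is_maximalideal] .
  show "ideal (cf_ideal (max_ideal R)) P" by (rule cf_ideal_ideal[OF m.is_ideal])
  show "cring P" by (rule P.is_cring)
  have "\<one>\<^bsub>P\<^esub> \<notin> cf_ideal (max_ideal R)"
    using local_ringD(4)[OF R] by (auto simp: cf_ideal_def intro: exI[of _ 0])
  then show "carrier P \<noteq> cf_ideal (max_ideal R)" by auto
  fix p q assume p: "p \<in> carrier P" and q: "q \<in> carrier P" and pq: "p \<otimes>\<^bsub>P\<^esub> q \<in> cf_ideal (max_ideal R)"
  show "p \<in> cf_ideal (max_ideal R) \<or> q \<in> cf_ideal (max_ideal R)"
  proof (rule ccontr)
    assume "\<not> ?thesis"
    then obtain i i' where "cf p i \<notin> max_ideal R" "cf q i' \<notin> max_ideal R"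
      using p q by (auto simp: cf_ideal_def)
    then obtain j k where j: "cf p j \<notin> max_ideal R" "\<And>i. i > j \<Longrightarrow> cf p i \<in> max_ideal R"
      and k: "cf q k \<notin> max_ideal R" "\<And>i. i > k \<Longrightarrow> cf q i \<in> max_ideal R"
      using exists_top_cf[OF m.is_ideal p] exists_top_cf[OF m.is_ideal q] by metis
    let ?c = "cf p j \<otimes> cf q k"
    have c: "?c \<in> carrier R" using p q by simp
    have 1: "cf (p \<otimes>\<^bsub>P\<^esub> q) (j + k) \<ominus> ?c \<in> max_ideal R" by (rule cf_mult_top[OF m.is_ideal p q j(2) k(2)])
    have 2: "cf (p \<otimes>\<^bsub>P\<^esub> q) (j + k) \<in> max_ideal R" using pq unfolding cf_ideal_def by blast
    have "a = b \<ominus> (b \<ominus> a)" if "a \<in> carrier R" "b \<in> carrier R" for a b using that by algebra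
    then have "?c = cf (p \<otimes>\<^bsub>P\<^esub> q) (j + k) \<ominus> (cf (p \<otimes>\<^bsub>P\<^esub> q) (j + k) \<ominus> ?c)" using c m.Icarr[OF 2] by blast
    then have "?c \<in> max_ideal R" using m.minus_mem[OF 2 1] by metis
    then show False using mp.I_prime[of "cf p j" "cf q k"] j(1) k(1) p q by simp
  qed
qed

text \<open>Modulo \<open>m\<close> this is division with remainder in a polynomial ring over a
  field. It is carried out in \<open>R[X]\<close> itself, with degrees read modulo
  \<open>m\<close>.\<close>

lemma exists_maximal_monic:
  assumes R: "local_ring R" and f0: "f0 \<in> carrier P" "N0 \<ge> 1" "cf f0 N0 \<notin> max_ideal R"
    "\<And>i. i > N0 \<Longrightarrow> cf f0 i \<in> max_ideal R"
  obtains Q f N where "maximalideal Q P" "f0 \<in> Q" "f \<in> Q" "N \<ge> 1" "cf f N \<in> Units R"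
    "\<And>i. i > N \<Longrightarrow> cf f i = \<zero>" "Q \<subseteq> genideal P (const ` max_ideal R \<union> cgenideal P f)"
proof -
  let ?m = "max_ideal R" and ?M = "cf_ideal (max_ideal R)"
  interpret m: ideal ?m R using R by (rule local_ringD(3))
  interpret M: ideal ?M P by (rule cf_ideal_ideal[OF m.is_ideal])
  have unit: "a \<in> Units R" if "a \<in> carrier R" "a \<notin> ?m" for a using local_ringD(5)[OF R that] .
  let ?I0 = "{i \<oplus>\<^bsub>P\<^esub> r \<otimes>\<^bsub>P\<^esub> f0 |i r. i \<in> ?M \<and> r \<in> carrier P}"
  have I0: "ideal ?I0 P" by (rule P.add_principal_ideal[OF M.is_ideal f0(1)])
  \<comment> \<open>In an equation \<open>1 = a + q f0\<close> the coefficients of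
    \<open>q f0\<close> from \<open>N0\<close> on lie in \<open>m\<close>, because \<open>N0\<close>
    is positive. As \<open>f0\<close> has a unit in position \<open>N0\<close>, this puts
    \<open>q\<close>, and then \<open>1\<close>, into \<open>m R[X]\<close>.\<close>
  have "\<one>\<^bsub>P\<^esub> \<notin> ?I0"
  proof
    assume "\<one>\<^bsub>P\<^esub> \<in> ?I0"
    then obtain a q where aq: "\<one>\<^bsub>P\<^esub> = a \<oplus>\<^bsub>P\<^esub> q \<otimes>\<^bsub>P\<^esub> f0" "a \<in> ?M" "q \<in> carrier P" by blast
    have ac: "a \<in> carrier P" using aq(2) M.Icarr by blast
    have "cf q i \<in> ?m" for i
    proof (rule mult_unit_top_mem[OF m.is_ideal aq(3) f0(1) _ f0(4)])
      show "cf f0 N0 \<in> Units R" using unit f0(1,3) by simp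
      fix i assume i: "i \<ge> N0"
      have "cf \<one>\<^bsub>P\<^esub> i = cf a i \<oplus> cf (q \<otimes>\<^bsub>P\<^esub> f0) i" using aq ac f0(1) by (simp only: coeff_add UP_mult_closed)
      then have "cf a i \<oplus> cf (q \<otimes>\<^bsub>P\<^esub> f0) i = \<zero>" using i f0(2) by simp
      moreover have "y = (x \<oplus> y) \<ominus> x" if "x \<in> carrier R" "y \<in> carrier R" for x y using that by algebra
      ultimately have "cf (q \<otimes>\<^bsub>P\<^esub> f0) i = \<zero> \<ominus> cf a i" using ac aq(3) f0(1) by (metis coeff_closed UP_mult_closed)
      then show "cf (q \<otimes>\<^bsub>P\<^esub> f0) i \<in> ?m"
        using m.minus_mem[of \<zero> "cf a i"] aq(2) m.zero_closed unfolding cf_ideal_def by auto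
    qed
    then have qM: "q \<in> ?M" using aq(3) unfolding cf_ideal_def by blast
    have "q \<otimes>\<^bsub>P\<^esub> f0 \<in> ?M" by (rule M.I_r_closed[OF qM f0(1)])
    then have "\<one>\<^bsub>P\<^esub> \<in> ?M"
      unfolding aq(1) by (rule additive_subgroup.a_closed[OF M.additive_subgroup_axioms aq(2)])
    then have "cf \<one>\<^bsub>P\<^esub> 0 \<in> ?m" unfolding cf_ideal_def by blast
    then show False using local_ringD(4)[OF R] by simp
  qed
  then obtain Q where Q: "maximalideal Q P" "?I0 \<subseteq> Q" using P.exists_maximalideal[OF I0] by blast
  interpret Q: maximalideal Q P by (rule Q(1))
  have one_Q: "\<one>\<^bsub>P\<^esub> \<notin> Q" using Q.one_imp_carrier Q.I_notcarr by blast
  have M_Q: "?M \<subseteq> Q"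
  proof
    fix a assume a: "a \<in> ?M"
    then have "a = a \<oplus>\<^bsub>P\<^esub> \<zero>\<^bsub>P\<^esub> \<otimes>\<^bsub>P\<^esub> f0" using M.Icarr f0(1) by simp
    then show "a \<in> Q" using a Q(2) by blast
  qed
  have f0Q: "f0 \<in> Q"
  proof -
    have "f0 = \<zero>\<^bsub>P\<^esub> \<oplus>\<^bsub>P\<^esub> \<one>\<^bsub>P\<^esub> \<otimes>\<^bsub>P\<^esub> f0" using f0(1) by simp
    then show ?thesis using Q(2) M.zero_closed by blast
  qed
  let ?D = "\<lambda>N. \<exists>f\<in>Q. cf f N \<notin> ?m \<and> (\<forall>i>N. cf f i \<in> ?m)"
  define N where "N = (LEAST N. ?D N)"
  have "?D N0" using f0 f0Q by blast
  then have DN: "?D N" unfolding N_def by (rule LeastI)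
  have leN: "N \<le> k" if "?D k" for k unfolding N_def using that by (rule Least_le)
  obtain f1 where f1: "f1 \<in> Q" "cf f1 N \<notin> ?m" "\<And>i. i > N \<Longrightarrow> cf f1 i \<in> ?m" using DN by blast
  have f1c: "f1 \<in> carrier P" using f1(1) Q.Icarr by blast
  have cfc: "cf f1 i \<in> carrier R" for i using f1c by simp
  \<comment> \<open>The terms of \<open>f1\<close> above \<open>N\<close> lie in
    \<open>m R[X]\<close>, hence in \<open>Q\<close>. Cutting them off makes the unit in position
    \<open>N\<close> the leading coefficient of \<open>f\<close> outright, and not only modulo
    \<open>m\<close>.\<close>
  define f where "f = trunc (up_ring.coeff P f1) (Suc N)"
  have fc: "f \<in> carrier P" unfolding f_def by (rule trunc_closed[OF cfc])
  have cff: "cf f i = (if i \<le> N then cf f1 i else \<zero>)" for i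
    unfolding f_def using cf_trunc[of "up_ring.coeff P f1" "Suc N" i, OF cfc]
    by (simp add: less_Suc_eq_le del: trunc.simps)
  have "f1 \<ominus>\<^bsub>P\<^esub> f \<in> ?M"
  proof -
    have "cf (f1 \<ominus>\<^bsub>P\<^esub> f) i \<in> ?m" for i
      using f1c fc f1(3)[of i] m.zero_closed by (cases "i \<le> N") (simp_all add: cff R.minus_eq R.r_neg)
    then show ?thesis using P.minus_closed[OF f1c fc] unfolding cf_ideal_def by blast
  qed
  then have "f1 \<ominus>\<^bsub>P\<^esub> f \<in> Q" using M_Q by blast
  moreover have "f = f1 \<ominus>\<^bsub>P\<^esub> (f1 \<ominus>\<^bsub>P\<^esub> f)" using f1c fc by algebra
  ultimately have fQ: "f \<in> Q" using Q.minus_mem[OF f1(1)] by metis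
  have fN: "cf f N \<in> Units R" using f1(2) f1c unit by (simp add: cff)
  have "N \<noteq> 0"
  proof
    \<comment> \<open>Otherwise \<open>f\<close> would be a constant unit inside the proper ideal
      \<open>Q\<close>.\<close>
    assume N0: "N = 0"
    have "f = const (cf f 0)" by (rule up_eqI) (use fc N0 in \<open>auto simp: cff cfc\<close>)
    then have "const (inv (cf f 0)) \<otimes>\<^bsub>P\<^esub> f = const (inv (cf f 0) \<otimes> cf f 0)"
      using monom_mult[of "inv (cf f 0)" "cf f 0" 0 0] fN N0 fc by simp
    then have "const (inv (cf f 0)) \<otimes>\<^bsub>P\<^esub> f = \<one>\<^bsub>P\<^esub>" using fN N0 by simp
    moreover have "const (inv (cf f 0)) \<otimes>\<^bsub>P\<^esub> f \<in> Q" using Q.I_l_closed[OF fQ] fN N0 by simp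
    ultimately show False using one_Q by simp
  qed
  let ?G = "genideal P (const ` ?m \<union> cgenideal P f)"
  have cgen: "ideal (cgenideal P f) P" by (rule P.cgenideal_ideal[OF fc])
  have sub: "const ` ?m \<union> cgenideal P f \<subseteq> carrier P"
    using m.Icarr ideal.Icarr[OF cgen] by auto
  interpret G: ideal ?G P by (rule P.genideal_ideal[OF sub])
  have M_G: "?M \<subseteq> ?G"
  proof -
    have "genideal P (const ` ?m) \<subseteq> ?G"
      using P.genideal_self[OF sub] by (intro P.genideal_minimal G.is_ideal) auto
    then show ?thesis using cf_ideal_le_genideal[of ?m] m.Icarr by blast
  qed
  have f_G: "f \<in> ?G" using P.genideal_self[OF sub] P.cgenideal_self[OF fc] by blast
  \<comment> \<open>Induction on a strict bound for the degree modulo \<open>m\<close>. If the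
    degree is \<open>k\<close>, then \<open>N \<le> k\<close> by minimality, and subtracting a
    suitable multiple \<open>c X^d f\<close> lowers it without leaving \<open>Q\<close>.\<close>
  have "p \<in> Q \<Longrightarrow> (\<And>i. i \<ge> k \<Longrightarrow> cf p i \<in> ?m) \<Longrightarrow> p \<in> ?G" for p k
  proof (induction k arbitrary: p)
    case 0
    have "cf p i \<in> ?m" for i using 0(2)[of i] by simp
    then have "p \<in> ?M" using Q.Icarr[OF 0(1)] unfolding cf_ideal_def by blast
    then show ?case using M_G by blast
  next
    case (Suc k)
    have pc: "p \<in> carrier P" using Suc(2) Q.Icarr by blast
    show ?case
    proof (cases "cf p k \<in> ?m")
      case True
      have "cf p i \<in> ?m" if "i \<ge> k" for i using Suc(3)[of i] True that by (cases "i = k") auto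
      then show ?thesis by (rule Suc(1)[OF Suc(2)])
    next
      case False
      then have "N \<le> k" using Suc(2,3) by (intro leN) (auto simp: Suc_le_eq)
      then obtain d where d: "k = N + d" using le_Suc_ex by blast
      define c where "c = cf p k \<otimes> inv (cf f N)"
      have c: "c \<in> carrier R" using pc fN by (simp add: c_def)
      define p' where "p' = p \<ominus>\<^bsub>P\<^esub> mon c d \<otimes>\<^bsub>P\<^esub> f"
      have mf: "mon c d \<otimes>\<^bsub>P\<^esub> f \<in> Q" "mon c d \<otimes>\<^bsub>P\<^esub> f \<in> ?G" "mon c d \<otimes>\<^bsub>P\<^esub> f \<in> carrier P"
        using Q.I_l_closed[OF fQ] G.I_l_closed[OF f_G] fc c by simp_all
      have p'Q: "p' \<in> Q" unfolding p'_def by (rule Q.minus_mem[OF Suc(2) mf(1)])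
      have "cf p' i \<in> ?m" if i: "i \<ge> k" for i
      proof -
        obtain j where j: "i = (N + j) + d" using i d le_Suc_ex[of k i] by (auto simp: algebra_simps)
        have "cf p' i = cf p i \<ominus> c \<otimes> cf f (N + j)"
          unfolding p'_def using coeff_monom_mult[OF c fc, of d "N + j"] pc mf(3) j
          by (simp del: coeff_mult)
        show ?thesis
        proof (cases "j = 0")
          case True
          then have "c \<otimes> cf f (N + j) = cf p i" using j d fN pc
            by (simp add: c_def R.m_assoc R.Units_closed)
          then have "cf p' i = \<zero>" using \<open>cf p' i = _\<close> pc by (simp add: R.minus_eq R.r_neg)
          then show ?thesis using m.zero_closed by simp
        next
          case False
          then have "cf p' i = cf p i" using \<open>cf p' i = _\<close> pc c by (simp add: cff R.minus_eq)
          moreover have "i \<ge> Suc k" using False j d by simp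
          ultimately show ?thesis using Suc(3) by simp
        qed
      qed
      then have "p' \<in> ?G" using Suc(1)[OF p'Q] by blast
      then show ?thesis using G.mem_of_minus_mem[OF _ mf(2) pc] unfolding p'_def by blast
    qed
  qed
  moreover have "\<exists>k. \<forall>i\<ge>k. cf p i \<in> ?m" if "p \<in> Q" for p
    using cf_eventually_zero[OF Q.Icarr[OF that]] m.zero_closed by metis
  ultimately have "Q \<subseteq> ?G" by blast
  moreover have "cf f i = \<zero>" if "i > N" for i using that by (simp add: cff)
  ultimately show ?thesis using that[OF Q(1) f0Q fQ _ fN] \<open>N \<noteq> 0\<close> by simp
qed

end

lemma socle_mult:
  fixes R (structure)
  assumes "r \<in> socle R" "a \<in> max_ideal R"
  shows "r \<otimes> a = \<zero>"
  using assms by (simp add: socle_def annihilator_def)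

lemma cf_const_mult:
  assumes "UP_cring R" "u \<in> carrier (UP R)" "r \<in> carrier R"
  shows "up_ring.coeff (UP R) (u \<otimes>\<^bsub>UP R\<^esub> up_ring.monom (UP R) r 0) i = up_ring.coeff (UP R) u i \<otimes>\<^bsub>R\<^esub> r"
proof -
  interpret UP_cring R "UP R" using assms(1) by (simp add: UP_cring_def)
  show ?thesis
    using coeff_monom_mult[OF assms(3,2), of 0 i] assms(2,3) P.m_comm[of u "const r"] R.m_comm[of r "cf u i"]
    by (simp del: coeff_mult)
qed

section \<open>The residue field of an existentially closed ring\<close>

lemma existentially_closed_residue_root:
  fixes R :: "'a ring"
  assumes ec: "existentially_closed (Art_le l) (Art_le l) R \<or> existentially_closed (Art_eq l) (Art_eq l) R"
    and R: "local_ring R" "comp_series R n I" "n \<le> l"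
    and f0: "f0 \<in> carrier (UP R)" "N0 \<ge> 1" "up_ring.coeff (UP R) f0 N0 \<notin> max_ideal R"
      "\<And>i. i > N0 \<Longrightarrow> up_ring.coeff (UP R) f0 i \<in> max_ideal R"
  obtains x where "x \<in> carrier R" "UnivPoly.eval R R id x f0 \<in> max_ideal R"
proof -
  interpret R: cring R using R(1) by (rule local_ringD(1))
  interpret UP_cring R "UP R" by unfold_locales simp
  interpret m: ideal "max_ideal R" R using R(1) by (rule local_ringD(3))
  let ?P = "UP R"
  obtain Q f N where Q: "maximalideal Q ?P" "f0 \<in> Q" "f \<in> Q" and N: "N \<ge> 1" "cf f N \<in> Units R"
    and top: "\<And>i. i > N \<Longrightarrow> cf f i = \<zero>\<^bsub>R\<^esub>"
    and gen: "Q \<subseteq> genideal ?P (const ` max_ideal R \<union> cgenideal ?P f)"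
    using exists_maximal_monic[OF R(1) f0] by blast
  interpret Q: maximalideal Q ?P by (rule Q(1))
  have fc: "f \<in> carrier ?P" using Q(3) Q.Icarr by blast
  let ?J = "cgenideal ?P f"
  interpret J: ideal ?J ?P by (rule P.cgenideal_ideal[OF fc])
  have f_J: "f \<in> ?J" by (rule P.cgenideal_self[OF fc])
  have JQ: "?J \<subseteq> Q" by (rule P.cgenideal_minimal[OF Q.is_ideal Q(3)])
  \<comment> \<open>With \<open>b\<close> a nonzero multiple of \<open>r\<close> in the socle, the
    elements that send \<open>b\<close> into \<open>?J\<close> form an ideal. It contains the
    constants from \<open>m\<close>, which annihilate \<open>b\<close>, and \<open>?J\<close>, hence
    all of \<open>Q\<close>; it also contains \<open>u\<close>. As \<open>Q\<close> is maximal,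
    \<open>b\<close> itself lies in \<open>?J\<close>.\<close>
  have inj: "r = \<zero>\<^bsub>R\<^esub>" if u: "u \<in> carrier ?P" "u \<notin> Q" and r: "r \<in> carrier R" and ur: "u \<otimes>\<^bsub>?P\<^esub> const r \<in> ?J" for u r
  proof (rule ccontr)
    assume "r \<noteq> \<zero>\<^bsub>R\<^esub>"
    then obtain c where c: "c \<in> carrier R" "c \<otimes>\<^bsub>R\<^esub> r \<in> socle R" "c \<otimes>\<^bsub>R\<^esub> r \<noteq> \<zero>\<^bsub>R\<^esub>"
      using exists_multiple_in_socle[OF R(1,2) r] by blast
    define b where "b = c \<otimes>\<^bsub>R\<^esub> r"
    have b: "b \<in> carrier R" "b \<in> socle R" "b \<noteq> \<zero>\<^bsub>R\<^esub>" using c r by (auto simp: b_def)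
    have "const b = const c \<otimes>\<^bsub>?P\<^esub> const r" using monom_mult[OF c(1) r, of 0 0] by (simp add: b_def)
    then have "u \<otimes>\<^bsub>?P\<^esub> const b = const c \<otimes>\<^bsub>?P\<^esub> (u \<otimes>\<^bsub>?P\<^esub> const r)"
      using u(1) r c(1) by (simp add: P.m_lcomm)
    then have ub: "u \<otimes>\<^bsub>?P\<^esub> const b \<in> ?J" using J.I_l_closed[OF ur] c(1) by simp
    let ?C = "{z \<in> carrier ?P. z \<otimes>\<^bsub>?P\<^esub> const b \<in> ?J}"
    have C: "ideal ?C ?P" using b by (intro P.colon_ideal J.is_ideal) simp
    have "const ` max_ideal R \<union> ?J \<subseteq> ?C"
    proof
      fix z assume "z \<in> const ` max_ideal R \<union> ?J"
      then show "z \<in> ?C"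
      proof
        assume "z \<in> const ` max_ideal R"
        then obtain a where a: "a \<in> max_ideal R" "z = const a" by blast
        have ac: "a \<in> carrier R" using a(1) m.Icarr by blast
        have "const b \<otimes>\<^bsub>?P\<^esub> z = \<zero>\<^bsub>?P\<^esub>"
          using monom_mult[OF b(1) ac, of 0 0] socle_mult[OF b(2) a(1)] a(2) by simp
        then show ?thesis using a(2) ac b(1) P.m_comm[of z "const b"] J.zero_closed by simp
      next
        assume "z \<in> ?J"
        then show ?thesis using J.I_r_closed J.Icarr b(1) by simp
      qed
    qed
    then have QC: "Q \<subseteq> ?C" using gen P.genideal_minimal[OF C] by blast
    let ?L = "{i \<oplus>\<^bsub>?P\<^esub> w \<otimes>\<^bsub>?P\<^esub> u |i w. i \<in> Q \<and> w \<in> carrier ?P}"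
    have L: "ideal ?L ?P" by (rule P.add_principal_ideal[OF Q.is_ideal u(1)])
    have QL: "Q \<subseteq> ?L"
    proof
      fix z assume z: "z \<in> Q"
      then have "z = z \<oplus>\<^bsub>?P\<^esub> \<zero>\<^bsub>?P\<^esub> \<otimes>\<^bsub>?P\<^esub> u" using Q.Icarr u(1) by simp
      then show "z \<in> ?L" using z by blast
    qed
    have "u = \<zero>\<^bsub>?P\<^esub> \<oplus>\<^bsub>?P\<^esub> \<one>\<^bsub>?P\<^esub> \<otimes>\<^bsub>?P\<^esub> u" using u(1) by simp
    then have "u \<in> ?L" using Q.zero_closed by blast
    then have "?L = carrier ?P" using Q.I_maximal[OF L QL] u(2) ideal.Icarr[OF L] by blast
    then obtain p w where pw: "\<one>\<^bsub>?P\<^esub> = p \<oplus>\<^bsub>?P\<^esub> w \<otimes>\<^bsub>?P\<^esub> u" "p \<in> Q" "w \<in> carrier ?P" by blast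
    have pb: "p \<otimes>\<^bsub>?P\<^esub> const b \<in> ?J" using QC pw(2) by blast
    have wub: "w \<otimes>\<^bsub>?P\<^esub> (u \<otimes>\<^bsub>?P\<^esub> const b) \<in> ?J" by (rule J.I_l_closed[OF ub pw(3)])
    have "const b = (p \<oplus>\<^bsub>?P\<^esub> w \<otimes>\<^bsub>?P\<^esub> u) \<otimes>\<^bsub>?P\<^esub> const b" using b(1) by (simp add: pw(1)[symmetric])
    also have "\<dots> = p \<otimes>\<^bsub>?P\<^esub> const b \<oplus>\<^bsub>?P\<^esub> w \<otimes>\<^bsub>?P\<^esub> (u \<otimes>\<^bsub>?P\<^esub> const b)"
      using Q.Icarr[OF pw(2)] pw(3) u(1) b(1) by (simp add: P.l_distr P.m_assoc)
    also have "\<dots> \<in> ?J" using pb wub additive_subgroup.a_closed[OF J.additive_subgroup_axioms] by blast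
    finally have "const b \<in> ?J" .
    then obtain q where q: "q \<in> carrier ?P" "const b = q \<otimes>\<^bsub>?P\<^esub> f" unfolding cgenideal_def by blast
    \<comment> \<open>The constant \<open>b = q f\<close> has no coefficient from
      \<open>N \<ge> 1\<close> on, and \<open>f\<close> has a unit leading coefficient in position
      \<open>N\<close>; so \<open>q = 0\<close>.\<close>
    have "cf q i \<in> {\<zero>\<^bsub>R\<^esub>}" for i
    proof (rule mult_unit_top_mem[OF R.zeroideal q(1) fc N(2)])
      show "cf f i \<in> {\<zero>\<^bsub>R\<^esub>}" if "i > N" for i using top[OF that] by simp
      show "cf (q \<otimes>\<^bsub>?P\<^esub> f) i \<in> {\<zero>\<^bsub>R\<^esub>}" if "i \<ge> N" for i
        using that N(1) b(1) unfolding q(2)[symmetric] by simp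
    qed
    then have "q = \<zero>\<^bsub>?P\<^esub>" by (intro up_eqI) (use q(1) in auto)
    then have "const b = \<zero>\<^bsub>?P\<^esub>" using q(2) fc by simp
    then have "cf (const b) 0 = cf \<zero>\<^bsub>?P\<^esub> 0" by simp
    then show False using b by simp
  qed
  have cfc: "cf f i \<in> carrier R" for i using fc by simp
  \<comment> \<open>The argument is \<open>Suc N\<close> since \<open>trunc\<close> stops below it
    and the term of exponent \<open>N\<close> has to be included.\<close>
  have trunc_f: "trunc (up_ring.coeff ?P f) (Suc N) = f"
    by (rule up_eqI) (use fc top cf_trunc[of "up_ring.coeff ?P f", OF cfc] trunc_closed[of "up_ring.coeff ?P f", OF cfc]
        in \<open>auto simp del: trunc.simps\<close>)
  let ?\<phi> = "FEq (poly_term (up_ring.coeff ?P f) (Suc N)) Zero"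
  have "ex_holds R (\<lambda>r. r) ?\<phi>"
  proof (rule UP_localized_realize[OF ec R P.maximalideal_prime[OF Q(1)] J.is_ideal JQ gen inj])
    show "qparams ?\<phi> \<subseteq> carrier R"
      using tparams_poly_term[of "up_ring.coeff ?P f" "Suc N"] cfc by (auto simp del: poly_term.simps)
  next
    fix S :: "((nat \<Rightarrow> 'a) \<times> (nat \<Rightarrow> 'a)) ring" and g
    assume S: "cring S" and g: "g \<in> ring_hom ?P S" and gJ: "\<And>a. a \<in> ?J \<Longrightarrow> g a = \<zero>\<^bsub>S\<^esub>"
    have "term_val S (\<lambda>a. g (const a)) (\<lambda>_. g (mon \<one>\<^bsub>R\<^esub> 1)) (poly_term (up_ring.coeff ?P f) (Suc N)) = \<zero>\<^bsub>S\<^esub>"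
      using term_val_poly_term[OF g S cfc, where k = "Suc N"] trunc_f gJ[OF f_J] by (simp del: poly_term.simps trunc.simps)
    moreover have "g (mon \<one>\<^bsub>R\<^esub> 1) \<in> carrier S" using g by (auto simp: ring_hom_def)
    ultimately show "ex_holds S (\<lambda>a. g (const a)) ?\<phi>"
      unfolding ex_holds_def by (intro exI[of _ "\<lambda>_. g (mon \<one>\<^bsub>R\<^esub> 1)"]) (simp del: poly_term.simps)
  qed auto
  then obtain v where v: "\<forall>i. v i \<in> carrier R" "term_val R (\<lambda>r. r) v (poly_term (up_ring.coeff ?P f) (Suc N)) = \<zero>\<^bsub>R\<^esub>"
    unfolding ex_holds_def by (auto simp del: poly_term.simps)
  define x where "x = v 0"
  have x: "x \<in> carrier R" using v(1) by (simp add: x_def)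
  interpret ev: UP_pre_univ_prop R R id "UP R"
    by unfold_locales (auto simp: ring_hom_def)
  let ?ev = "UnivPoly.eval R R id x"
  have ev: "?ev \<in> ring_hom ?P R" by (rule ev.eval_ring_hom[OF x])
  have "term_val R (\<lambda>r. r) v (poly_term (up_ring.coeff ?P f) (Suc N)) = ?ev (trunc (up_ring.coeff ?P f) (Suc N))"
  proof (rule term_val_poly_term[OF ev R.cring_axioms cfc])
    show "a = ?ev (const a)" if "a \<in> carrier R" for a
      unfolding ev.eval_const[OF x that] by simp
    show "v 0 = ?ev (mon \<one>\<^bsub>R\<^esub> 1)"
      unfolding ev.eval_monom1[OF x] by (simp add: x_def)
  qed
  then have "?ev f = \<zero>\<^bsub>R\<^esub>" unfolding trunc_f v(2) by (rule sym)
  \<comment> \<open>Evaluation at \<open>x\<close> sends the constants from \<open>m\<close> and the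
    multiples of \<open>f\<close> into \<open>m\<close>, hence all of \<open>Q\<close>, to which
    \<open>f0\<close> belongs.\<close>
  let ?V = "{p \<in> carrier ?P. ?ev p \<in> max_ideal R}"
  have V: "ideal ?V ?P"
    by (rule ring_hom_ring.ideal_vimage[OF ring_hom_ringI2[OF P.ring_axioms R.ring_axioms ev] m.is_ideal])
  have "const ` max_ideal R \<union> ?J \<subseteq> ?V"
  proof -
    have "?J \<subseteq> ?V" using \<open>?ev f = _\<close> fc m.zero_closed by (intro P.cgenideal_minimal[OF V]) simp
    then show ?thesis using ev.eval_const[OF x] m.Icarr by auto
  qed
  then have "Q \<subseteq> ?V" using gen P.genideal_minimal[OF V] by blast
  then show ?thesis using that x Q(2) by blast
qed

text \<open>Lists in \<open>poly_ring\<close> start with the leading coefficient, so the head of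
  \<open>c # cs\<close> belongs to the exponent \<open>length cs\<close>.\<close>

primrec (in UP_cring) lift_poly :: "'a set list \<Rightarrow> nat \<Rightarrow> 'a" where
  "lift_poly [] = \<zero>\<^bsub>P\<^esub>"
| "lift_poly (c # cs) = lift_poly cs \<oplus>\<^bsub>P\<^esub> up_ring.monom P (coset_rep c) (length cs)"

lemma existentially_closed_residue_algebraically_closed:
  fixes R :: "'a ring"
  assumes ec: "existentially_closed (Art_le l) (Art_le l) R \<or> existentially_closed (Art_eq l) (Art_eq l) R"
    and R: "local_ring R" "comp_series R n I" "n \<le> l"
  shows "algebraically_closed (R Quot max_ideal R)"
proof -
  interpret R: cring R using R(1) by (rule local_ringD(1))
  interpret UP_cring R "UP R" by unfold_locales simp
  interpret m: maximalideal "max_ideal R" R using R(1) by (rule local_ringD(2))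
  let ?K = "R Quot max_ideal R" and ?m = "max_ideal R"
  have carK: "carrier ?K = (\<lambda>a. ?m +>\<^bsub>R\<^esub> a) ` carrier R"
    by (auto simp: FactRing_def A_RCOSETS_def')
  have zeroK: "\<zero>\<^bsub>?K\<^esub> = ?m" by (simp add: FactRing_def)
  interpret K: field ?K by (rule m.quotient_is_field[OF R.cring_axioms])
  interpret pr: ring_hom_cring R ?K "(+>\<^bsub>R\<^esub>) ?m" by (rule m.rcos_ring_hom_cring[OF R.cring_axioms])
  have rep: "coset_rep c \<in> carrier R" "?m +>\<^bsub>R\<^esub> coset_rep c = c" if c: "c \<in> carrier ?K" for c
  proof -
    obtain a where a: "a \<in> carrier R" and ca: "c = ?m +>\<^bsub>R\<^esub> a"
      using c unfolding carK by blast
    show "coset_rep c \<in> carrier R" unfolding ca by (rule m.coset_rep_cong(1)[OF a])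
    show "?m +>\<^bsub>R\<^esub> coset_rep c = c" unfolding ca by (rule m.coset_rep_cong(2)[OF a])
  qed
  have lift: "lift_poly cs \<in> carrier (UP R)" "\<And>i. i \<ge> length cs \<Longrightarrow> up_ring.coeff (UP R) (lift_poly cs) i = \<zero>\<^bsub>R\<^esub>"
    if "set cs \<subseteq> carrier ?K" for cs
    using that by (induction cs) (simp_all add: rep(1))
  show ?thesis
  proof (rule K.algebraically_closedI)
    fix p assume p: "p \<in> carrier (poly_ring ?K)" and deg: "degree p > 1"
    have pK: "set p \<subseteq> carrier ?K" and lead: "p \<noteq> [] \<Longrightarrow> hd p \<noteq> \<zero>\<^bsub>?K\<^esub>"
      using p unfolding univ_poly_carrier[symmetric] polynomial_def by auto
    obtain c cs where cs: "p = c # cs" using deg by (cases p) auto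
    have c: "c \<in> carrier ?K" "c \<noteq> \<zero>\<^bsub>?K\<^esub>" and csK: "set cs \<subseteq> carrier ?K" using pK lead cs by auto
    have N0: "length cs \<ge> 1" using deg cs by simp
    \<comment> \<open>The leading coefficient of \<open>p\<close> is a nonzero class, so its
      representative is outside \<open>m\<close> and the lift has positive degree modulo
      \<open>m\<close>.\<close>
    have "coset_rep c \<notin> ?m" using rep[OF c(1)] c(2) zeroK R.a_rcos_zero[OF m.is_ideal] by metis
    then have top: "up_ring.coeff (UP R) (lift_poly p) (length cs) \<notin> ?m"
      using lift[OF csK] rep[OF c(1)] by (simp add: cs)
    have above: "up_ring.coeff (UP R) (lift_poly p) i \<in> ?m" if "i > length cs" for i
      using lift(2)[OF pK, of i] that m.zero_closed by (simp add: cs)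
    obtain x where x: "x \<in> carrier R" "UnivPoly.eval R R id x (lift_poly p) \<in> ?m"
      using existentially_closed_residue_root[OF ec R lift(1)[OF pK] N0 top above] by blast
    interpret ev: UP_pre_univ_prop R R id "UP R"
      by unfold_locales (auto simp: ring_hom_def)
    define e where "e = UnivPoly.eval R R id x"
    have ev: "e \<in> ring_hom (UP R) R" unfolding e_def by (rule ev.eval_ring_hom[OF x(1)])
    have e_mon: "e (mon a k) = a \<otimes>\<^bsub>R\<^esub> x [^]\<^bsub>R\<^esub> k" if "a \<in> carrier R" for a k
      unfolding e_def ev.eval_monom[OF that x(1)] by simp
    have e_mem: "e (lift_poly p) \<in> ?m" unfolding e_def by (rule x(2))
    \<comment> \<open>Evaluation commutes with reduction modulo \<open>m\<close>. The induction
      admits arbitrary lists over the residue field, since the tail of a polynomial may begin with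
      zero and then is not an element of \<open>poly_ring\<close>.\<close>
    have "e (lift_poly cs) \<in> carrier R \<and> ?m +>\<^bsub>R\<^esub> e (lift_poly cs) = K.eval cs (?m +>\<^bsub>R\<^esub> x)"
      if "set cs \<subseteq> carrier ?K" for cs
      using that
    proof (induction cs)
      case Nil
      have "e \<zero>\<^bsub>UP R\<^esub> = \<zero>\<^bsub>R\<^esub>" by (rule ring_hom_zero[OF ev P.ring_axioms R.ring_axioms])
      then show ?case by simp
    next
      case (Cons a as)
      have a: "a \<in> carrier ?K" and as: "set as \<subseteq> carrier ?K" using Cons(2) by auto
      have "e (lift_poly (a # as)) = e (lift_poly as) \<oplus>\<^bsub>R\<^esub> e (mon (coset_rep a) (length as))"
        using ring_hom_add[OF ev lift(1)[OF as]] rep(1)[OF a] by simp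
      also have "e (mon (coset_rep a) (length as)) = coset_rep a \<otimes>\<^bsub>R\<^esub> x [^]\<^bsub>R\<^esub> length as"
        by (rule e_mon[OF rep(1)[OF a]])
      finally have eq: "e (lift_poly (a # as)) = e (lift_poly as) \<oplus>\<^bsub>R\<^esub> coset_rep a \<otimes>\<^bsub>R\<^esub> x [^]\<^bsub>R\<^esub> length as" .
      note IH = Cons(1)[OF as]
      have "?m +>\<^bsub>R\<^esub> e (lift_poly (a # as)) =
          (?m +>\<^bsub>R\<^esub> e (lift_poly as)) \<oplus>\<^bsub>?K\<^esub> (?m +>\<^bsub>R\<^esub> coset_rep a) \<otimes>\<^bsub>?K\<^esub> (?m +>\<^bsub>R\<^esub> x) [^]\<^bsub>?K\<^esub> length as"
        unfolding eq using IH rep(1)[OF a] x(1) by simp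
      also have "\<dots> = K.eval as (?m +>\<^bsub>R\<^esub> x) \<oplus>\<^bsub>?K\<^esub> a \<otimes>\<^bsub>?K\<^esub> (?m +>\<^bsub>R\<^esub> x) [^]\<^bsub>?K\<^esub> length as"
        using IH rep(2)[OF a] by simp
      also have "\<dots> = K.eval (a # as) (?m +>\<^bsub>R\<^esub> x)"
        using a K.eval_in_carrier[OF as] x(1) by (simp add: K.a_comm)
      finally show ?case using eq IH rep(1)[OF a] x(1) by simp
    qed
    from this[OF pK] have "K.eval p (?m +>\<^bsub>R\<^esub> x) = \<zero>\<^bsub>?K\<^esub>"
      using R.a_rcos_zero[OF m.is_ideal e_mem] zeroK by simp
    then show "\<exists>y\<in>carrier ?K. K.eval p y = \<zero>\<^bsub>?K\<^esub>" using x(1) by (intro bexI[of _ "?m +>\<^bsub>R\<^esub> x"]) auto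
  qed
qed

section \<open>The socle of an existentially closed ring\<close>

lemma existentially_closed_socle_generated:
  fixes R :: "'a ring"
  assumes ec: "existentially_closed (Art_le l) (Art_le l) R \<or> existentially_closed (Art_eq l) (Art_eq l) R"
    and R: "local_ring R" "comp_series R n I" "n \<le> l"
    and s: "s \<in> socle R" "s \<noteq> \<zero>\<^bsub>R\<^esub>" and t: "t \<in> socle R"
  shows "\<exists>x\<in>carrier R. x \<otimes>\<^bsub>R\<^esub> s = t"
proof (rule ccontr)
  assume indep: "\<not> ?thesis"
  interpret R: cring R using R(1) by (rule local_ringD(1))
  interpret UP_cring R "UP R" by unfold_locales simp
  let ?m = "max_ideal R" and ?P = "UP R"
  interpret m: ideal ?m R using R(1) by (rule local_ringD(3))
  have sc: "s \<in> carrier R" and tc: "t \<in> carrier R" using s t by (auto simp: socle_def annihilator_def)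
  have unit: "a \<in> Units R" if "a \<in> carrier R" "a \<notin> ?m" for a using local_ringD(5)[OF R(1) that] .
  have unit_cancel: "y = inv\<^bsub>R\<^esub> a \<otimes>\<^bsub>R\<^esub> z" if "a \<in> carrier R" "a \<notin> ?m" "y \<in> carrier R" "a \<otimes>\<^bsub>R\<^esub> y = z" for a y z
    using unit[OF that(1,2)] that by (metis R.Units_inv_closed R.Units_l_inv R.l_one R.m_assoc)
  \<comment> \<open>If \<open>s\<close> were a unit, \<open>t\<close> would be a multiple of it; if
    \<open>t\<close> were a unit, \<open>t \<otimes> s = \<zero>\<close> would force
    \<open>s = \<zero>\<close>. So both lie in \<open>m\<close>, and \<open>X s - t\<close> lies in
    \<open>m R[X]\<close>.\<close>
  have sm: "s \<in> ?m"
  proof (rule ccontr)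
    assume "s \<notin> ?m"
    then have "(t \<otimes>\<^bsub>R\<^esub> inv\<^bsub>R\<^esub> s) \<otimes>\<^bsub>R\<^esub> s = t" using unit[OF sc] sc tc by (simp add: R.m_assoc)
    then show False using indep unit[OF sc \<open>s \<notin> ?m\<close>] tc by (metis R.Units_inv_closed R.m_closed)
  qed
  have tm: "t \<in> ?m"
  proof (rule ccontr)
    assume "t \<notin> ?m"
    then have "s = inv\<^bsub>R\<^esub> t \<otimes>\<^bsub>R\<^esub> \<zero>\<^bsub>R\<^esub>" using unit_cancel[OF tc _ sc] socle_mult[OF t sm] by blast
    then show False using s(2) unit[OF tc \<open>t \<notin> ?m\<close>] by simp
  qed
  let ?M = "cf_ideal ?m"
  interpret M: ideal ?M ?P by (rule cf_ideal_ideal[OF m.is_ideal])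
  define f where "f = mon s 1 \<ominus>\<^bsub>?P\<^esub> const t"
  have fc: "f \<in> carrier ?P" using sc tc by (simp add: f_def)
  have fM: "f \<in> ?M"
  proof -
    have "cf (mon s 1) i \<in> ?m" "cf (const t) i \<in> ?m" for i
      using sm tm m.zero_closed unfolding coeff_monom[OF sc] coeff_monom[OF tc] by simp_all
    then have "mon s 1 \<in> ?M" "const t \<in> ?M"
      using monom_closed[OF sc] monom_closed[OF tc] unfolding cf_ideal_def by blast+
    then show ?thesis unfolding f_def by (rule M.minus_mem)
  qed
  let ?J = "cgenideal ?P f"
  interpret J: ideal ?J ?P by (rule P.cgenideal_ideal[OF fc])
  have f_J: "f \<in> ?J" by (rule P.cgenideal_self[OF fc])
  have JM: "?J \<subseteq> ?M" by (rule P.cgenideal_minimal[OF M.is_ideal fM])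
  have sub: "const ` ?m \<union> ?J \<subseteq> carrier ?P" using m.Icarr J.Icarr by auto
  have gen: "?M \<subseteq> genideal ?P (const ` ?m \<union> ?J)"
  proof -
    have "genideal ?P (const ` ?m) \<subseteq> genideal ?P (const ` ?m \<union> ?J)"
      using P.genideal_self[OF sub] by (intro P.genideal_minimal P.genideal_ideal[OF sub]) auto
    then show ?thesis using cf_ideal_le_genideal[of ?m] m.Icarr by blast
  qed
  have inj: "r = \<zero>\<^bsub>R\<^esub>" if u: "u \<in> carrier ?P" "u \<notin> ?M" and r: "r \<in> carrier R" and ur: "u \<otimes>\<^bsub>?P\<^esub> const r \<in> ?J" for u r
  proof (rule ccontr)
    assume "r \<noteq> \<zero>\<^bsub>R\<^esub>"
    then obtain c where c: "c \<in> carrier R" "c \<otimes>\<^bsub>R\<^esub> r \<in> socle R" "c \<otimes>\<^bsub>R\<^esub> r \<noteq> \<zero>\<^bsub>R\<^esub>"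
      using exists_multiple_in_socle[OF R(1,2) r] by blast
    define b where "b = c \<otimes>\<^bsub>R\<^esub> r"
    have b: "b \<in> carrier R" "b \<in> socle R" "b \<noteq> \<zero>\<^bsub>R\<^esub>" using c r by (auto simp: b_def)
    have "const b = const c \<otimes>\<^bsub>?P\<^esub> const r" using monom_mult[OF c(1) r, of 0 0] by (simp add: b_def)
    then have "u \<otimes>\<^bsub>?P\<^esub> const b = const c \<otimes>\<^bsub>?P\<^esub> (u \<otimes>\<^bsub>?P\<^esub> const r)"
      using u(1) r c(1) by (simp add: P.m_lcomm)
    then have ub: "u \<otimes>\<^bsub>?P\<^esub> const b \<in> ?J" using J.I_l_closed[OF ur] c(1) by simp
    then obtain q where q: "q \<in> carrier ?P" "u \<otimes>\<^bsub>?P\<^esub> const b = q \<otimes>\<^bsub>?P\<^esub> f" unfolding cgenideal_def by blast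
    have uc: "cf u i \<in> carrier R" and qc: "cf q i \<in> carrier R" for i using u q by simp_all
    have qf: "q \<otimes>\<^bsub>?P\<^esub> f = mon s 1 \<otimes>\<^bsub>?P\<^esub> q \<ominus>\<^bsub>?P\<^esub> q \<otimes>\<^bsub>?P\<^esub> const t"
      using q(1) sc tc P.m_comm[of q "mon s 1"]
      unfolding f_def by (simp add: P.minus_eq P.r_distr P.r_minus)
    \<comment> \<open>The coefficients of \<open>u b = q (X s - t)\<close>: the one at
      \<open>i\<close> is \<open>s\<close> times the previous coefficient of \<open>q\<close>, minus
      \<open>t\<close> times the coefficient at \<open>i\<close>. As \<open>s\<close> and
      \<open>t\<close> annihilate \<open>m\<close>, only the coefficients of \<open>q\<close>
      outside \<open>m\<close> contribute.\<close>
    have ubi: "cf u i \<otimes>\<^bsub>R\<^esub> b = cf (mon s 1 \<otimes>\<^bsub>?P\<^esub> q) i \<ominus>\<^bsub>R\<^esub> cf q i \<otimes>\<^bsub>R\<^esub> t" for i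
    proof -
      have "cf u i \<otimes>\<^bsub>R\<^esub> b = cf (u \<otimes>\<^bsub>?P\<^esub> const b) i"
        using cf_const_mult[OF UP_cring_axioms u(1) b(1)] by simp
      also have "\<dots> = cf (mon s 1 \<otimes>\<^bsub>?P\<^esub> q) i \<ominus>\<^bsub>R\<^esub> cf (q \<otimes>\<^bsub>?P\<^esub> const t) i"
        unfolding q(2) qf using q(1) sc tc by (simp del: coeff_mult)
      finally show ?thesis using cf_const_mult[OF UP_cring_axioms q(1) tc] by simp
    qed
    have qt: "cf q i \<otimes>\<^bsub>R\<^esub> t = \<zero>\<^bsub>R\<^esub>" "s \<otimes>\<^bsub>R\<^esub> cf q i = \<zero>\<^bsub>R\<^esub>" if "cf q i \<in> ?m" for i
      using socle_mult[OF t that] socle_mult[OF s(1) that] tc qc R.m_comm by auto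
    have s0: "cf (mon s 1 \<otimes>\<^bsub>?P\<^esub> q) 0 = \<zero>\<^bsub>R\<^esub>" using sc q(1) by simp
    have sS: "cf (mon s 1 \<otimes>\<^bsub>?P\<^esub> q) (Suc i) = s \<otimes>\<^bsub>R\<^esub> cf q i" for i
      using coeff_monom_mult[OF sc q(1), of 1 i] by (simp del: coeff_mult)
    \<comment> \<open>Otherwise \<open>u b = 0\<close>, although some coefficient of
      \<open>u\<close> is a unit and \<open>b\<close> is nonzero.\<close>
    have "\<exists>i. cf q i \<notin> ?m"
    proof (rule ccontr)
      assume all: "\<not> ?thesis"
      have "cf u i \<otimes>\<^bsub>R\<^esub> b = \<zero>\<^bsub>R\<^esub>" for i
        unfolding ubi using all qt s0 sS by (cases i) (auto simp: R.minus_eq simp del: coeff_mult)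
      moreover obtain j where "cf u j \<notin> ?m" using u unfolding cf_ideal_def by blast
      ultimately have "b = inv\<^bsub>R\<^esub> cf u j \<otimes>\<^bsub>R\<^esub> \<zero>\<^bsub>R\<^esub>" using unit_cancel[OF uc _ b(1)] by blast
      then show False using b(3) unit[OF uc \<open>cf u j \<notin> ?m\<close>] by simp
    qed
    then obtain i0 where i0: "cf q i0 \<notin> ?m" by blast
    \<comment> \<open>At the lowest coefficient of \<open>q\<close> outside \<open>m\<close> the
      contribution of \<open>s\<close> vanishes, and \<open>t\<close> turns out to be a multiple of
      \<open>b\<close>.\<close>
    define k where "k = (LEAST i. cf q i \<notin> ?m)"
    have k: "cf q k \<notin> ?m" unfolding k_def using i0 by (rule LeastI)
    have below: "cf q i \<in> ?m" if "i < k" for i using not_less_Least[of i] that unfolding k_def by blast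
    have "cf (mon s 1 \<otimes>\<^bsub>?P\<^esub> q) k = \<zero>\<^bsub>R\<^esub>"
      using s0 sS qt(2) below by (cases k) (auto simp del: coeff_mult)
    then have "cf u k \<otimes>\<^bsub>R\<^esub> b = \<ominus>\<^bsub>R\<^esub> (cf q k \<otimes>\<^bsub>R\<^esub> t)" using ubi[of k] qc tc by (simp add: R.minus_eq)
    then have "cf q k \<otimes>\<^bsub>R\<^esub> t = \<ominus>\<^bsub>R\<^esub> (cf u k \<otimes>\<^bsub>R\<^esub> b)" using qc tc by simp
    then have "t = inv\<^bsub>R\<^esub> cf q k \<otimes>\<^bsub>R\<^esub> (\<ominus>\<^bsub>R\<^esub> (cf u k \<otimes>\<^bsub>R\<^esub> b))" using unit_cancel[OF qc k tc] by blast
    then have tb: "t = \<ominus>\<^bsub>R\<^esub> (inv\<^bsub>R\<^esub> cf q k \<otimes>\<^bsub>R\<^esub> cf u k) \<otimes>\<^bsub>R\<^esub> b"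
      using unit[OF qc k] uc b(1) by (simp add: R.r_minus R.l_minus R.m_assoc)
    \<comment> \<open>One position above the highest coefficient of \<open>q\<close> outside
      \<open>m\<close> the contribution of \<open>t\<close> vanishes, and \<open>s\<close> turns out
      to be a multiple \<open>?w\<close> of \<open>b\<close>.\<close>
    obtain j where j: "cf q j \<notin> ?m" "\<And>i. i > j \<Longrightarrow> cf q i \<in> ?m" using exists_top_cf[OF m.is_ideal q(1) i0] by blast
    have "cf u (Suc j) \<otimes>\<^bsub>R\<^esub> b = s \<otimes>\<^bsub>R\<^esub> cf q j"
      using ubi[of "Suc j"] sS[of j] qt(1)[OF j(2)[of "Suc j"]] sc qc by (simp add: R.minus_eq del: coeff_mult)
    then have "s = inv\<^bsub>R\<^esub> cf q j \<otimes>\<^bsub>R\<^esub> (cf u (Suc j) \<otimes>\<^bsub>R\<^esub> b)"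
      using unit_cancel[OF qc j(1) sc] R.m_comm[OF qc sc] by metis
    then have sb: "(inv\<^bsub>R\<^esub> cf q j \<otimes>\<^bsub>R\<^esub> cf u (Suc j)) \<otimes>\<^bsub>R\<^esub> b = s"
      using unit[OF qc j(1)] uc b(1) by (simp add: R.m_assoc)
    let ?w = "inv\<^bsub>R\<^esub> cf q j \<otimes>\<^bsub>R\<^esub> cf u (Suc j)"
    have wc: "?w \<in> carrier R" using unit[OF qc j(1)] uc by simp
    \<comment> \<open>Since \<open>b\<close> is in the socle and \<open>s\<close> is nonzero,
      \<open>?w\<close> is a unit. Thus \<open>b\<close>, and with it \<open>t\<close>, is a
      multiple of \<open>s\<close>, against the assumption.\<close>
    have wm: "?w \<notin> ?m"
    proof
      assume "?w \<in> ?m"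
      then have "?w \<otimes>\<^bsub>R\<^esub> b = \<zero>\<^bsub>R\<^esub>" using socle_mult[OF b(2)] R.m_comm[OF wc b(1)] by simp
      then show False using sb s(2) by simp
    qed
    have "b = inv\<^bsub>R\<^esub> ?w \<otimes>\<^bsub>R\<^esub> s" using unit_cancel[OF wc wm b(1) sb] .
    then have "t = (\<ominus>\<^bsub>R\<^esub> (inv\<^bsub>R\<^esub> cf q k \<otimes>\<^bsub>R\<^esub> cf u k) \<otimes>\<^bsub>R\<^esub> inv\<^bsub>R\<^esub> ?w) \<otimes>\<^bsub>R\<^esub> s"
      using tb unit[OF qc k] unit[OF wc wm] uc sc
      by (metis R.Units_inv_closed R.a_inv_closed R.m_assoc R.m_closed)
    moreover have "\<ominus>\<^bsub>R\<^esub> (inv\<^bsub>R\<^esub> cf q k \<otimes>\<^bsub>R\<^esub> cf u k) \<otimes>\<^bsub>R\<^esub> inv\<^bsub>R\<^esub> ?w \<in> carrier R"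
      using unit[OF qc k] unit[OF wc wm] uc by simp
    ultimately show False using indep by metis
  qed
  let ?\<phi> = "FEq (Mul (Var 0) (Param s)) (Param t)"
  have "ex_holds R (\<lambda>r. r) ?\<phi>"
  proof (rule UP_localized_realize[OF ec R cf_ideal_max_prime[OF R(1)] J.is_ideal JM gen inj])
    show "qparams ?\<phi> \<subseteq> carrier R" using sc tc by simp
  next
    fix S :: "((nat \<Rightarrow> 'a) \<times> (nat \<Rightarrow> 'a)) ring" and g
    assume S: "cring S" and g: "g \<in> ring_hom ?P S" and gJ: "\<And>a. a \<in> ?J \<Longrightarrow> g a = \<zero>\<^bsub>S\<^esub>"
    interpret S: cring S by (rule S)
    interpret g: ring_hom_ring ?P S g by (rule ring_hom_ringI2[OF P.ring_axioms S.ring_axioms g])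
    have eq: "mon s 1 = f \<oplus>\<^bsub>?P\<^esub> const t"
    proof -
      have "a = (a \<ominus>\<^bsub>?P\<^esub> b) \<oplus>\<^bsub>?P\<^esub> b" if "a \<in> carrier ?P" "b \<in> carrier ?P" for a b using that by algebra
      then show ?thesis unfolding f_def using sc tc by simp
    qed
    have "mon s 1 = mon \<one>\<^bsub>R\<^esub> 1 \<otimes>\<^bsub>?P\<^esub> const s" using monom_mult[of "\<one>\<^bsub>R\<^esub>" s 1 0] sc by simp
    then have "g (mon \<one>\<^bsub>R\<^esub> 1) \<otimes>\<^bsub>S\<^esub> g (const s) = g (f \<oplus>\<^bsub>?P\<^esub> const t)"
      using g.hom_mult[of "mon \<one>\<^bsub>R\<^esub> 1" "const s"] eq sc by (metis R.one_closed monom_closed)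
    also have "\<dots> = g f \<oplus>\<^bsub>S\<^esub> g (const t)" using g.hom_add[OF fc, of "const t"] tc by simp
    also have "\<dots> = g (const t)" using gJ[OF f_J] g.hom_closed[of "const t"] tc by simp
    finally show "ex_holds S (\<lambda>a. g (const a)) ?\<phi>"
      unfolding ex_holds_def by (intro exI[of _ "\<lambda>_. g (mon \<one>\<^bsub>R\<^esub> 1)"]) simp
  qed auto
  then show False using indep unfolding ex_holds_def by auto
qed

section \<open>The length of an existentially closed ring\<close>

text \<open>One generator is taken for each step of the series in which \<open>I\<close> has a new
  element; any other element of \<open>I\<close> is reduced by it to the lower step.\<close>

lemma exists_finite_generators:
  fixes R (structure)
  assumes R: "cring R" and J: "comp_series R n J" and I: "ideal I R"
  obtains as where "set as \<subseteq> I" "\<And>K. ideal K R \<Longrightarrow> set as \<subseteq> K \<Longrightarrow> I \<subseteq> K"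
proof -
  interpret cring R by (rule R)
  interpret I: ideal I R by (rule I)
  have "i \<le> n \<Longrightarrow> \<exists>as. set as \<subseteq> I \<and> (\<forall>K. ideal K R \<and> set as \<subseteq> K \<longrightarrow> I \<inter> J i \<subseteq> K)" for i
  proof (induction i)
    case 0
    have "I \<inter> J 0 \<subseteq> K" if "ideal K R" for K
      using J additive_subgroup.zero_closed[OF ideal.axioms(1)[OF that]] by (auto simp: comp_series_def)
    then show ?case by (intro exI[of _ "[]"]) auto
  next
    case (Suc i)
    then obtain as where as: "set as \<subseteq> I" "\<And>K. ideal K R \<Longrightarrow> set as \<subseteq> K \<Longrightarrow> I \<inter> J i \<subseteq> K" by auto
    show ?case
    proof (cases "I \<inter> J (Suc i) \<subseteq> J i")
      case True
      then have "I \<inter> J (Suc i) \<subseteq> K" if "ideal K R" "set as \<subseteq> K" for K using as(2)[OF that] by blast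
      then show ?thesis using as(1) by blast
    next
      case False
      then obtain y where y: "y \<in> I" "y \<in> J (Suc i)" "y \<notin> J i" by blast
      have "I \<inter> J (Suc i) \<subseteq> K" if K: "ideal K R" "set (y # as) \<subseteq> K" for K
      proof
        interpret K: ideal K R by (rule K(1))
        fix x assume x: "x \<in> I \<inter> J (Suc i)"
        obtain r where r: "r \<in> carrier R" "x \<ominus> r \<otimes> y \<in> J i"
          using J Suc.prems x y unfolding comp_series_def simple_step_def by (metis DiffI IntD2 Suc_le_lessD)
        have "x \<ominus> r \<otimes> y \<in> I" using I.minus_mem[OF _ I.I_l_closed[OF y(1) r(1)]] x by blast
        then have "x \<ominus> r \<otimes> y \<in> K" using as(2)[OF K(1)] K(2) r(2) by auto
        moreover have "r \<otimes> y \<in> K" using K.I_l_closed[of y r] K(2) r(1) by simp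
        ultimately show "x \<in> K" using K.mem_of_minus_mem[of x "r \<otimes> y"] x I.Icarr by blast
      qed
      then show ?thesis using as(1) y(1) by (intro exI[of _ "y # as"]) auto
    qed
  qed
  from this[of n] obtain as where as: "set as \<subseteq> I" "\<And>K. ideal K R \<Longrightarrow> set as \<subseteq> K \<Longrightarrow> I \<inter> J n \<subseteq> K" by auto
  have "I \<inter> J n = I" using J I.Icarr by (auto simp: comp_series_def)
  then show ?thesis using that as by simp
qed

lemma qf_holds_foldr_FAnd:
  "qf_holds S h v (foldr (\<lambda>a. FAnd (\<psi> a)) as \<phi>) \<longleftrightarrow> (\<forall>a\<in>set as. qf_holds S h v (\<psi> a)) \<and> qf_holds S h v \<phi>"
  by (induction as) auto

lemma qparams_foldr_FAnd: "qparams (foldr (\<lambda>a. FAnd (\<psi> a)) as \<phi>) = (\<Union>a\<in>set as. qparams (\<psi> a)) \<union> qparams \<phi>"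
  by (induction as) auto

lemma existentially_closed_length:
  fixes R :: "'a ring"
  assumes ec: "existentially_closed (Art_le l) (Art_le l) R \<or> existentially_closed (Art_eq l) (Art_eq l) R"
    and R: "artinian_local_ring R" "ring_length R = enat n" and less: "n < l"
  shows False
proof -
  have loc: "local_ring R" using R(1) by (simp add: artinian_local_ring_def)
  interpret R: cring R using loc by (rule local_ringD(1))
  let ?m = "max_ideal R"
  interpret m: ideal ?m R using loc by (rule local_ringD(3))
  interpret soc: ideal "socle R" R using loc by (rule socle_ideal)
  \<comment> \<open>The value zero is taken only if the socle meets \<open>m\<close> trivially; this
    lets both cases end in the same contradiction.\<close>
  obtain s where s: "s \<in> socle R" "s \<in> ?m"
    and s_max: "s = \<zero>\<^bsub>R\<^esub> \<Longrightarrow> socle R \<inter> ?m \<subseteq> {\<zero>\<^bsub>R\<^esub>}"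
  proof (cases "socle R \<inter> ?m \<subseteq> {\<zero>\<^bsub>R\<^esub>}")
    case True
    then show ?thesis using that[of "\<zero>\<^bsub>R\<^esub>"] soc.zero_closed m.zero_closed by blast
  next
    case False
    then show ?thesis using that by blast
  qed
  interpret X: root_extension R s by unfold_locales (rule loc s)+
  obtain J where J: "comp_series R n J" using exists_comp_series[OF R.cring_axioms R(2)] by blast
  obtain as where as: "set as \<subseteq> ?m" "\<And>K. ideal K R \<Longrightarrow> set as \<subseteq> K \<Longrightarrow> ?m \<subseteq> K"
    using exists_finite_generators[OF R.cring_axioms J m.is_ideal] by blast
  \<comment> \<open>The unknown annihilates generators of \<open>m\<close>, is nonzero and has
    square \<open>s\<close>. The inequation matters for \<open>s = \<zero>\<close>, where zero would
    be a solution.\<close>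
  let ?\<phi> = "foldr (\<lambda>a. FAnd (FEq (Mul (Var 0) (Param a)) Zero)) as
    (FAnd (FNot (FEq (Var 0) Zero)) (FEq (Mul (Var 0) (Var 0)) (Param s)))"
  let ?h = "\<lambda>a. (a, X.pr \<zero>\<^bsub>R\<^esub>)"
  \<comment> \<open>An element \<open>a + c X\<close> is coded by the list of \<open>a\<close> and a
    representative of \<open>c\<close>.\<close>
  let ?g = "(\<lambda>(a, b). [a, b]) \<circ> (\<lambda>(a, c). (a, coset_rep c))"
  have "ex_holds R (\<lambda>r. r) ?\<phi>"
  proof (rule existentially_closed_realize[OF ec])
    show "artinian_local_ring X.S" "ring_length X.S \<le> enat l"
      using X.S_artinian_local[OF R] less by simp_all
    show "?h \<in> ring_hom R X.S" by (rule X.embed_hom)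
    show "inj_on ?h (carrier R)" by (simp add: inj_on_def)
    show "inj_on ?g (carrier X.S)"
      by (rule comp_inj_on[OF X.inj_on_pair_coset_rep]) (auto simp: inj_on_def)
    show "qparams ?\<phi> \<subseteq> carrier R" using as(1) m.Icarr s(2) by (auto simp: qparams_foldr_FAnd)
    have "qf_holds X.S ?h (\<lambda>_. X.root) ?\<phi>"
      unfolding qf_holds_foldr_FAnd
      using as(1) X.max_ideal_mult_root X.root_square X.root_ne_zero by auto
    then show "ex_holds X.S ?h ?\<phi>"
      unfolding ex_holds_def using X.root_closed by (intro exI[of _ "\<lambda>_. X.root"] conjI allI)
  qed
  then obtain v where v: "\<forall>i. v i \<in> carrier R" "qf_holds R (\<lambda>r. r) v ?\<phi>" unfolding ex_holds_def by blast
  define x where "x = v 0"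
  have x: "x \<in> carrier R" "x \<noteq> \<zero>\<^bsub>R\<^esub>" "x \<otimes>\<^bsub>R\<^esub> x = s" and xa: "\<And>a. a \<in> set as \<Longrightarrow> x \<otimes>\<^bsub>R\<^esub> a = \<zero>\<^bsub>R\<^esub>"
    using v unfolding qf_holds_foldr_FAnd by (auto simp: x_def)
  have xm: "x \<otimes>\<^bsub>R\<^esub> a = \<zero>\<^bsub>R\<^esub>" if "a \<in> ?m" for a
  proof -
    have "ideal {a \<in> carrier R. a \<otimes>\<^bsub>R\<^esub> x \<in> {\<zero>\<^bsub>R\<^esub>}} R" by (rule R.colon_ideal[OF R.zeroideal x(1)])
    moreover have "set as \<subseteq> {a \<in> carrier R. a \<otimes>\<^bsub>R\<^esub> x \<in> {\<zero>\<^bsub>R\<^esub>}}"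
    proof
      fix a assume a: "a \<in> set as"
      then have ac: "a \<in> carrier R" using as(1) m.Icarr by blast
      then show "a \<in> {a \<in> carrier R. a \<otimes>\<^bsub>R\<^esub> x \<in> {\<zero>\<^bsub>R\<^esub>}}" using xa[OF a] R.m_comm[OF ac x(1)] by simp
    qed
    ultimately have "a \<in> {a \<in> carrier R. a \<otimes>\<^bsub>R\<^esub> x \<in> {\<zero>\<^bsub>R\<^esub>}}" using as(2) that by blast
    then show ?thesis using R.m_comm[OF _ x(1), of a] by simp
  qed
  have xs: "x \<in> socle R" using x(1) xm unfolding socle_def annihilator_def by blast
  \<comment> \<open>A unit \<open>x\<close> is impossible, because \<open>x\<close> annihilates
    \<open>m\<close> and \<open>s = x^2\<close> lies in \<open>m\<close>, so that
    \<open>x^3 = 0\<close>.\<close>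
  have "x \<in> ?m"
  proof (rule ccontr)
    assume "x \<notin> ?m"
    then have u: "x \<in> Units R" using local_ringD(5)[OF loc] x(1) by blast
    have "x \<otimes>\<^bsub>R\<^esub> (x \<otimes>\<^bsub>R\<^esub> x) = \<zero>\<^bsub>R\<^esub>" using xm[OF s(2)] x(3) by simp
    then have "x = inv\<^bsub>R\<^esub> x \<otimes>\<^bsub>R\<^esub> (inv\<^bsub>R\<^esub> x \<otimes>\<^bsub>R\<^esub> \<zero>\<^bsub>R\<^esub>)"
      using u x(1) by (metis R.Units_inv_closed R.Units_l_inv R.l_one R.m_assoc R.m_closed)
    then show False using x(2) u by simp
  qed
  \<comment> \<open>Now \<open>x\<close> lies in \<open>m\<close> and annihilates \<open>m\<close>,
    so its square is zero; but then \<open>x\<close> is a nonzero element of the socle in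
    \<open>m\<close>, which the choice of \<open>s\<close> excludes.\<close>
  then have "s = \<zero>\<^bsub>R\<^esub>" using xm x(3) by metis
  then show False using s_max xs \<open>x \<in> ?m\<close> x(2) by blast
qed

theorem theorem1p6:
  fixes l :: nat and R :: "'a ring"
  assumes "l \<ge> 1"
    and "existentially_closed (Art_le l) (Art_le l) R \<or>
         existentially_closed (Art_eq l) (Art_eq l) R"
  shows "algebraically_closed (R Quot (max_ideal R)) \<and>
         gorenstein R \<and>
         ring_length R = enat l"
proof -
  note ec = assms(2)
  have art: "artinian_local_ring R" and le: "ring_length R \<le> enat l"
    using ec by (auto simp: existentially_closed_def Art_le_def Art_eq_def)
  obtain n where n: "ring_length R = enat n" "n \<le> l" using le by (cases "ring_length R") auto
  have loc: "local_ring R" using art by (simp add: artinian_local_ring_def)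
  interpret R: cring R using loc by (rule local_ringD(1))
  interpret soc: ideal "socle R" R using loc by (rule socle_ideal)
  obtain J where J: "comp_series R n J" using exists_comp_series[OF R.cring_axioms n(1)] by blast
  have "n = l" using existentially_closed_length[OF ec art n(1)] n(2) by fastforce
  moreover have "principalideal (socle R) R"
  proof -
    \<comment> \<open>A nonzero multiple of \<open>\<one>\<close> in the socle shows that the socle
      is nonzero, and each of its nonzero elements generates it.\<close>
    have "\<one>\<^bsub>R\<^esub> \<noteq> \<zero>\<^bsub>R\<^esub>"
      using local_ringD(3,4)[OF loc] by (metis additive_subgroup.zero_closed ideal.axioms(1))
    then obtain c where c: "c \<in> carrier R" "c \<otimes>\<^bsub>R\<^esub> \<one>\<^bsub>R\<^esub> \<in> socle R" "c \<otimes>\<^bsub>R\<^esub> \<one>\<^bsub>R\<^esub> \<noteq> \<zero>\<^bsub>R\<^esub>"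
      using exists_multiple_in_socle[OF loc J R.one_closed] by blast
    then have s: "c \<in> socle R" "c \<noteq> \<zero>\<^bsub>R\<^esub>" by auto
    have "socle R = cgenideal R c"
    proof
      show "socle R \<subseteq> cgenideal R c"
        using existentially_closed_socle_generated[OF ec loc J n(2) s] unfolding cgenideal_def by blast
      show "cgenideal R c \<subseteq> socle R" by (rule R.cgenideal_minimal[OF soc.is_ideal s(1)])
    qed
    then show ?thesis using R.cgenideal_is_principalideal[OF c(1)] by simp
  qed
  ultimately show ?thesis
    using existentially_closed_residue_algebraically_closed[OF ec loc J n(2)] art n(1)
    by (simp add: gorenstein_def)
qed

end
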